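(* Let $n,m\ge1$ and let $a_1,\dots,a_n,b_1,\dots,b_n$ be nonnegative integers with $b_i\geq a_i$ for all $i$. There is an open immersion $Y\hookrightarrow X$ of the families $Y=Y_{\pmb a,\pmb b,m}$ and $X=X_{\pmb a,\pmb b,m}$, defined by the identity on $x_1,\dots,x_n$ and $$y_d=\frac{y^{m/d}}{\prod_{e:\ d\mid e\mid m}f_{\pmb a,\pmb b,e}(x_1,\dots,x_n)^{e/d}}\qquad\text{for each } d\mid m.$$ The birational inverse (defined where all $x_i\ne1$) is given by the identity on $x_1,\dots,x_n$ and $$y=y_m\,f_{\pmb a,\pmb b,m}(x_1,\dots,x_n).$$ Moreover, the action of $\mu_m$ on $Y$ by $y\mapsto\zeta_my$ extends to $X$, equivariantly for this open immersion.
   Context: All objects are families over $\mathbb Z[1/m]$ with parameter $t\in\mathbb P^1\smallsetminus\{0,1,\infty\}$. $V$ is defined by $tx_1\cdots x_n=1$ with all $x_i\neq0$ (invertible), and $U\subseteq V$ is the open subset where moreover all $x_i\ne1$ (i.e. $1-x_i$ is invertible). $Y\subseteq U\times\mathbb A^1$ is the hypersurface $$y^m=f_{\pmb a,\pmb b}(x)=\prod_{i=1}^n(-x_i)^{a_i}(1-x_i)^{b_i-a_i}.$$ For a positive divisor $e\mid m$ put $$f_{\pmb a,\pmb b,e}(x)=\prod_{i:\gcd(m,a_i)=e}(-x_i)^{a_i/e}\prod_{i:\gcd(m,b_i-a_i)=e}(1-x_i)^{(b_i-a_i)/e},$$ so that $f_{\pmb a,\pmb b}=\prod_{e\mid m}f_{\pmb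 a,\pmb b,e}^{\,e}$. $X\subseteq V\times\mathbb A^{\tau(m)}$, with affine coordinates $y_d$ indexed by the positive divisors $d\mid m$ ($\tau(m)$ of them), is cut out by $y_1=1$ and, for all $h\mid d\mid m$, $$y_d^{d/h}=y_h\prod_{e\mid m,\ h\mid e,\ d\nmid e}f_{\pmb a,\pmb b,e}(x)^{e/h}.$$ *)

theory Defs
  imports
    "HOL-Analysis.Abstract_Topology"
    "HOL-Algebra.QuotRing"
    "HOL-Library.Poly_Mapping"
begin

section \<open>Ringed spaces and their morphisms\<close>

text \<open>
  The data of a (locally) ringed space: a topology, the ring of sections over each open set
  (values at non-open sets are irrelevant), and \<open>rs_res M U V\<close>, the restriction map from
  sections over \<open>U\<close> to sections over \<open>V \<subseteq> U\<close>.
\<close>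

record ('p, 's) ringed_space =
  rs_top :: "'p topology"
  rs_sec :: "'p set \<Rightarrow> 's ring"
  rs_res :: "'p set \<Rightarrow> 'p set \<Rightarrow> 's \<Rightarrow> 's"

abbreviation rs_points :: "('p, 's) ringed_space \<Rightarrow> 'p set"
  where "rs_points M \<equiv> topspace (rs_top M)"

text \<open>
  A morphism from \<open>M\<close> (points \<open>'p\<close>, sections \<open>'s\<close>) to \<open>N\<close> (points \<open>'q\<close>, sections \<open>'t\<close>);
  \<open>pb F W\<close> is the pullback of sections over the open set \<open>W\<close> of \<open>N\<close>.
\<close>

record ('p, 's, 'q, 't) rs_morph =
  pt :: "'p \<Rightarrow> 'q"
  pb :: "'q set \<Rightarrow> 't \<Rightarrow> 's"

definition preim :: "('p, 's) ringed_space \<Rightarrow> ('p \<Rightarrow> 'q) \<Rightarrow> 'q set \<Rightarrow> 'p set"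
  where "preim M f W = {x \<in> rs_points M. f x \<in> W}"

text \<open>A section over \<open>W\<close> whose germ at \<open>x\<close> is a unit of the stalk.\<close>

definition unit_germ :: "('p, 's) ringed_space \<Rightarrow> 'p \<Rightarrow> 'p set \<Rightarrow> 's \<Rightarrow> bool"
  where "unit_germ M x W s \<longleftrightarrow>
    (\<exists>W'. openin (rs_top M) W' \<and> W' \<subseteq> W \<and> x \<in> W' \<and> rs_res M W W' s \<in> Units (rs_sec M W'))"

text \<open>
  Morphisms of locally ringed spaces.  The last conjunct says that the induced maps of stalks are
  local homomorphisms.
\<close>

definition lrs_morphism ::
  "('p, 's) ringed_space \<Rightarrow> ('q, 't) ringed_space \<Rightarrow> ('p, 's, 'q, 't) rs_morph \<Rightarrow> bool"
  where "lrs_morphism M N F \<longleftrightarrow>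
    continuous_map (rs_top M) (rs_top N) (pt F) \<and>
    (\<forall>W. openin (rs_top N) W \<longrightarrow>
       pb F W \<in> ring_hom (rs_sec N W) (rs_sec M (preim M (pt F) W))) \<and>
    (\<forall>W W'. openin (rs_top N) W \<longrightarrow> openin (rs_top N) W' \<longrightarrow> W' \<subseteq> W \<longrightarrow>
       (\<forall>s \<in> carrier (rs_sec N W).
          pb F W' (rs_res N W W' s) =
          rs_res M (preim M (pt F) W) (preim M (pt F) W') (pb F W s))) \<and>
    (\<forall>x \<in> rs_points M. \<forall>W. openin (rs_top N) W \<longrightarrow> pt F x \<in> W \<longrightarrow>
       (\<forall>s \<in> carrier (rs_sec N W).
          unit_germ M x (preim M (pt F) W) (pb F W s) \<longrightarrow> unit_germ N (pt F x) W s))"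

definition id_morph :: "('p, 's, 'p, 's) rs_morph"
  where "id_morph = \<lparr>pt = (\<lambda>x. x), pb = (\<lambda>W s. s)\<rparr>"

text \<open>The composite of \<open>F\<close> from \<open>M\<close> to \<open>N\<close> and \<open>G\<close> from \<open>N\<close> to a third space; the argument \<open>N\<close> is needed
  to form preimages.\<close>

definition comp_morph ::
  "('q, 't) ringed_space \<Rightarrow> ('q, 't, 'r, 'u) rs_morph \<Rightarrow> ('p, 's, 'q, 't) rs_morph
    \<Rightarrow> ('p, 's, 'r, 'u) rs_morph"
  where "comp_morph N G F =
    \<lparr>pt = (\<lambda>x. pt G (pt F x)), pb = (\<lambda>W s. pb F (preim N (pt G) W) (pb G W s))\<rparr>"

text \<open>Equality of morphisms from \<open>M\<close> to \<open>N\<close>, ignoring junk values outside the carriers.\<close>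

definition eq_morph ::
  "('p, 's) ringed_space \<Rightarrow> ('q, 't) ringed_space \<Rightarrow> ('p, 's, 'q, 't) rs_morph
    \<Rightarrow> ('p, 's, 'q, 't) rs_morph \<Rightarrow> bool"
  where "eq_morph M N F G \<longleftrightarrow>
    (\<forall>x \<in> rs_points M. pt F x = pt G x) \<and>
    (\<forall>W. openin (rs_top N) W \<longrightarrow> (\<forall>s \<in> carrier (rs_sec N W). pb F W s = pb G W s))"

definition lrs_inverse ::
  "('p, 's) ringed_space \<Rightarrow> ('q, 't) ringed_space \<Rightarrow> ('p, 's, 'q, 't) rs_morph
    \<Rightarrow> ('q, 't, 'p, 's) rs_morph \<Rightarrow> bool"
  where "lrs_inverse M N F G \<longleftrightarrow>
    lrs_morphism M N F \<and> lrs_morphism N M G \<and>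
    eq_morph M M (comp_morph N G F) id_morph \<and> eq_morph N N (comp_morph M F G) id_morph"

definition open_subspace :: "('p, 's) ringed_space \<Rightarrow> 'p set \<Rightarrow> ('p, 's) ringed_space"
  where "open_subspace M W = M\<lparr>rs_top := subtopology (rs_top M) W\<rparr>"

text \<open>
  An open immersion induces an isomorphism onto an open subspace of the target.  The same record
  \<open>F\<close> also serves as the corestricted morphism, because the open sets of \<open>open_subspace N W\<close> are
  the open sets of \<open>N\<close> contained in \<open>W\<close>, with the same sections.
\<close>

definition open_immersion ::
  "('p, 's) ringed_space \<Rightarrow> ('q, 't) ringed_space \<Rightarrow> ('p, 's, 'q, 't) rs_morph \<Rightarrow> bool"
  where "open_immersion M N F \<longleftrightarrow>
    lrs_morphism M N F \<and>
    (\<exists>W G. openin (rs_top N) W \<and> lrs_inverse M (open_subspace N W) F G)"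


section \<open>The spectrum of a commutative ring\<close>

definition prime_spec :: "('a, 'm) ring_scheme \<Rightarrow> 'a set set"
  where "prime_spec A = {p. primeideal p A}"

definition zariski :: "('a, 'm) ring_scheme \<Rightarrow> 'a set topology"
  where "zariski A =
    topology (\<lambda>W. \<exists>E \<subseteq> carrier A. W = {p \<in> prime_spec A. \<not> E \<subseteq> p})"

lemma istopology_zariski:
  "istopology (\<lambda>W. \<exists>E \<subseteq> carrier A. W = {p \<in> prime_spec A. \<not> E \<subseteq> p})"
  unfolding istopology_def
proof (intro conjI allI impI)
  fix S T
  assume S: "\<exists>E \<subseteq> carrier A. S = {p \<in> prime_spec A. \<not> E \<subseteq> p}"
    and T: "\<exists>E \<subseteq> carrier A. T = {p \<in> prime_spec A. \<not> E \<subseteq> p}"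
  from S obtain E where E: "E \<subseteq> carrier A" "S = {p \<in> prime_spec A. \<not> E \<subseteq> p}"
    by (elim exE conjE)
  from T obtain E' where E': "E' \<subseteq> carrier A" "T = {p \<in> prime_spec A. \<not> E' \<subseteq> p}"
    by (elim exE conjE)
  define EE where "EE = {x \<otimes>\<^bsub>A\<^esub> y | x y. x \<in> E \<and> y \<in> E'}"
  have key: "\<not> EE \<subseteq> p \<longleftrightarrow> \<not> E \<subseteq> p \<and> \<not> E' \<subseteq> p" if "p \<in> prime_spec A" for p
  proof -
    interpret primeideal p A using that by (simp add: prime_spec_def)
    have "x \<otimes>\<^bsub>A\<^esub> y \<in> p \<longleftrightarrow> x \<in> p \<or> y \<in> p" if "x \<in> E" "y \<in> E'" for x y
      using I_prime[of x y] I_l_closed[of y x] I_r_closed[of x y] subsetD[OF E(1) that(1)]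
        subsetD[OF E'(1) that(2)] by argo
    then show ?thesis unfolding EE_def by blast
  qed
  show "\<exists>E \<subseteq> carrier A. S \<inter> T = {p \<in> prime_spec A. \<not> E \<subseteq> p}"
  proof (cases "prime_spec A = {}")
    case True
    then have "S \<inter> T = {p \<in> prime_spec A. \<not> {} \<subseteq> p}" by (simp add: E(2))
    then show ?thesis by (intro exI[of _ "{}"]) simp
  next
    case False
    then obtain p where "primeideal p A" unfolding prime_spec_def by fast
    then interpret primeideal p A .
    have "EE \<subseteq> carrier A" using E(1) E'(1) by (auto simp: EE_def)
    moreover have "S \<inter> T = {p \<in> prime_spec A. \<not> EE \<subseteq> p}"
      unfolding E(2) E'(2) using key by auto
    ultimately show ?thesis by (intro exI conjI)
  qed
next
  fix \<K>
  assume K: "\<forall>K\<in>\<K>. \<exists>E \<subseteq> carrier A. K = {p \<in> prime_spec A. \<not> E \<subseteq> p}"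
  define EE where "EE = \<Union>{E. E \<subseteq> carrier A \<and> {p \<in> prime_spec A. \<not> E \<subseteq> p} \<in> \<K>}"
  have "\<Union>\<K> = {p \<in> prime_spec A. \<not> EE \<subseteq> p}"
  proof (intro equalityI subsetI)
    fix p assume "p \<in> \<Union>\<K>"
    then obtain L where L: "L \<in> \<K>" "p \<in> L" by blast
    from bspec[OF K L(1)] obtain E
      where E: "E \<subseteq> carrier A" "L = {p \<in> prime_spec A. \<not> E \<subseteq> p}" by (elim exE conjE)
    have "E \<subseteq> EE" unfolding EE_def using L(1) E(1) unfolding E(2) by (intro Union_upper) simp
    then show "p \<in> {p \<in> prime_spec A. \<not> EE \<subseteq> p}" using L(2) unfolding E(2) by auto
  next
    fix p assume p: "p \<in> {p \<in> prime_spec A. \<not> EE \<subseteq> p}"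
    then obtain x E where "x \<in> E" "x \<notin> p" "{p \<in> prime_spec A. \<not> E \<subseteq> p} \<in> \<K>"
      unfolding EE_def by blast
    then show "p \<in> \<Union>\<K>" using p by (intro UnionI) auto
  qed
  moreover have "EE \<subseteq> carrier A" by (auto simp: EE_def)
  ultimately show "\<exists>E \<subseteq> carrier A. \<Union>\<K> = {p \<in> prime_spec A. \<not> E \<subseteq> p}"
    by (intro exI conjI)
qed

lemma openin_zariski:
  "openin (zariski A) W \<longleftrightarrow> (\<exists>E \<subseteq> carrier A. W = {p \<in> prime_spec A. \<not> E \<subseteq> p})"
  using istopology_zariski[of A] by (simp add: zariski_def topology_inverse')

text \<open>The fraction \<open>a/s\<close> in the localization of \<open>A\<close> at the prime \<open>p\<close>, as an equivalence class.\<close>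

definition frac :: "('a, 'm) ring_scheme \<Rightarrow> 'a set \<Rightarrow> 'a \<Rightarrow> 'a \<Rightarrow> ('a \<times> 'a) set"
  where "frac A p a s = {(b, t). b \<in> carrier A \<and> t \<in> carrier A - p \<and>
    (\<exists>u \<in> carrier A - p. u \<otimes>\<^bsub>A\<^esub> (a \<otimes>\<^bsub>A\<^esub> t) = u \<otimes>\<^bsub>A\<^esub> (b \<otimes>\<^bsub>A\<^esub> s))}"

text \<open>The unions below range over all representatives; the sets united are all equal.\<close>

definition loc :: "('a, 'm) ring_scheme \<Rightarrow> 'a set \<Rightarrow> ('a \<times> 'a) set ring"
  where "loc A p =
    \<lparr>carrier = {frac A p a s | a s. a \<in> carrier A \<and> s \<in> carrier A - p},
     mult = (\<lambda>c d. \<Union>(a, s)\<in>c. \<Union>(b, t)\<in>d. frac A p (a \<otimes>\<^bsub>A\<^esub> b) (s \<otimes>\<^bsub>A\<^esub> t)),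
     one = frac A p \<one>\<^bsub>A\<^esub> \<one>\<^bsub>A\<^esub>,
     zero = frac A p \<zero>\<^bsub>A\<^esub> \<one>\<^bsub>A\<^esub>,
     add = (\<lambda>c d. \<Union>(a, s)\<in>c. \<Union>(b, t)\<in>d.
              frac A p ((a \<otimes>\<^bsub>A\<^esub> t) \<oplus>\<^bsub>A\<^esub> (b \<otimes>\<^bsub>A\<^esub> s)) (s \<otimes>\<^bsub>A\<^esub> t))\<rparr>"

type_synonym 'a spec_sec = "'a set \<Rightarrow> ('a \<times> 'a) set"

text \<open>Sections of the structure sheaf: families of elements of the localizations that are locally
  given by a fraction.\<close>

definition spec_sections :: "('a, 'm) ring_scheme \<Rightarrow> 'a set set \<Rightarrow> 'a spec_sec ring"
  where "spec_sections A W =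
    \<lparr>carrier = {\<sigma> \<in> (\<Pi>\<^sub>E p\<in>W. carrier (loc A p)).
        \<forall>p\<in>W. \<exists>W'. openin (zariski A) W' \<and> W' \<subseteq> W \<and> p \<in> W' \<and>
          (\<exists>a \<in> carrier A. \<exists>s \<in> carrier A. \<forall>q\<in>W'. s \<notin> q \<and> \<sigma> q = frac A q a s)},
     mult = (\<lambda>\<sigma> \<tau>. \<lambda>p\<in>W. \<sigma> p \<otimes>\<^bsub>loc A p\<^esub> \<tau> p),
     one = (\<lambda>p\<in>W. \<one>\<^bsub>loc A p\<^esub>),
     zero = (\<lambda>p\<in>W. \<zero>\<^bsub>loc A p\<^esub>),
     add = (\<lambda>\<sigma> \<tau>. \<lambda>p\<in>W. \<sigma> p \<oplus>\<^bsub>loc A p\<^esub> \<tau> p)\<rparr>"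

definition Spec :: "('a, 'm) ring_scheme \<Rightarrow> ('a set, 'a spec_sec) ringed_space"
  where "Spec A = \<lparr>rs_top = zariski A, rs_sec = spec_sections A, rs_res = (\<lambda>W W' \<sigma>. restrict \<sigma> W')\<rparr>"

text \<open>The section over \<open>W\<close> defined by an element \<open>c\<close> of the ring.\<close>

definition regular :: "('a, 'm) ring_scheme \<Rightarrow> 'a set set \<Rightarrow> 'a \<Rightarrow> 'a spec_sec"
  where "regular A W c = (\<lambda>p\<in>W. frac A p c \<one>\<^bsub>A\<^esub>)"


section \<open>Affine schemes given by coordinates and equations\<close>

text \<open>
  Coordinates: the parameter \<open>t\<close>, the \<open>x\<^sub>i\<close>, \<open>y\<close>, the \<open>y\<^sub>d\<close>, coordinates \<open>z\<^sub>j\<close> on copies of the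
  group scheme of \<open>m\<close>-th roots of unity, and inverses of \<open>m\<close>, \<open>t\<close>, \<open>1 - t\<close>, \<open>x\<^sub>i\<close>, \<open>1 - x\<^sub>i\<close>.
\<close>

datatype coord =
    C_t | C_inv_m | C_inv_t | C_inv_1t
  | C_x nat | C_inv_x nat | C_inv_1x nat
  | C_y | C_yd nat | C_z nat

type_synonym mpoly = "(coord \<Rightarrow>\<^sub>0 nat) \<Rightarrow>\<^sub>0 int"

definition var :: "coord \<Rightarrow> mpoly"
  where "var v = Poly_Mapping.single (Poly_Mapping.single v 1) 1"

definition poly_ring :: "coord set \<Rightarrow> mpoly ring"
  where "poly_ring S =
    \<lparr>carrier = {p. \<forall>e \<in> Poly_Mapping.keys p. Poly_Mapping.keys e \<subseteq> S},
     mult = (*), one = 1, zero = 0, add = (+)\<rparr>"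

lemma cring_poly_ring: "cring (poly_ring S)"
proof (rule cringI)
  let ?C = "carrier (poly_ring S)"
  have C: "p \<in> ?C \<longleftrightarrow> (\<forall>e \<in> Poly_Mapping.keys p. Poly_Mapping.keys e \<subseteq> S)" for p
    by (simp add: poly_ring_def)
  have ops: "x \<otimes>\<^bsub>poly_ring S\<^esub> y = x * y" "x \<oplus>\<^bsub>poly_ring S\<^esub> y = x + y"
    "\<one>\<^bsub>poly_ring S\<^esub> = 1" "\<zero>\<^bsub>poly_ring S\<^esub> = 0" for x y
    by (simp_all add: poly_ring_def)
  have add: "p + q \<in> ?C" if "p \<in> ?C" "q \<in> ?C" for p q
    using that Poly_Mapping.keys_add[of p q] unfolding C by blast
  have mult: "p * q \<in> ?C" if "p \<in> ?C" "q \<in> ?C" for p q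
    unfolding C
  proof
    fix e assume "e \<in> Poly_Mapping.keys (p * q)"
    then obtain u v where "u \<in> Poly_Mapping.keys p" "v \<in> Poly_Mapping.keys q" "e = u + v"
      using keys_mult[of p q] by blast
    with that show "Poly_Mapping.keys e \<subseteq> S"
      using Poly_Mapping.keys_add[of u v] unfolding C by blast
  qed
  have one: "1 \<in> ?C" and zero: "0 \<in> ?C" by (simp_all add: C)
  have neg: "- p \<in> ?C" if "p \<in> ?C" for p using that by (simp add: C)
  show "abelian_group (poly_ring S)"
  proof (rule abelian_groupI)
    fix x assume "x \<in> ?C"
    then show "\<exists>y\<in>?C. y \<oplus>\<^bsub>poly_ring S\<^esub> x = \<zero>\<^bsub>poly_ring S\<^esub>"
      by (intro bexI[of _ "- x"] neg) (simp_all add: ops)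
  qed (simp_all add: ops add zero ac_simps)
  show "Group.comm_monoid (poly_ring S)"
    by (rule comm_monoidI) (simp_all add: ops mult one ac_simps)
qed (simp add: poly_ring_def distrib_right)

text \<open>A set of coordinates together with the polynomials that are set to zero.\<close>

type_synonym presentation = "coord set \<times> mpoly set"

definition rel_ideal :: "presentation \<Rightarrow> mpoly set"
  where "rel_ideal P = genideal (poly_ring (fst P)) (snd P)"

definition coord_ring :: "presentation \<Rightarrow> mpoly set ring"
  where "coord_ring P = poly_ring (fst P) Quot rel_ideal P"

definition cls :: "presentation \<Rightarrow> mpoly \<Rightarrow> mpoly set"
  where "cls P f = rel_ideal P +>\<^bsub>poly_ring (fst P)\<^esub> f"

type_synonym aff_space = "(mpoly set set, mpoly set spec_sec) ringed_space"
type_synonym aff_morph =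
  "(mpoly set set, mpoly set spec_sec, mpoly set set, mpoly set spec_sec) rs_morph"

definition Aff :: "presentation \<Rightarrow> aff_space"
  where "Aff P = Spec (coord_ring P)"

abbreviation aff_points :: "presentation \<Rightarrow> mpoly set set set"
  where "aff_points P \<equiv> rs_points (Aff P)"

text \<open>
  For \<open>F\<close> defined on the open set \<open>W\<close> of \<open>Aff P\<close>, with values in \<open>Aff Q\<close>: the coordinate function
  \<open>v\<close> of \<open>Aff Q\<close> pulls back to the restriction to \<open>W\<close> of the function \<open>c\<close> on \<open>Aff P\<close>.
\<close>

definition pulls_back ::
  "presentation \<Rightarrow> mpoly set set set \<Rightarrow> presentation \<Rightarrow> aff_morph \<Rightarrow> coord \<Rightarrow> mpoly set \<Rightarrow> bool"
  where "pulls_back P W Q F v c \<longleftrightarrow>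
    pb F (aff_points Q) (regular (coord_ring Q) (aff_points Q) (cls Q (var v)))
      = regular (coord_ring P) W c"

text \<open>\<open>F\<close> is the morphism from \<open>Aff P\<close> to \<open>Aff Q\<close> given in coordinates by \<open>v = \<theta> v\<close>.\<close>

definition given_by ::
  "presentation \<Rightarrow> presentation \<Rightarrow> aff_morph \<Rightarrow> (coord \<Rightarrow> mpoly set) \<Rightarrow> bool"
  where "given_by P Q F \<theta> \<longleftrightarrow>
    lrs_morphism (Aff P) (Aff Q) F \<and> (\<forall>v \<in> fst Q. pulls_back P (aff_points P) Q F v (\<theta> v))"


section \<open>The families\<close>

text \<open>The base, the projective line over \<open>\<int>[1/m]\<close> without \<open>0\<close>, \<open>1\<close>, \<open>\<infinity>\<close>.\<close>

definition base_pres :: "nat \<Rightarrow> presentation"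
  where "base_pres m =
    ({C_t, C_inv_m, C_inv_t, C_inv_1t},
     {of_nat m * var C_inv_m - 1,
      var C_t * var C_inv_t - 1,
      (1 - var C_t) * var C_inv_1t - 1})"

definition V_pres :: "nat \<Rightarrow> nat \<Rightarrow> presentation"
  where "V_pres n m =
    (fst (base_pres m) \<union> C_x ` {1..n} \<union> C_inv_x ` {1..n},
     snd (base_pres m) \<union> {var C_t * (\<Prod>i\<in>{1..n}. var (C_x i)) - 1}
       \<union> (\<lambda>i. var (C_x i) * var (C_inv_x i) - 1) ` {1..n})"

definition U_pres :: "nat \<Rightarrow> nat \<Rightarrow> presentation"
  where "U_pres n m =
    (fst (V_pres n m) \<union> C_inv_1x ` {1..n},
     snd (V_pres n m) \<union> (\<lambda>i. (1 - var (C_x i)) * var (C_inv_1x i) - 1) ` {1..n})"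

definition f_ab :: "nat \<Rightarrow> (nat \<Rightarrow> nat) \<Rightarrow> (nat \<Rightarrow> nat) \<Rightarrow> mpoly"
  where "f_ab n a b = (\<Prod>i\<in>{1..n}. (- var (C_x i)) ^ a i * (1 - var (C_x i)) ^ (b i - a i))"

definition f_abe :: "nat \<Rightarrow> nat \<Rightarrow> (nat \<Rightarrow> nat) \<Rightarrow> (nat \<Rightarrow> nat) \<Rightarrow> nat \<Rightarrow> mpoly"
  where "f_abe n m a b e =
    (\<Prod>i\<in>{i \<in> {1..n}. gcd m (a i) = e}. (- var (C_x i)) ^ (a i div e)) *
    (\<Prod>i\<in>{i \<in> {1..n}. gcd m (b i - a i) = e}. (1 - var (C_x i)) ^ ((b i - a i) div e))"

definition Y_pres :: "nat \<Rightarrow> nat \<Rightarrow> (nat \<Rightarrow> nat) \<Rightarrow> (nat \<Rightarrow> nat) \<Rightarrow> presentation"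
  where "Y_pres n m a b =
    (insert C_y (fst (U_pres n m)), insert (var C_y ^ m - f_ab n a b) (snd (U_pres n m)))"

definition X_pres :: "nat \<Rightarrow> nat \<Rightarrow> (nat \<Rightarrow> nat) \<Rightarrow> (nat \<Rightarrow> nat) \<Rightarrow> presentation"
  where "X_pres n m a b =
    (fst (V_pres n m) \<union> C_yd ` {d. d dvd m},
     snd (V_pres n m) \<union> {var (C_yd 1) - 1} \<union>
       {var (C_yd d) ^ (d div h) -
          var (C_yd h) * (\<Prod>e\<in>{e. e dvd m \<and> h dvd e \<and> \<not> d dvd e}. f_abe n m a b e ^ (e div h))
        | h d. h dvd d \<and> d dvd m})"


section \<open>Actions of the group scheme of roots of unity\<close>

text \<open>
  The fibre product over the base of \<open>Aff P\<close> with the group scheme of \<open>m\<close>-th roots of unity, the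
  latter with coordinate \<open>z\<^sub>j\<close>.  It is only used when \<open>C_z j\<close> does not occur in \<open>P\<close>.
\<close>

definition mu_prod :: "nat \<Rightarrow> nat \<Rightarrow> presentation \<Rightarrow> presentation"
  where "mu_prod m j P = (insert (C_z j) (fst P), insert (var (C_z j) ^ m - 1) (snd P))"

definition mu_proj :: "nat \<Rightarrow> nat \<Rightarrow> presentation \<Rightarrow> aff_morph \<Rightarrow> bool"
  where "mu_proj m j P p \<longleftrightarrow> given_by (mu_prod m j P) P p (\<lambda>v. cls (mu_prod m j P) (var v))"

text \<open>\<open>G\<close> is the product of the identity of the group scheme with \<open>F\<close>, where \<open>F\<close> is a morphism
  from \<open>Aff P\<close> to \<open>Aff Q\<close>.\<close>

definition id_times ::
  "nat \<Rightarrow> nat \<Rightarrow> presentation \<Rightarrow> nat \<Rightarrow> presentation \<Rightarrow> aff_morph \<Rightarrow> aff_morph \<Rightarrow> bool"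
  where "id_times m i P j Q F G \<longleftrightarrow>
    lrs_morphism (Aff (mu_prod m i P)) (Aff (mu_prod m j Q)) G \<and>
    pulls_back (mu_prod m i P) (aff_points (mu_prod m i P)) (mu_prod m j Q) G
      (C_z j) (cls (mu_prod m i P) (var (C_z i))) \<and>
    (\<exists>p q. mu_proj m i P p \<and> mu_proj m j Q q \<and>
       eq_morph (Aff (mu_prod m i P)) (Aff Q)
         (comp_morph (Aff (mu_prod m j Q)) q G) (comp_morph (Aff P) F p))"

text \<open>\<open>\<alpha>\<close> is a morphism over the base satisfying the unit law and the associative law
  \<open>z\<^sub>2 \<cdot> (z\<^sub>1 \<cdot> x) = (z\<^sub>2 z\<^sub>1) \<cdot> x\<close>.\<close>

definition mu_action :: "nat \<Rightarrow> presentation \<Rightarrow> aff_morph \<Rightarrow> bool"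
  where "mu_action m P \<alpha> \<longleftrightarrow>
    (let P1 = mu_prod m 1 P; P2 = mu_prod m 2 P1 in
      lrs_morphism (Aff P1) (Aff P) \<alpha> \<and>
      (\<forall>v \<in> fst (base_pres m). pulls_back P1 (aff_points P1) P \<alpha> v (cls P1 (var v))) \<and>
      (\<exists>\<epsilon>. given_by P P1 \<epsilon> (\<lambda>v. if v = C_z 1 then cls P 1 else cls P (var v)) \<and>
         eq_morph (Aff P) (Aff P) (comp_morph (Aff P1) \<alpha> \<epsilon>) id_morph) \<and>
      (\<exists>\<mu> \<alpha>'.
         given_by P2 P1 \<mu>
           (\<lambda>v. if v = C_z 1 then cls P2 (var (C_z 2) * var (C_z 1)) else cls P2 (var v)) \<and>
         id_times m 2 P1 1 P \<alpha> \<alpha>' \<and>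
         eq_morph (Aff P2) (Aff P) (comp_morph (Aff P1) \<alpha> \<alpha>') (comp_morph (Aff P1) \<alpha> \<mu>)))"

definition mu_equivariant ::
  "nat \<Rightarrow> presentation \<Rightarrow> presentation \<Rightarrow> aff_morph \<Rightarrow> aff_morph \<Rightarrow> aff_morph \<Rightarrow> bool"
  where "mu_equivariant m P Q \<alpha> \<beta> F \<longleftrightarrow>
    (\<exists>F'. id_times m 1 P 1 Q F F' \<and>
       eq_morph (Aff (mu_prod m 1 P)) (Aff Q)
         (comp_morph (Aff P) F \<alpha>) (comp_morph (Aff (mu_prod m 1 Q)) \<beta> F'))"

end

theory Submission
  imports
    "HOL-Computational_Algebra.Polynomial_Factorial"
    "HOL-Algebra.Algebraic_Closure_Type"
    "HOL-Library.Countable"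
    Defs
begin

text \<open>
  All morphisms come from substitutions of polynomials for coordinates.  On \<open>X\<close> the equations give
  \<open>(y\<^sub>m f\<^sub>m)^(m/d) = y\<^sub>d \<Prod>\<^bsub>d|e\<^esub> f\<^sub>e^(e/d)\<close>; hence the coordinate ring of \<open>Y\<close> is that of \<open>X\<close> with
  \<open>g = \<Prod>i. 1 - x\<^sub>i\<close> inverted, and \<open>Y\<close> is the basic open subset of \<open>X\<close> where \<open>g\<close> does not vanish.
  Giving \<open>y\<close> weight \<open>1\<close> and \<open>y\<^sub>d\<close> weight \<open>m/d\<close> makes all equations homogeneous modulo \<open>m\<close>, which
  yields the two actions and the equivariance.

  For the density of \<open>Y\<close> in \<open>X\<close>, suppose that a function \<open>f\<close> on \<open>X\<close> vanishes at all points with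
  independent coordinates \<open>x\<^sub>i\<close>.  The group of roots of unity permutes these points, so every part
  of \<open>f\<close> that is homogeneous of weight \<open>k\<close> modulo \<open>m\<close> vanishes there too.  The \<open>m\<close>-th power of such
  a part has weight \<open>0\<close>, and functions of weight \<open>0\<close> are, up to nilpotent elements, functions on the
  integral scheme \<open>V\<close>.  Hence that power, and so \<open>f\<close>, vanishes at every point of \<open>X\<close>.
\<close>

section \<open>Localizations and the structure sheaf\<close>

text \<open>\<open>X\<close> and \<open>Y\<close> may be reducible: if \<open>m > 1\<close> and all
  \<open>a i\<close> and \<open>b i - a i\<close> are divisible by \<open>m\<close>, the equation of
  \<open>Y\<close> reads \<open>y^m = h^m\<close> for a function \<open>h\<close>. So density does
  not follow from irreducibility, and one generic point is not enough; a whole orbit of generic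
  points under the roots of unity is needed. Nor is anything known beforehand about nilpotents of
  \<open>X\<close> or torsion of \<open>g\<close>. This shapes both halves. For the immersion, a
  function that dies on \<open>Y\<close> is only shown to be killed by a power of \<open>g\<close>,
  which is what a localization allows. For density, identities valid on \<open>Y\<close> are checked
  modulo each prime of the coordinate ring of \<open>X\<close>, where nonvanishing factors can be
  cancelled; the price is an ambiguity by nilpotents, harmless for statements about points. The
  generic points take values in an algebraically closed field of characteristic 0, where f has an
  m-th root and \<open>z^m - 1\<close> has \<open>m\<close> distinct roots, so that values on the
  orbit separate the homogeneous parts; the primes at which vanishing is concluded may have any
  residue characteristic prime to \<open>m\<close>.\<close>

lemma UN_pairs_const:
  assumes "\<And>a s. (a, s) \<in> c \<Longrightarrow> F a s = Z" and "c \<noteq> {}"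
  shows "(\<Union>(a, s)\<in>c. F a s) = Z"
  using assms by fastforce

lemma Spec_simps:
  "rs_top (Spec A) = zariski A" "rs_sec (Spec A) W = spec_sections A W"
  "rs_res (Spec A) W W' \<phi> = restrict \<phi> W'"
  by (simp_all add: Spec_def)

context cring
begin

section \<open>Primes and equality of fractions\<close>

lemma primeD:
  assumes "p \<in> prime_spec R"
  shows "primeideal p R" "p \<subseteq> carrier R" "\<one> \<notin> p" "\<zero> \<in> p"
    "\<And>a b. a \<in> carrier R \<Longrightarrow> b \<in> carrier R \<Longrightarrow> a \<otimes> b \<in> p \<longleftrightarrow> a \<in> p \<or> b \<in> p"
    "\<And>a b. a \<in> p \<Longrightarrow> b \<in> p \<Longrightarrow> a \<oplus> b \<in> p"
proof -
  interpret primeideal p R using assms by (simp add: prime_spec_def)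
  show "primeideal p R" by (rule primeideal)
  show "p \<subseteq> carrier R" by (rule a_subset)
  show "\<one> \<notin> p" using I_notcarr one_imp_carrier by metis
  show "\<zero> \<in> p" by simp
  show "\<And>a b. a \<in> carrier R \<Longrightarrow> b \<in> carrier R \<Longrightarrow> a \<otimes> b \<in> p \<longleftrightarrow> a \<in> p \<or> b \<in> p"
    by (meson I_prime I_l_closed I_r_closed)
  show "\<And>a b. a \<in> p \<Longrightarrow> b \<in> p \<Longrightarrow> a \<oplus> b \<in> p" by simp
qed

lemma prime_pow_mem:
  assumes "p \<in> prime_spec R" "a \<in> carrier R" "a [^] (k::nat) \<in> p"
  shows "a \<in> p"
  using assms(3)
proof (induction k)
  case 0 then show ?case using primeD(3)[OF assms(1)] by simp
next
  case (Suc k) then show ?case using primeD(5)[OF assms(1), of "a [^] k" a] assms(2) by auto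
qed

lemma frac_mem_iff:
  "(b, t) \<in> frac R p a s \<longleftrightarrow> b \<in> carrier R \<and> t \<in> carrier R - p \<and>
     (\<exists>u \<in> carrier R - p. u \<otimes> (a \<otimes> t) = u \<otimes> (b \<otimes> s))"
  by (simp add: frac_def)

lemma frac_mem_self:
  assumes "p \<in> prime_spec R" "a \<in> carrier R" "s \<in> carrier R - p"
  shows "(a, s) \<in> frac R p a s"
  unfolding frac_mem_iff using assms primeD(3)[OF assms(1)] by (auto intro!: bexI[of _ \<one>])

text \<open>Transitivity of the relation between fractions, through \<open>a/s\<close>. The
  hypotheses are symmetric in the two fractions, so the reverse inclusion follows by exchanging
  them.\<close>

lemma frac_subset:
  assumes p: "p \<in> prime_spec R" and ab: "a \<in> carrier R" "b \<in> carrier R"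
    and st: "s \<in> carrier R - p" "t \<in> carrier R - p"
    and u: "u \<in> carrier R - p" "u \<otimes> (a \<otimes> t) = u \<otimes> (b \<otimes> s)"
  shows "frac R p a s \<subseteq> frac R p b t"
proof
  fix x assume "x \<in> frac R p a s"
  then obtain c r v where x: "x = (c, r)" and c: "c \<in> carrier R" and r: "r \<in> carrier R - p"
    and v: "v \<in> carrier R - p" "v \<otimes> (a \<otimes> r) = v \<otimes> (c \<otimes> s)"
    by (cases x) (auto simp: frac_mem_iff)
  have carr: "u \<in> carrier R" "v \<in> carrier R" "s \<in> carrier R" "t \<in> carrier R" "r \<in> carrier R"
    using u v st r by auto
  \<comment> \<open>The factor \<open>s\<close>, the denominator of the middle fraction, has to stay
    in the multiplier: it need not be cancellable.\<close>
  have "(u \<otimes> v \<otimes> s) \<otimes> (b \<otimes> r) = (v \<otimes> r) \<otimes> (u \<otimes> (b \<otimes> s))"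
    using carr ab c by (simp add: m_ac)
  also have "\<dots> = (u \<otimes> t) \<otimes> (v \<otimes> (a \<otimes> r))"
    unfolding u(2)[symmetric] using carr ab c by (simp add: m_ac)
  also have "\<dots> = (u \<otimes> v \<otimes> s) \<otimes> (c \<otimes> t)"
    unfolding v(2) using carr ab c by (simp add: m_ac)
  finally have "(u \<otimes> v \<otimes> s) \<otimes> (b \<otimes> r) = (u \<otimes> v \<otimes> s) \<otimes> (c \<otimes> t)" .
  moreover have "u \<otimes> v \<otimes> s \<in> carrier R - p" using u v st carr primeD(5)[OF p] by auto
  ultimately show "x \<in> frac R p b t" unfolding x frac_mem_iff using c r by blast
qed

lemma frac_eq_iff:
  assumes p: "p \<in> prime_spec R" and ab: "a \<in> carrier R" "b \<in> carrier R"
    and st: "s \<in> carrier R - p" "t \<in> carrier R - p"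
  shows "frac R p a s = frac R p b t \<longleftrightarrow>
    (\<exists>u \<in> carrier R - p. u \<otimes> (a \<otimes> t) = u \<otimes> (b \<otimes> s))"
proof
  assume "frac R p a s = frac R p b t"
  with frac_mem_self[OF p ab(2) st(2)] show "\<exists>u \<in> carrier R - p. u \<otimes> (a \<otimes> t) = u \<otimes> (b \<otimes> s)"
    using frac_mem_iff by blast
next
  assume "\<exists>u \<in> carrier R - p. u \<otimes> (a \<otimes> t) = u \<otimes> (b \<otimes> s)"
  then obtain u where u: "u \<in> carrier R - p" "u \<otimes> (a \<otimes> t) = u \<otimes> (b \<otimes> s)" by blast
  show "frac R p a s = frac R p b t"
    by (rule equalityI[OF frac_subset[OF p ab st u] frac_subset[OF p ab(2,1) st(2,1) u(1) u(2)[symmetric]]])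
qed

lemma frac_eqI:
  assumes "p \<in> prime_spec R" "a \<in> carrier R" "b \<in> carrier R"
    "s \<in> carrier R - p" "t \<in> carrier R - p" "a \<otimes> t = b \<otimes> s"
  shows "frac R p a s = frac R p b t"
  using frac_eq_iff[OF assms(1-5)] assms primeD(3)[OF assms(1)] by (auto intro!: bexI[of _ \<one>])

section \<open>Arithmetic of the localization at a prime\<close>

lemma loc_carrier:
  "carrier (loc R p) = {frac R p a s | a s. a \<in> carrier R \<and> s \<in> carrier R - p}"
  by (simp add: loc_def)

lemma loc_carrierE:
  assumes "c \<in> carrier (loc R p)"
  obtains a s where "a \<in> carrier R" "s \<in> carrier R - p" "c = frac R p a s"
  using assms by (auto simp: loc_carrier)

lemma frac_carrier:
  "a \<in> carrier R \<Longrightarrow> s \<in> carrier R \<Longrightarrow> s \<notin> p \<Longrightarrow> frac R p a s \<in> carrier (loc R p)"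
  by (auto simp: loc_carrier)

lemma frac_cong_mult:
  assumes p: "p \<in> prime_spec R"
    and c: "a \<in> carrier R" "s \<in> carrier R - p" "b \<in> carrier R" "t \<in> carrier R - p"
    and m: "(a', s') \<in> frac R p a s" "(b', t') \<in> frac R p b t"
  shows "frac R p (a' \<otimes> b') (s' \<otimes> t') = frac R p (a \<otimes> b) (s \<otimes> t)"
    and "frac R p (a' \<otimes> t' \<oplus> b' \<otimes> s') (s' \<otimes> t') = frac R p (a \<otimes> t \<oplus> b \<otimes> s) (s \<otimes> t)"
proof -
  obtain u v where u: "u \<in> carrier R - p" "u \<otimes> (a \<otimes> s') = u \<otimes> (a' \<otimes> s)"
    and v: "v \<in> carrier R - p" "v \<otimes> (b \<otimes> t') = v \<otimes> (b' \<otimes> t)"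
    and c': "a' \<in> carrier R" "s' \<in> carrier R - p" "b' \<in> carrier R" "t' \<in> carrier R - p"
    using m unfolding frac_mem_iff by (elim conjE bexE) blast
  have carr: "u \<in> carrier R" "v \<in> carrier R" "s \<in> carrier R" "t \<in> carrier R" "s' \<in> carrier R" "t' \<in> carrier R"
    using u v c c' by auto
  have uv: "u \<otimes> v \<in> carrier R - p" "s \<otimes> t \<in> carrier R - p" "s' \<otimes> t' \<in> carrier R - p"
    using u v carr c c' primeD(5)[OF p] by auto
  have "(u \<otimes> v) \<otimes> (a \<otimes> b \<otimes> (s' \<otimes> t')) = (u \<otimes> (a \<otimes> s')) \<otimes> (v \<otimes> (b \<otimes> t'))"
    using carr c c' by (simp add: m_ac)
  also have "\<dots> = (u \<otimes> v) \<otimes> (a' \<otimes> b' \<otimes> (s \<otimes> t))"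
    unfolding u v using carr c c' by (simp add: m_ac)
  finally show "frac R p (a' \<otimes> b') (s' \<otimes> t') = frac R p (a \<otimes> b) (s \<otimes> t)"
    using frac_eq_iff[OF p, of "a \<otimes> b" "a' \<otimes> b'" "s \<otimes> t" "s' \<otimes> t'"] uv c c' by (metis m_closed)
  have "(u \<otimes> v) \<otimes> ((a \<otimes> t \<oplus> b \<otimes> s) \<otimes> (s' \<otimes> t'))
      = (v \<otimes> t \<otimes> t') \<otimes> (u \<otimes> (a \<otimes> s')) \<oplus> (u \<otimes> s \<otimes> s') \<otimes> (v \<otimes> (b \<otimes> t'))"
    using carr c c' by (simp add: m_ac l_distr r_distr)
  also have "\<dots> = (u \<otimes> v) \<otimes> ((a' \<otimes> t' \<oplus> b' \<otimes> s') \<otimes> (s \<otimes> t))"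
    unfolding u v using carr c c' by (simp add: m_ac l_distr r_distr)
  finally show "frac R p (a' \<otimes> t' \<oplus> b' \<otimes> s') (s' \<otimes> t') = frac R p (a \<otimes> t \<oplus> b \<otimes> s) (s \<otimes> t)"
    using frac_eq_iff[OF p, of "a \<otimes> t \<oplus> b \<otimes> s" "a' \<otimes> t' \<oplus> b' \<otimes> s'" "s \<otimes> t" "s' \<otimes> t'"] uv c c' carr
    by (metis m_closed a_closed)
qed

lemma loc_mult:
  assumes p: "p \<in> prime_spec R"
    and c: "a \<in> carrier R" "s \<in> carrier R - p" "b \<in> carrier R" "t \<in> carrier R - p"
  shows "frac R p a s \<otimes>\<^bsub>loc R p\<^esub> frac R p b t = frac R p (a \<otimes> b) (s \<otimes> t)"
proof -
  have "(\<Union>(b', t')\<in>frac R p b t. frac R p (a' \<otimes> b') (s' \<otimes> t')) = frac R p (a \<otimes> b) (s \<otimes> t)"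
    if "(a', s') \<in> frac R p a s" for a' s'
    using frac_mem_self[OF p c(3,4)] frac_cong_mult(1)[OF p c that] by (intro UN_pairs_const) auto
  moreover have "frac R p a s \<noteq> {}" using frac_mem_self[OF p c(1,2)] by blast
  ultimately have "(\<Union>(a', s')\<in>frac R p a s. \<Union>(b', t')\<in>frac R p b t. frac R p (a' \<otimes> b') (s' \<otimes> t'))
      = frac R p (a \<otimes> b) (s \<otimes> t)"
    by (rule UN_pairs_const)
  then show ?thesis by (simp add: loc_def)
qed

lemma loc_add:
  assumes p: "p \<in> prime_spec R"
    and c: "a \<in> carrier R" "s \<in> carrier R - p" "b \<in> carrier R" "t \<in> carrier R - p"
  shows "frac R p a s \<oplus>\<^bsub>loc R p\<^esub> frac R p b t = frac R p (a \<otimes> t \<oplus> b \<otimes> s) (s \<otimes> t)"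
proof -
  have "(\<Union>(b', t')\<in>frac R p b t. frac R p ((a' \<otimes> t') \<oplus> (b' \<otimes> s')) (s' \<otimes> t'))
      = frac R p (a \<otimes> t \<oplus> b \<otimes> s) (s \<otimes> t)"
    if "(a', s') \<in> frac R p a s" for a' s'
    using frac_mem_self[OF p c(3,4)] frac_cong_mult(2)[OF p c that] by (intro UN_pairs_const) auto
  moreover have "frac R p a s \<noteq> {}" using frac_mem_self[OF p c(1,2)] by blast
  ultimately have "(\<Union>(a', s')\<in>frac R p a s. \<Union>(b', t')\<in>frac R p b t. frac R p ((a' \<otimes> t') \<oplus> (b' \<otimes> s')) (s' \<otimes> t'))
      = frac R p (a \<otimes> t \<oplus> b \<otimes> s) (s \<otimes> t)"
    by (rule UN_pairs_const)
  then show ?thesis by (simp add: loc_def)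
qed

lemma loc_one: "\<one>\<^bsub>loc R p\<^esub> = frac R p \<one> \<one>" by (simp add: loc_def)

section \<open>The Zariski topology and sections of the structure sheaf\<close>

lemma zariski_topspace: "topspace (zariski R) = prime_spec R"
proof
  show "topspace (zariski R) \<subseteq> prime_spec R"
    using openin_topspace[of "zariski R"] unfolding openin_zariski by blast
  have "openin (zariski R) {p \<in> prime_spec R. \<not> {\<one>} \<subseteq> p}"
    unfolding openin_zariski by (intro exI[of _ "{\<one>}"]) simp
  then show "prime_spec R \<subseteq> topspace (zariski R)"
    using primeD(3) openin_subset by (fastforce simp: subset_eq)
qed

lemma openin_basic:
  assumes "g \<in> carrier R"
  shows "openin (zariski R) {p \<in> prime_spec R. g \<notin> p}"
  unfolding openin_zariski using assms by (intro exI[of _ "{g}"]) auto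

lemma Spec_points: "rs_points (Spec R) = prime_spec R"
  by (simp add: Spec_def zariski_topspace)

lemma open_prime: "openin (zariski R) W \<Longrightarrow> p \<in> W \<Longrightarrow> p \<in> prime_spec R"
  using openin_subset zariski_topspace by blast

lemma sec_carrier:
  "\<phi> \<in> carrier (spec_sections R W) \<longleftrightarrow> \<phi> \<in> (\<Pi>\<^sub>E p\<in>W. carrier (loc R p)) \<and>
        (\<forall>p\<in>W. \<exists>W'. openin (zariski R) W' \<and> W' \<subseteq> W \<and> p \<in> W' \<and>
          (\<exists>a \<in> carrier R. \<exists>s \<in> carrier R. \<forall>q\<in>W'. s \<notin> q \<and> \<phi> q = frac R q a s))"
  by (simp add: spec_sections_def)

lemma sec_ext:
  assumes "\<phi> \<in> carrier (spec_sections R W)" "\<tau> \<in> carrier (spec_sections R W)"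
    "\<And>p. p \<in> W \<Longrightarrow> \<phi> p = \<tau> p"
  shows "\<phi> = \<tau>"
  by (rule PiE_ext[OF conjunct1[OF assms(1)[unfolded sec_carrier]]
        conjunct1[OF assms(2)[unfolded sec_carrier]] assms(3)])

lemma sec_localE:
  assumes "\<phi> \<in> carrier (spec_sections R W)" "p \<in> W"
  obtains W' a s where "openin (zariski R) W'" "W' \<subseteq> W" "p \<in> W'" "a \<in> carrier R" "s \<in> carrier R"
    "\<And>q. q \<in> W' \<Longrightarrow> s \<notin> q" "\<And>q. q \<in> W' \<Longrightarrow> \<phi> q = frac R q a s"
proof -
  have "\<exists>W'. openin (zariski R) W' \<and> W' \<subseteq> W \<and> p \<in> W' \<and>
          (\<exists>a \<in> carrier R. \<exists>s \<in> carrier R. \<forall>q\<in>W'. s \<notin> q \<and> \<phi> q = frac R q a s)"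
    by (rule bspec[OF conjunct2[OF assms(1)[unfolded sec_carrier]] assms(2)])
  then obtain W' a s where *: "openin (zariski R) W'" "W' \<subseteq> W" "p \<in> W'" "a \<in> carrier R" "s \<in> carrier R"
    and "\<forall>q\<in>W'. s \<notin> q \<and> \<phi> q = frac R q a s"
    by (elim exE conjE bexE)
  then show ?thesis by (intro that[OF *]) simp_all
qed

lemma sec_value: "\<phi> \<in> carrier (spec_sections R W) \<Longrightarrow> p \<in> W \<Longrightarrow> \<phi> p \<in> carrier (loc R p)"
  unfolding sec_carrier by blast

lemma sec_carrierI:
  assumes "\<phi> \<in> extensional W"
    and "\<And>p. p \<in> W \<Longrightarrow> \<exists>W' a s. openin (zariski R) W' \<and> W' \<subseteq> W \<and> p \<in> W' \<and>
          a \<in> carrier R \<and> s \<in> carrier R \<and> (\<forall>q\<in>W'. s \<notin> q \<and> \<phi> q = frac R q a s)"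
  shows "\<phi> \<in> carrier (spec_sections R W)"
  unfolding sec_carrier
proof (intro conjI ballI)
  have "\<phi> p \<in> carrier (loc R p)" if "p \<in> W" for p
    using assms(2)[OF that] frac_carrier by metis
  then show "\<phi> \<in> (\<Pi>\<^sub>E p\<in>W. carrier (loc R p))" using assms(1) by (simp add: PiE_def)
  fix p assume "p \<in> W"
  from assms(2)[OF this] obtain W' a s where
    "openin (zariski R) W'" "W' \<subseteq> W" "p \<in> W'" "a \<in> carrier R" "s \<in> carrier R"
    "\<forall>q\<in>W'. s \<notin> q \<and> \<phi> q = frac R q a s"
    by (elim exE conjE)
  then show "\<exists>W'. openin (zariski R) W' \<and> W' \<subseteq> W \<and> p \<in> W' \<and>
      (\<exists>a \<in> carrier R. \<exists>s \<in> carrier R. \<forall>q\<in>W'. s \<notin> q \<and> \<phi> q = frac R q a s)"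
    by (intro exI conjI bexI)
qed

lemma sec_common:
  assumes "\<phi> \<in> carrier (spec_sections R W)" "\<tau> \<in> carrier (spec_sections R W)" "p \<in> W"
  obtains W' a s b t where "openin (zariski R) W'" "W' \<subseteq> W" "p \<in> W'"
    "a \<in> carrier R" "s \<in> carrier R" "b \<in> carrier R" "t \<in> carrier R"
    "\<And>q. q \<in> W' \<Longrightarrow> s \<notin> q \<and> t \<notin> q \<and> \<phi> q = frac R q a s \<and> \<tau> q = frac R q b t"
proof -
  obtain W1 a s where 1: "openin (zariski R) W1" "W1 \<subseteq> W" "p \<in> W1" "a \<in> carrier R" "s \<in> carrier R"
    "\<And>q. q \<in> W1 \<Longrightarrow> s \<notin> q" "\<And>q. q \<in> W1 \<Longrightarrow> \<phi> q = frac R q a s"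
    using sec_localE[OF assms(1,3)] by metis
  obtain W2 b t where 2: "openin (zariski R) W2" "W2 \<subseteq> W" "p \<in> W2" "b \<in> carrier R" "t \<in> carrier R"
    "\<And>q. q \<in> W2 \<Longrightarrow> t \<notin> q" "\<And>q. q \<in> W2 \<Longrightarrow> \<tau> q = frac R q b t"
    using sec_localE[OF assms(2,3)] by metis
  show ?thesis
    using 1 2 by (intro that[of "W1 \<inter> W2" a s b t]) auto
qed

lemma sec_mult_closed:
  assumes "\<phi> \<in> carrier (spec_sections R W)" "\<tau> \<in> carrier (spec_sections R W)"
  shows "\<phi> \<otimes>\<^bsub>spec_sections R W\<^esub> \<tau> \<in> carrier (spec_sections R W)"
proof (rule sec_carrierI)
  show "\<phi> \<otimes>\<^bsub>spec_sections R W\<^esub> \<tau> \<in> extensional W" by (simp add: spec_sections_def)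
next
  fix p assume "p \<in> W"
  obtain W' a s b t where *: "openin (zariski R) W'" "W' \<subseteq> W" "p \<in> W'"
    "a \<in> carrier R" "s \<in> carrier R" "b \<in> carrier R" "t \<in> carrier R"
    "\<And>q. q \<in> W' \<Longrightarrow> s \<notin> q \<and> t \<notin> q \<and> \<phi> q = frac R q a s \<and> \<tau> q = frac R q b t"
    using sec_common[OF assms \<open>p \<in> W\<close>] by metis
  have "s \<otimes> t \<notin> q \<and> (\<phi> \<otimes>\<^bsub>spec_sections R W\<^esub> \<tau>) q = frac R q (a \<otimes> b) (s \<otimes> t)" if "q \<in> W'" for q
  proof -
    have q: "q \<in> prime_spec R" "q \<in> W" using open_prime * that by blast+
    show ?thesis using *(8)[OF that] *(4-7) q loc_mult[OF q(1), of a s b t] primeD(5)[OF q(1)]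
      by (simp add: spec_sections_def)
  qed
  then show "\<exists>W' a' s'. openin (zariski R) W' \<and> W' \<subseteq> W \<and> p \<in> W' \<and> a' \<in> carrier R \<and> s' \<in> carrier R \<and>
      (\<forall>q\<in>W'. s' \<notin> q \<and> (\<phi> \<otimes>\<^bsub>spec_sections R W\<^esub> \<tau>) q = frac R q a' s')"
    using * by (intro exI[of _ W'] exI[of _ "a \<otimes> b"] exI[of _ "s \<otimes> t"]) auto
qed

lemma sec_add_closed:
  assumes "\<phi> \<in> carrier (spec_sections R W)" "\<tau> \<in> carrier (spec_sections R W)"
  shows "\<phi> \<oplus>\<^bsub>spec_sections R W\<^esub> \<tau> \<in> carrier (spec_sections R W)"
proof (rule sec_carrierI)
  show "\<phi> \<oplus>\<^bsub>spec_sections R W\<^esub> \<tau> \<in> extensional W" by (simp add: spec_sections_def)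
next
  fix p assume "p \<in> W"
  obtain W' a s b t where *: "openin (zariski R) W'" "W' \<subseteq> W" "p \<in> W'"
    "a \<in> carrier R" "s \<in> carrier R" "b \<in> carrier R" "t \<in> carrier R"
    "\<And>q. q \<in> W' \<Longrightarrow> s \<notin> q \<and> t \<notin> q \<and> \<phi> q = frac R q a s \<and> \<tau> q = frac R q b t"
    using sec_common[OF assms \<open>p \<in> W\<close>] by metis
  have "s \<otimes> t \<notin> q \<and> (\<phi> \<oplus>\<^bsub>spec_sections R W\<^esub> \<tau>) q = frac R q (a \<otimes> t \<oplus> b \<otimes> s) (s \<otimes> t)"
    if "q \<in> W'" for q
  proof -
    have q: "q \<in> prime_spec R" "q \<in> W" using open_prime * that by blast+
    show ?thesis using *(8)[OF that] *(4-7) q loc_add[OF q(1), of a s b t] primeD(5)[OF q(1)]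
      by (simp add: spec_sections_def)
  qed
  then show "\<exists>W' a' s'. openin (zariski R) W' \<and> W' \<subseteq> W \<and> p \<in> W' \<and> a' \<in> carrier R \<and> s' \<in> carrier R \<and>
      (\<forall>q\<in>W'. s' \<notin> q \<and> (\<phi> \<oplus>\<^bsub>spec_sections R W\<^esub> \<tau>) q = frac R q a' s')"
    using * by (intro exI[of _ W'] exI[of _ "a \<otimes> t \<oplus> b \<otimes> s"] exI[of _ "s \<otimes> t"]) auto
qed

lemma regular_carrier:
  assumes "openin (zariski R) W" "c \<in> carrier R"
  shows "regular R W c \<in> carrier (spec_sections R W)"
proof (rule sec_carrierI)
  show "regular R W c \<in> extensional W" by (simp add: regular_def)
next
  fix p assume "p \<in> W"
  then show "\<exists>W' a s. openin (zariski R) W' \<and> W' \<subseteq> W \<and> p \<in> W' \<and> a \<in> carrier R \<and> s \<in> carrier R \<and>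
      (\<forall>q\<in>W'. s \<notin> q \<and> regular R W c q = frac R q a s)"
    using assms open_prime[OF assms(1)] primeD(3)
    by (intro exI[of _ W] exI[of _ c] exI[of _ \<one>]) (auto simp: regular_def)
qed

lemma sec_one: "\<one>\<^bsub>spec_sections R W\<^esub> = regular R W \<one>"
  by (simp add: spec_sections_def regular_def loc_one)

lemma sec_restrict:
  assumes "\<phi> \<in> carrier (spec_sections R W)" "openin (zariski R) V" "V \<subseteq> W"
  shows "restrict \<phi> V \<in> carrier (spec_sections R V)"
proof (rule sec_carrierI)
  fix p assume p: "p \<in> V"
  obtain W' a s where *: "openin (zariski R) W'" "W' \<subseteq> W" "p \<in> W'" "a \<in> carrier R" "s \<in> carrier R"
    "\<And>q. q \<in> W' \<Longrightarrow> s \<notin> q" "\<And>q. q \<in> W' \<Longrightarrow> \<phi> q = frac R q a s"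
    using sec_localE[OF assms(1) subsetD[OF assms(3) p]] by metis
  then show "\<exists>W' a s. openin (zariski R) W' \<and> W' \<subseteq> V \<and> p \<in> W' \<and> a \<in> carrier R \<and> s \<in> carrier R \<and>
      (\<forall>q\<in>W'. s \<notin> q \<and> restrict \<phi> V q = frac R q a s)"
    using p assms(2) by (intro exI[of _ "W' \<inter> V"] exI[of _ a] exI[of _ s]) auto
qed simp

section \<open>Units of the localizations and of the stalks\<close>

lemma loc_inverse:
  assumes p: "p \<in> prime_spec R" and c: "a \<in> carrier R - p" "s \<in> carrier R - p"
  shows "frac R p a s \<otimes>\<^bsub>loc R p\<^esub> frac R p s a = \<one>\<^bsub>loc R p\<^esub>"
proof -
  have "s \<otimes> a \<in> carrier R - p" using c primeD(5)[OF p] by auto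
  then have "frac R p (a \<otimes> s) (s \<otimes> a) = frac R p \<one> \<one>"
    using c primeD(3)[OF p] by (intro frac_eqI[OF p]) (simp_all add: m_ac)
  then show ?thesis using c by (simp add: loc_mult[OF p] loc_one)
qed

text \<open>If \<open>a/s\<close> times \<open>b/t\<close> is 1, then \<open>u a b = u s t\<close>
  for some \<open>u\<close> outside \<open>p\<close>; the right-hand side is outside the prime,
  hence so is \<open>a\<close>. This is what makes \<open>loc R p\<close> a local ring.\<close>

lemma frac_Unit_iff:
  assumes p: "p \<in> prime_spec R" and c: "a \<in> carrier R" "s \<in> carrier R - p"
  shows "frac R p a s \<in> Units (loc R p) \<longleftrightarrow> a \<notin> p"
proof
  assume "frac R p a s \<in> Units (loc R p)"
  then obtain c where cc: "c \<in> carrier (loc R p)" "frac R p a s \<otimes>\<^bsub>loc R p\<^esub> c = \<one>\<^bsub>loc R p\<^esub>"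
    unfolding Units_def by (simp only: mem_Collect_eq) (elim conjE bexE)
  then obtain b t where bt: "b \<in> carrier R" "t \<in> carrier R - p"
    "frac R p a s \<otimes>\<^bsub>loc R p\<^esub> frac R p b t = \<one>\<^bsub>loc R p\<^esub>"
    by (metis loc_carrierE)
  have st: "s \<otimes> t \<in> carrier R - p" using primeD(5)[OF p] c bt by auto
  from bt have "frac R p (a \<otimes> b) (s \<otimes> t) = frac R p \<one> \<one>" using loc_mult[OF p c, of b t] by (simp add: loc_one)
  then obtain u where u: "u \<in> carrier R - p" "u \<otimes> (a \<otimes> b \<otimes> \<one>) = u \<otimes> (\<one> \<otimes> (s \<otimes> t))"
    using frac_eq_iff[OF p, of "a \<otimes> b" \<one> "s \<otimes> t" \<one>] primeD(3)[OF p] st c bt by auto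
  have "u \<otimes> (\<one> \<otimes> (s \<otimes> t)) \<notin> p" using u(1) st primeD(5)[OF p] by auto
  then show "a \<notin> p" unfolding u(2)[symmetric] using u(1) c bt primeD(5)[OF p] by auto
next
  assume a: "a \<notin> p"
  have "frac R p a s \<in> carrier (loc R p)" "frac R p s a \<in> carrier (loc R p)"
    using a c by (simp_all add: frac_carrier)
  then show "frac R p a s \<in> Units (loc R p)"
    unfolding Units_def using loc_inverse[OF p, of a s] loc_inverse[OF p, of s a] a c
    by (simp only: mem_Collect_eq) (intro conjI bexI[of _ "frac R p s a"]; simp)
qed

text \<open>On the basic open set where a numerator does not vanish the reversed fraction is an
  inverse. Units of the stalk at \<open>x\<close> are therefore visible in \<open>loc R x\<close>,
  and no direct limit has to be formed.\<close>

lemma unit_germ_Spec_iff: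
  assumes W: "openin (zariski R) W" and \<phi>: "\<phi> \<in> carrier (spec_sections R W)" and x: "x \<in> W"
  shows "unit_germ (Spec R) x W \<phi> \<longleftrightarrow> \<phi> x \<in> Units (loc R x)"
proof
  assume "unit_germ (Spec R) x W \<phi>"
  then obtain W' \<tau> where W': "openin (zariski R) W'" "W' \<subseteq> W" "x \<in> W'"
    and t: "\<tau> \<in> carrier (spec_sections R W')"
    "\<tau> \<otimes>\<^bsub>spec_sections R W'\<^esub> restrict \<phi> W' = \<one>\<^bsub>spec_sections R W'\<^esub>"
    "restrict \<phi> W' \<otimes>\<^bsub>spec_sections R W'\<^esub> \<tau> = \<one>\<^bsub>spec_sections R W'\<^esub>"
    unfolding unit_germ_def Spec_simps Units_def
    by (elim exE conjE CollectE bexE)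
  have "\<tau> x \<otimes>\<^bsub>loc R x\<^esub> \<phi> x = \<one>\<^bsub>loc R x\<^esub>" "\<phi> x \<otimes>\<^bsub>loc R x\<^esub> \<tau> x = \<one>\<^bsub>loc R x\<^esub>"
    using fun_cong[OF t(2), of x] fun_cong[OF t(3), of x] W' by (simp_all add: spec_sections_def)
  then show "\<phi> x \<in> Units (loc R x)"
    unfolding Units_def using sec_value[OF \<phi> x] sec_value[OF t(1) W'(3)] by blast
next
  assume unit: "\<phi> x \<in> Units (loc R x)"
  obtain W1 a s where 1: "openin (zariski R) W1" "W1 \<subseteq> W" "x \<in> W1" "a \<in> carrier R" "s \<in> carrier R"
    "\<And>q. q \<in> W1 \<Longrightarrow> s \<notin> q" "\<And>q. q \<in> W1 \<Longrightarrow> \<phi> q = frac R q a s"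
    using sec_localE[OF \<phi> x] by metis
  have xp: "x \<in> prime_spec R" using open_prime[OF W x] .
  have ax: "a \<notin> x" using unit 1 frac_Unit_iff[OF xp, of a s] by auto
  define W2 where "W2 = W1 \<inter> {p \<in> prime_spec R. a \<notin> p}"
  have W2: "openin (zariski R) W2" "W2 \<subseteq> W" "x \<in> W2"
    unfolding W2_def using 1 ax xp openin_basic by auto
  define \<tau> where "\<tau> = (\<lambda>q\<in>W2. frac R q s a)"
  have \<tau>: "\<tau> \<in> carrier (spec_sections R W2)"
  proof (rule sec_carrierI)
    fix p assume "p \<in> W2"
    then show "\<exists>W' b t. openin (zariski R) W' \<and> W' \<subseteq> W2 \<and> p \<in> W' \<and> b \<in> carrier R \<and> t \<in> carrier R \<and>
        (\<forall>q\<in>W'. t \<notin> q \<and> \<tau> q = frac R q b t)"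
      using W2(1) 1 by (intro exI[of _ W2] exI[of _ s] exI[of _ a]) (auto simp: \<tau>_def W2_def)
  qed (simp add: \<tau>_def)
  have eq: "frac R q a s \<otimes>\<^bsub>loc R q\<^esub> frac R q s a = \<one>\<^bsub>loc R q\<^esub>"
    "frac R q s a \<otimes>\<^bsub>loc R q\<^esub> frac R q a s = \<one>\<^bsub>loc R q\<^esub>" if "q \<in> W2" for q
  proof -
    have q: "q \<in> prime_spec R" "a \<notin> q" "s \<notin> q" using that 1 by (auto simp: W2_def)
    show "frac R q a s \<otimes>\<^bsub>loc R q\<^esub> frac R q s a = \<one>\<^bsub>loc R q\<^esub>"
      "frac R q s a \<otimes>\<^bsub>loc R q\<^esub> frac R q a s = \<one>\<^bsub>loc R q\<^esub>"
      using q 1(4,5) by (simp_all add: loc_inverse)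
  qed
  have "W2 \<subseteq> W1" by (simp add: W2_def)
  then have "restrict \<phi> W2 \<otimes>\<^bsub>spec_sections R W2\<^esub> \<tau> = \<one>\<^bsub>spec_sections R W2\<^esub>"
    "\<tau> \<otimes>\<^bsub>spec_sections R W2\<^esub> restrict \<phi> W2 = \<one>\<^bsub>spec_sections R W2\<^esub>"
    using eq 1(7) by (simp_all add: spec_sections_def \<tau>_def subset_eq cong: restrict_cong)
  then have "restrict \<phi> W2 \<in> Units (spec_sections R W2)"
    unfolding Units_def using \<tau> sec_restrict[OF \<phi> W2(1,2)]
    by (intro CollectI conjI bexI[of _ \<tau>])
  then show "unit_germ (Spec R) x W \<phi>"
    unfolding unit_germ_def Spec_simps using W2 by blast
qed

end

section \<open>Inverting a morphism of ringed spaces\<close>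

lemma open_subspace_simps [simp]:
  "rs_top (open_subspace M W) = subtopology (rs_top M) W"
  "rs_sec (open_subspace M W) = rs_sec M" "rs_res (open_subspace M W) = rs_res M"
  by (simp_all add: open_subspace_def)

lemma openin_open_subspace:
  "openin (rs_top M) W \<Longrightarrow> openin (rs_top (open_subspace M W)) V \<longleftrightarrow> openin (rs_top M) V \<and> V \<subseteq> W"
  by (simp add: openin_open_subtopology)

lemma lrs_morphismD:
  assumes "lrs_morphism M N F"
  shows "continuous_map (rs_top M) (rs_top N) (pt F)"
    "\<And>W. openin (rs_top N) W \<Longrightarrow> pb F W \<in> ring_hom (rs_sec N W) (rs_sec M (preim M (pt F) W))"
    "\<And>W W' s. openin (rs_top N) W \<Longrightarrow> openin (rs_top N) W' \<Longrightarrow> W' \<subseteq> W \<Longrightarrow> s \<in> carrier (rs_sec N W) \<Longrightarrow>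
       pb F W' (rs_res N W W' s) = rs_res M (preim M (pt F) W) (preim M (pt F) W') (pb F W s)"
    "\<And>x W s. x \<in> rs_points M \<Longrightarrow> openin (rs_top N) W \<Longrightarrow> pt F x \<in> W \<Longrightarrow> s \<in> carrier (rs_sec N W) \<Longrightarrow>
       unit_germ M x (preim M (pt F) W) (pb F W s) \<Longrightarrow> unit_germ N (pt F x) W s"
  using assms unfolding lrs_morphism_def by simp_all

lemma lrs_morphism_corestrict:
  assumes F: "lrs_morphism M N F" and W: "openin (rs_top N) W" and im: "pt F ` rs_points M \<subseteq> W"
  shows "lrs_morphism M (open_subspace N W) F"
  unfolding lrs_morphism_def
proof (intro conjI allI impI ballI)
  show "continuous_map (rs_top M) (rs_top (open_subspace N W)) (pt F)"
    using lrs_morphismD(1)[OF F] im by (auto simp: continuous_map_in_subtopology)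
next
  fix V assume "openin (rs_top (open_subspace N W)) V"
  then show "pb F V \<in> ring_hom (rs_sec (open_subspace N W) V) (rs_sec M (preim M (pt F) V))"
    using lrs_morphismD(2)[OF F] by (simp add: openin_open_subtopology[OF W])
next
  fix V V' s
  assume "openin (rs_top (open_subspace N W)) V" "openin (rs_top (open_subspace N W)) V'" "V' \<subseteq> V"
    "s \<in> carrier (rs_sec (open_subspace N W) V)"
  then show "pb F V' (rs_res (open_subspace N W) V V' s) =
      rs_res M (preim M (pt F) V) (preim M (pt F) V') (pb F V s)"
    using lrs_morphismD(3)[OF F] by (simp add: openin_open_subtopology[OF W])
next
  fix x V s
  assume "x \<in> rs_points M" "openin (rs_top (open_subspace N W)) V" "pt F x \<in> V"
    "s \<in> carrier (rs_sec (open_subspace N W) V)"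
    "unit_germ M x (preim M (pt F) V) (pb F V s)"
  then have V: "V \<subseteq> W" and "unit_germ N (pt F x) V s"
    using lrs_morphismD(4)[OF F] by (simp_all add: openin_open_subtopology[OF W])
  then show "unit_germ (open_subspace N W) (pt F x) V s"
    unfolding unit_germ_def openin_open_subspace[OF W] by auto
qed

lemma ring_hom_Units:
  assumes h: "h \<in> ring_hom A B" and u: "u \<in> Units A"
  shows "h u \<in> Units B"
proof -
  from u obtain v where u': "u \<in> carrier A" and v: "v \<in> carrier A" "v \<otimes>\<^bsub>A\<^esub> u = \<one>\<^bsub>A\<^esub>" "u \<otimes>\<^bsub>A\<^esub> v = \<one>\<^bsub>A\<^esub>"
    unfolding Units_def by blast
  have "h v \<otimes>\<^bsub>B\<^esub> h u = \<one>\<^bsub>B\<^esub>" "h u \<otimes>\<^bsub>B\<^esub> h v = \<one>\<^bsub>B\<^esub>"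
    using v(2,3) ring_hom_mult[OF h v(1) u'] ring_hom_mult[OF h u' v(1)] ring_hom_one[OF h] by simp_all
  then show ?thesis unfolding Units_def using ring_hom_closed[OF h] u' v(1) by blast
qed

text \<open>The inverse of a homeomorphism that is bijective on sections is built from
  \<open>inv_into\<close>. Records of type \<open>ringed_space\<close> satisfy no axioms by
  themselves, so closure of the sections under the ring operations and under restriction is assumed;
  it places the sections compared below in the carriers on which \<open>pb F\<close> is
  injective.\<close>

lemma lrs_inverse_exists:
  assumes F: "lrs_morphism M N F"
    and inj: "inj_on (pt F) (rs_points M)" and surj: "pt F ` rs_points M = rs_points N"
    and opn: "\<And>V. openin (rs_top M) V \<Longrightarrow> openin (rs_top N) (pt F ` V)"
    and bij: "\<And>V. openin (rs_top N) V \<Longrightarrow>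
      bij_betw (pb F V) (carrier (rs_sec N V)) (carrier (rs_sec M (preim M (pt F) V)))"
    and closed: "\<And>V s t. openin (rs_top N) V \<Longrightarrow> s \<in> carrier (rs_sec N V) \<Longrightarrow> t \<in> carrier (rs_sec N V) \<Longrightarrow>
      s \<otimes>\<^bsub>rs_sec N V\<^esub> t \<in> carrier (rs_sec N V) \<and> s \<oplus>\<^bsub>rs_sec N V\<^esub> t \<in> carrier (rs_sec N V)"
      "\<And>V. openin (rs_top N) V \<Longrightarrow> \<one>\<^bsub>rs_sec N V\<^esub> \<in> carrier (rs_sec N V)"
    and res: "\<And>V V' s. openin (rs_top N) V \<Longrightarrow> openin (rs_top N) V' \<Longrightarrow> V' \<subseteq> V \<Longrightarrow>
      s \<in> carrier (rs_sec N V) \<Longrightarrow> rs_res N V V' s \<in> carrier (rs_sec N V')"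
  shows "\<exists>G. lrs_inverse M N F G"
proof -
  define gp where "gp = inv_into (rs_points M) (pt F)"
  define gb where "gb = (\<lambda>V. inv_into (carrier (rs_sec N (pt F ` V))) (pb F (pt F ` V)))"
  define G where "G = \<lparr>pt = gp, pb = gb\<rparr>"
  have G: "pt G = gp" "pb G = gb" by (simp_all add: G_def)
  have gpF: "gp (pt F x) = x" if "x \<in> rs_points M" for x
    using that inj by (simp add: gp_def)
  have Fgp: "pt F (gp y) = y" and gpM: "gp y \<in> rs_points M" if "y \<in> rs_points N" for y
    using that surj unfolding gp_def by (simp_all add: f_inv_into_f inv_into_into)
  have sub: "V \<subseteq> rs_points M" if "openin (rs_top M) V" for V using that by (rule openin_subset)
  have preF: "preim M (pt F) (pt F ` V) = V" if "openin (rs_top M) V" for V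
    using sub[OF that] inj by (auto simp: preim_def inj_on_def)
  have preG: "preim N gp V = pt F ` V" if "openin (rs_top M) V" for V
    using sub[OF that] surj gpF Fgp by (force simp: preim_def image_iff)
  have preGF: "pt F ` preim M (pt F) V = V" if "openin (rs_top N) V" for V
    using openin_subset[OF that] surj by (auto simp: preim_def)
  have preMopen: "openin (rs_top M) (preim M (pt F) V)" if "openin (rs_top N) V" for V
    using lrs_morphismD(1)[OF F] that by (simp add: preim_def continuous_map)
  have bijV: "bij_betw (pb F (pt F ` V)) (carrier (rs_sec N (pt F ` V))) (carrier (rs_sec M V))"
    if "openin (rs_top M) V" for V using bij[OF opn[OF that]] preF[OF that] by simp
  have gbF: "gb V (pb F (pt F ` V) s) = s" if "openin (rs_top M) V" "s \<in> carrier (rs_sec N (pt F ` V))" for V s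
    using bijV[OF that(1)] that(2) by (simp add: gb_def bij_betw_def)
  have Fgb: "pb F (pt F ` V) (gb V s) = s" and gbc: "gb V s \<in> carrier (rs_sec N (pt F ` V))"
    if "openin (rs_top M) V" "s \<in> carrier (rs_sec M V)" for V s
    using bijV[OF that(1)] that(2) unfolding gb_def bij_betw_def
    by (simp_all add: f_inv_into_f inv_into_into)
  have hom: "pb F (pt F ` V) \<in> ring_hom (rs_sec N (pt F ` V)) (rs_sec M V)" if "openin (rs_top M) V" for V
    using lrs_morphismD(2)[OF F opn[OF that]] preF[OF that] by simp
  have "lrs_morphism N M G"
    unfolding lrs_morphism_def G
  proof (intro conjI allI impI ballI)
    show "continuous_map (rs_top N) (rs_top M) gp"
      unfolding continuous_map
      using gpM preG opn by (auto simp: preim_def)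
  next
    fix V assume V: "openin (rs_top M) V"
    show "gb V \<in> ring_hom (rs_sec M V) (rs_sec N (preim N gp V))"
      unfolding preG[OF V]
    proof (rule ring_hom_memI)
      fix x y assume x: "x \<in> carrier (rs_sec M V)" and y: "y \<in> carrier (rs_sec M V)"
      show "gb V x \<in> carrier (rs_sec N (pt F ` V))" by (rule gbc[OF V x])
      have "x \<otimes>\<^bsub>rs_sec M V\<^esub> y = pb F (pt F ` V) (gb V x \<otimes>\<^bsub>rs_sec N (pt F ` V)\<^esub> gb V y)"
        using ring_hom_mult[OF hom[OF V] gbc[OF V x] gbc[OF V y]] Fgb V x y by simp
      then show "gb V (x \<otimes>\<^bsub>rs_sec M V\<^esub> y) = gb V x \<otimes>\<^bsub>rs_sec N (pt F ` V)\<^esub> gb V y"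
        using gbF[OF V] closed(1)[OF opn[OF V] gbc[OF V x] gbc[OF V y]] by simp
      have "x \<oplus>\<^bsub>rs_sec M V\<^esub> y = pb F (pt F ` V) (gb V x \<oplus>\<^bsub>rs_sec N (pt F ` V)\<^esub> gb V y)"
        using ring_hom_add[OF hom[OF V] gbc[OF V x] gbc[OF V y]] Fgb V x y by simp
      then show "gb V (x \<oplus>\<^bsub>rs_sec M V\<^esub> y) = gb V x \<oplus>\<^bsub>rs_sec N (pt F ` V)\<^esub> gb V y"
        using gbF[OF V] closed(1)[OF opn[OF V] gbc[OF V x] gbc[OF V y]] by simp
    next
      show "gb V \<one>\<^bsub>rs_sec M V\<^esub> = \<one>\<^bsub>rs_sec N (pt F ` V)\<^esub>"
        using gbF[OF V closed(2)[OF opn[OF V]]] ring_hom_one[OF hom[OF V]] by simp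
    qed
  next
    fix V V' s
    assume V: "openin (rs_top M) V" "openin (rs_top M) V'" "V' \<subseteq> V" and s: "s \<in> carrier (rs_sec M V)"
    have sub': "pt F ` V' \<subseteq> pt F ` V" using V(3) by blast
    have "pb F (pt F ` V') (rs_res N (pt F ` V) (pt F ` V') (gb V s)) = rs_res M V V' s"
      using lrs_morphismD(3)[OF F opn[OF V(1)] opn[OF V(2)] sub' gbc[OF V(1) s]] V s
      by (simp add: preF Fgb)
    then show "gb V' (rs_res M V V' s) = rs_res N (preim N gp V) (preim N gp V') (gb V s)"
      unfolding preG[OF V(1)] preG[OF V(2)]
      using gbF[OF V(2) res[OF opn[OF V(1)] opn[OF V(2)] sub' gbc[OF V(1) s]]] by simp
  next
    fix y V s
    assume y: "y \<in> rs_points N" and V: "openin (rs_top M) V" and yV: "gp y \<in> V"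
      and s: "s \<in> carrier (rs_sec M V)" and u: "unit_germ N y (preim N gp V) (gb V s)"
    from u obtain W' where W': "openin (rs_top N) W'" "W' \<subseteq> pt F ` V" "y \<in> W'"
      "rs_res N (pt F ` V) W' (gb V s) \<in> Units (rs_sec N W')"
      unfolding unit_germ_def preG[OF V] by blast
    let ?V' = "preim M (pt F) W'"
    have sub': "?V' \<subseteq> V" using W'(2) preF[OF V] by (auto simp: preim_def)
    \<comment> \<open>Locality of the inverse needs only that ring homomorphisms preserve units: a
      section of \<open>N\<close> that is a unit on \<open>W'\<close> pulls back to a unit on the
      preimage.\<close>
    have "pb F W' (rs_res N (pt F ` V) W' (gb V s)) \<in> Units (rs_sec M ?V')"
      using ring_hom_Units[OF lrs_morphismD(2)[OF F W'(1)] W'(4)] .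
    then have "rs_res M V ?V' s \<in> Units (rs_sec M ?V')"
      using lrs_morphismD(3)[OF F opn[OF V] W'(1,2) gbc[OF V s]] by (simp add: preF[OF V] Fgb[OF V s])
    moreover have "gp y \<in> ?V'" using y W'(3) gpM Fgp by (simp add: preim_def)
    ultimately show "unit_germ M (gp y) V s"
      unfolding unit_germ_def using preMopen[OF W'(1)] sub' by blast
  qed
  moreover have "eq_morph M M (comp_morph N G F) id_morph"
    unfolding eq_morph_def comp_morph_def id_morph_def G using gpF Fgb preG by simp
  moreover have "eq_morph N N (comp_morph M F G) id_morph"
    unfolding eq_morph_def comp_morph_def id_morph_def G
    using Fgp gbF[OF preMopen] preGF by simp
  ultimately show ?thesis using F unfolding lrs_inverse_def by blast
qed

section \<open>Morphisms of spectra induced by ring homomorphisms\<close>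

definition spec_pt :: "('a, 'm) ring_scheme \<Rightarrow> ('a \<Rightarrow> 'b) \<Rightarrow> 'b set \<Rightarrow> 'a set"
  where "spec_pt A h q = {a \<in> carrier A. h a \<in> q}"

text \<open>A union over all representatives, as in \<open>loc\<close>. It takes the intended value
  on fractions at the prime \<open>spec_pt A h q\<close>, where the sets united coincide.\<close>

definition loc_map :: "('b, 'm) ring_scheme \<Rightarrow> ('a \<Rightarrow> 'b) \<Rightarrow> 'b set \<Rightarrow> ('a \<times> 'a) set \<Rightarrow> ('b \<times> 'b) set"
  where "loc_map B h q c = (\<Union>(a, s)\<in>c. frac B q (h a) (h s))"

definition Spec_map :: "('a, 'm) ring_scheme \<Rightarrow> ('b, 'n) ring_scheme \<Rightarrow> ('a \<Rightarrow> 'b) \<Rightarrow>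
    ('b set, 'b spec_sec, 'a set, 'a spec_sec) rs_morph"
  where "Spec_map A B h = \<lparr>pt = spec_pt A h,
    pb = (\<lambda>W \<phi>. \<lambda>q\<in>preim (Spec B) (spec_pt A h) W. loc_map B h q (\<phi> (spec_pt A h q)))\<rparr>"

lemma Spec_map_simps:
  "pt (Spec_map A B h) = spec_pt A h"
  "pb (Spec_map A B h) W \<phi> =
    (\<lambda>q\<in>preim (Spec B) (spec_pt A h) W. loc_map B h q (\<phi> (spec_pt A h q)))"
  by (simp_all add: Spec_map_def)

context ring_hom_cring
begin

lemma spec_pt_prime:
  assumes q: "q \<in> prime_spec S"
  shows "spec_pt R h q \<in> prime_spec R"
proof -
  note q' = S.primeD[OF q]
  interpret q: primeideal q S by (rule q'(1))
  have "primeideal (spec_pt R h q) R"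
  proof (rule primeidealI)
    show "ideal (spec_pt R h q) R"
      unfolding spec_pt_def by (rule ring.ideal_vimage[OF q.is_ideal])
    show "cring R" by (rule R.is_cring)
    have "\<one> \<notin> spec_pt R h q" using q'(3) by (simp add: spec_pt_def)
    then show "carrier R \<noteq> spec_pt R h q" by blast
    show "a \<in> spec_pt R h q \<or> b \<in> spec_pt R h q"
      if "a \<in> carrier R" "b \<in> carrier R" "a \<otimes> b \<in> spec_pt R h q" for a b
      using that q'(5)[of "h a" "h b"] by (simp add: spec_pt_def)
  qed
  then show ?thesis by (simp add: prime_spec_def)
qed

lemma spec_pt_mem: "a \<in> carrier R \<Longrightarrow> a \<in> spec_pt R h q \<longleftrightarrow> h a \<in> q"
  by (simp add: spec_pt_def)

lemma preim_spec_pt: "preim (Spec S) (spec_pt R h) W = {q \<in> prime_spec S. spec_pt R h q \<in> W}"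
  by (simp add: preim_def S.Spec_points)

lemma preim_open:
  assumes "openin (zariski R) W"
  shows "openin (zariski S) (preim (Spec S) (spec_pt R h) W)"
proof -
  from assms obtain E where E: "E \<subseteq> carrier R" "W = {p \<in> prime_spec R. \<not> E \<subseteq> p}"
    unfolding openin_zariski by blast
  have "preim (Spec S) (spec_pt R h) W = {q \<in> prime_spec S. \<not> h ` E \<subseteq> q}"
    unfolding preim_spec_pt E(2) using E(1) spec_pt_prime by (auto simp: spec_pt_def)
  then show ?thesis unfolding openin_zariski using E(1) by (intro exI[of _ "h ` E"]) auto
qed

text \<open>Applying \<open>h\<close> to the equation that identifies two representatives identifies
  their images; the multiplier stays outside \<open>q\<close> because it was chosen outside the
  preimage of \<open>q\<close>.\<close>

lemma loc_map_frac:
  assumes q: "q \<in> prime_spec S" and c: "a \<in> carrier R" "s \<in> carrier R" "h s \<notin> q"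
  shows "loc_map S h q (frac R (spec_pt R h q) a s) = frac S q (h a) (h s)"
  unfolding loc_map_def
proof (rule UN_pairs_const)
  let ?p = "spec_pt R h q"
  have p: "?p \<in> prime_spec R" by (rule spec_pt_prime[OF q])
  have s: "s \<in> carrier R - ?p" using c by (simp add: spec_pt_mem)
  show "frac R ?p a s \<noteq> {}" using R.frac_mem_self[OF p c(1) s] by blast
  fix b t assume "(b, t) \<in> frac R ?p a s"
  then obtain u where bt: "b \<in> carrier R" "t \<in> carrier R - ?p"
    and u: "u \<in> carrier R - ?p" "u \<otimes> (a \<otimes> t) = u \<otimes> (b \<otimes> s)"
    unfolding R.frac_mem_iff by (elim conjE bexE)
  have "h u \<otimes>\<^bsub>S\<^esub> (h b \<otimes>\<^bsub>S\<^esub> h s) = h u \<otimes>\<^bsub>S\<^esub> (h a \<otimes>\<^bsub>S\<^esub> h t)"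
    using arg_cong[OF u(2), of h] u(1) bt c by simp
  then show "frac S q (h b) (h t) = frac S q (h a) (h s)"
    using u bt c S.frac_eq_iff[OF q, of "h b" "h a" "h t" "h s"] by (auto simp: spec_pt_def)
qed

lemma loc_map_ops:
  assumes q: "q \<in> prime_spec S" and x: "x \<in> carrier (loc R (spec_pt R h q))" "y \<in> carrier (loc R (spec_pt R h q))"
  shows "loc_map S h q x \<in> carrier (loc S q)"
    "loc_map S h q (x \<otimes>\<^bsub>loc R (spec_pt R h q)\<^esub> y) = loc_map S h q x \<otimes>\<^bsub>loc S q\<^esub> loc_map S h q y"
    "loc_map S h q (x \<oplus>\<^bsub>loc R (spec_pt R h q)\<^esub> y) = loc_map S h q x \<oplus>\<^bsub>loc S q\<^esub> loc_map S h q y"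
proof -
  let ?p = "spec_pt R h q"
  have p: "?p \<in> prime_spec R" by (rule spec_pt_prime[OF q])
  from x obtain a s b t where as: "a \<in> carrier R" "s \<in> carrier R - ?p" "x = frac R ?p a s"
    and bt: "b \<in> carrier R" "t \<in> carrier R - ?p" "y = frac R ?p b t"
    by (metis R.loc_carrierE)
  have st: "h s \<notin> q" "h t \<notin> q" "h s \<otimes>\<^bsub>S\<^esub> h t \<notin> q"
    using as bt S.primeD(5)[OF q, of "h s" "h t"] by (auto simp: spec_pt_def)
  show "loc_map S h q x \<in> carrier (loc S q)"
    using as st by (simp add: loc_map_frac[OF q] S.frac_carrier)
  show "loc_map S h q (x \<otimes>\<^bsub>loc R ?p\<^esub> y) = loc_map S h q x \<otimes>\<^bsub>loc S q\<^esub> loc_map S h q y"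
    using as bt st by (simp add: R.loc_mult[OF p] S.loc_mult[OF q] loc_map_frac[OF q])
  show "loc_map S h q (x \<oplus>\<^bsub>loc R ?p\<^esub> y) = loc_map S h q x \<oplus>\<^bsub>loc S q\<^esub> loc_map S h q y"
    using as bt st by (simp add: R.loc_add[OF p] S.loc_add[OF q] loc_map_frac[OF q])
qed

lemma Spec_map_sec:
  assumes W: "openin (zariski R) W" and \<phi>: "\<phi> \<in> carrier (spec_sections R W)"
  shows "pb (Spec_map R S h) W \<phi> \<in> carrier (spec_sections S (preim (Spec S) (spec_pt R h) W))"
proof (rule S.sec_carrierI)
  fix q assume q: "q \<in> preim (Spec S) (spec_pt R h) W"
  then have qW: "spec_pt R h q \<in> W" and "q \<in> prime_spec S" by (simp_all add: preim_spec_pt)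
  obtain W' a s where *: "openin (zariski R) W'" "W' \<subseteq> W" "spec_pt R h q \<in> W'" "a \<in> carrier R" "s \<in> carrier R"
    "\<And>p. p \<in> W' \<Longrightarrow> s \<notin> p" "\<And>p. p \<in> W' \<Longrightarrow> \<phi> p = frac R p a s"
    using R.sec_localE[OF \<phi> qW] by metis
  have "h s \<notin> q' \<and> pb (Spec_map R S h) W \<phi> q' = frac S q' (h a) (h s)"
    if q': "q' \<in> preim (Spec S) (spec_pt R h) W'" for q'
  proof -
    have m: "q' \<in> prime_spec S" "spec_pt R h q' \<in> W'" "q' \<in> preim (Spec S) (spec_pt R h) W"
      using q' *(2) by (auto simp: preim_spec_pt)
    then have "h s \<notin> q'" using *(5,6) spec_pt_mem by blast
    then show ?thesis using m * by (simp add: Spec_map_simps loc_map_frac)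
  qed
  moreover have "q \<in> preim (Spec S) (spec_pt R h) W'" "preim (Spec S) (spec_pt R h) W' \<subseteq> preim (Spec S) (spec_pt R h) W"
    using q * by (auto simp: preim_spec_pt)
  ultimately show "\<exists>W' a s. openin (zariski S) W' \<and> W' \<subseteq> preim (Spec S) (spec_pt R h) W \<and> q \<in> W' \<and>
      a \<in> carrier S \<and> s \<in> carrier S \<and> (\<forall>q'\<in>W'. s \<notin> q' \<and> pb (Spec_map R S h) W \<phi> q' = frac S q' a s)"
    using preim_open[OF *(1)] *(4,5)
    by (intro exI[of _ "preim (Spec S) (spec_pt R h) W'"] exI[of _ "h a"] exI[of _ "h s"]) simp
qed (simp add: Spec_map_simps)

lemma Spec_map_regular:
  assumes "c \<in> carrier R"
  shows "pb (Spec_map R S h) W (regular R W c) = regular S (preim (Spec S) (spec_pt R h) W) (h c)"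
proof -
  have "loc_map S h q (regular R W c (spec_pt R h q)) = frac S q (h c) \<one>\<^bsub>S\<^esub>"
    if "q \<in> preim (Spec S) (spec_pt R h) W" for q
    using that loc_map_frac[of q c "\<one>"] S.primeD(3) assms by (simp add: preim_spec_pt regular_def)
  then show ?thesis by (simp add: Spec_map_simps regular_def cong: restrict_cong)
qed

lemma Spec_map_hom:
  assumes W: "openin (zariski R) W"
  shows "pb (Spec_map R S h) W \<in> ring_hom (spec_sections R W) (spec_sections S (preim (Spec S) (spec_pt R h) W))"
proof (rule ring_hom_memI)
  let ?P = "preim (Spec S) (spec_pt R h) W"
  fix \<phi> \<tau> assume \<phi>: "\<phi> \<in> carrier (spec_sections R W)" and \<tau>: "\<tau> \<in> carrier (spec_sections R W)"
  show "pb (Spec_map R S h) W \<phi> \<in> carrier (spec_sections S ?P)" by (rule Spec_map_sec[OF W \<phi>])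
  have v: "q \<in> prime_spec S \<and> spec_pt R h q \<in> W \<and> \<phi> (spec_pt R h q) \<in> carrier (loc R (spec_pt R h q)) \<and>
    \<tau> (spec_pt R h q) \<in> carrier (loc R (spec_pt R h q))" if "q \<in> ?P" for q
    using that R.sec_value[OF \<phi>] R.sec_value[OF \<tau>] by (simp add: preim_spec_pt)
  show "pb (Spec_map R S h) W (\<phi> \<otimes>\<^bsub>spec_sections R W\<^esub> \<tau>) =
      pb (Spec_map R S h) W \<phi> \<otimes>\<^bsub>spec_sections S ?P\<^esub> pb (Spec_map R S h) W \<tau>"
    using v loc_map_ops(2) by (simp add: Spec_map_simps spec_sections_def cong: restrict_cong)
  show "pb (Spec_map R S h) W (\<phi> \<oplus>\<^bsub>spec_sections R W\<^esub> \<tau>) =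
      pb (Spec_map R S h) W \<phi> \<oplus>\<^bsub>spec_sections S ?P\<^esub> pb (Spec_map R S h) W \<tau>"
    using v loc_map_ops(3) by (simp add: Spec_map_simps spec_sections_def cong: restrict_cong)
next
  show "pb (Spec_map R S h) W \<one>\<^bsub>spec_sections R W\<^esub> = \<one>\<^bsub>spec_sections S (preim (Spec S) (spec_pt R h) W)\<^esub>"
    by (simp add: R.sec_one S.sec_one Spec_map_regular)
qed

lemma Spec_map_morphism: "lrs_morphism (Spec S) (Spec R) (Spec_map R S h)"
  unfolding lrs_morphism_def Spec_simps Spec_map_simps(1) S.zariski_topspace
proof (intro conjI allI impI ballI)
  show "continuous_map (zariski S) (zariski R) (spec_pt R h)"
    unfolding continuous_map R.zariski_topspace S.zariski_topspace
    using spec_pt_prime preim_open by (auto simp: preim_spec_pt)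
next
  fix W assume "openin (zariski R) W"
  then show "pb (Spec_map R S h) W \<in> ring_hom (spec_sections R W) (spec_sections S (preim (Spec S) (spec_pt R h) W))"
    by (rule Spec_map_hom)
next
  fix W W' :: "'a set set" and \<phi> assume "W' \<subseteq> W"
  then show "pb (Spec_map R S h) W' (restrict \<phi> W') =
      restrict (pb (Spec_map R S h) W \<phi>) (preim (Spec S) (spec_pt R h) W')"
    by (auto simp: Spec_map_simps preim_spec_pt restrict_def fun_eq_iff)
next
  fix x W \<phi> assume x: "x \<in> prime_spec S" and W: "openin (zariski R) W" and xW: "spec_pt R h x \<in> W"
    and \<phi>: "\<phi> \<in> carrier (spec_sections R W)"
    and u: "unit_germ (Spec S) x (preim (Spec S) (spec_pt R h) W) (pb (Spec_map R S h) W \<phi>)"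
  have p: "spec_pt R h x \<in> prime_spec R" by (rule spec_pt_prime[OF x])
  have xp: "x \<in> preim (Spec S) (spec_pt R h) W" using x xW by (simp add: preim_spec_pt)
  obtain a s where as: "a \<in> carrier R" "s \<in> carrier R - spec_pt R h x" "\<phi> (spec_pt R h x) = frac R (spec_pt R h x) a s"
    using R.loc_carrierE[OF R.sec_value[OF \<phi> xW]] by metis
  have "loc_map S h x (frac R (spec_pt R h x) a s) \<in> Units (loc S x)"
    using u xp as unfolding S.unit_germ_Spec_iff[OF preim_open[OF W] Spec_map_sec[OF W \<phi>] xp]
    by (simp add: Spec_map_simps)
  \<comment> \<open>A unit at \<open>x\<close> has its numerator \<open>h a\<close> outside
    \<open>x\<close>, that is, \<open>a\<close> outside the preimage of \<open>x\<close>: this is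
    the locality of the stalk maps.\<close>
  then have "h a \<notin> x"
    using as S.frac_Unit_iff[OF x, of "h a" "h s"] by (auto simp: loc_map_frac[OF x] spec_pt_mem)
  then have "\<phi> (spec_pt R h x) \<in> Units (loc R (spec_pt R h x))"
    unfolding as(3) R.frac_Unit_iff[OF p as(1,2)] using as(1) by (simp add: spec_pt_mem)
  then show "unit_germ (Spec R) (spec_pt R h x) W \<phi>"
    using R.unit_germ_Spec_iff[OF W \<phi> xW] by blast
qed

end

lemma Spec_map_id:
  assumes "cring A" and "\<And>a. a \<in> carrier A \<Longrightarrow> h a = a"
  shows "eq_morph (Spec A) (Spec A) (Spec_map A A h) id_morph"
proof -
  interpret A: cring A by fact
  interpret h: ring_hom_cring A A h
    by unfold_locales (auto intro!: ring_hom_memI simp: assms(2))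
  have pt: "spec_pt A h p = p" if "p \<in> prime_spec A" for p
    using A.primeD(2)[OF that] assms(2) by (auto simp: spec_pt_def)
  have lm: "loc_map A h p x = x" if p: "p \<in> prime_spec A" and x: "x \<in> carrier (loc A p)" for p x
  proof -
    obtain a s where *: "a \<in> carrier A" "s \<in> carrier A - p" "x = frac A p a s"
      using A.loc_carrierE[OF x] by metis
    then show ?thesis using h.loc_map_frac[OF p, of a s] assms(2) by (simp add: pt[OF p])
  qed
  have "pb (Spec_map A A h) W \<phi> = \<phi>"
    if W: "openin (zariski A) W" and \<phi>: "\<phi> \<in> carrier (spec_sections A W)" for W \<phi>
  proof -
    have P: "preim (Spec A) (spec_pt A h) W = W"
      using pt A.open_prime[OF W] by (auto simp: h.preim_spec_pt)
    show ?thesis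
    proof (rule A.sec_ext[OF _ \<phi>])
      show "pb (Spec_map A A h) W \<phi> \<in> carrier (spec_sections A W)"
        using h.Spec_map_sec[OF W \<phi>] by (simp add: P)
      show "pb (Spec_map A A h) W \<phi> p = \<phi> p" if "p \<in> W" for p
        using that A.open_prime[OF W that] A.sec_value[OF \<phi> that] by (simp add: Spec_map_simps P pt lm)
    qed
  qed
  then show ?thesis
    unfolding eq_morph_def using pt by (simp add: A.Spec_points Spec_simps(2) Spec_map_simps(1) id_morph_def) (simp add: Spec_simps(1))
qed

text \<open>The third map \<open>l\<close> is a parameter that has to agree with the composite on
  the carrier only: homomorphisms between coordinate rings are defined through chosen
  representatives and are controlled on classes alone.\<close>

lemma Spec_map_comp:
  assumes h: "ring_hom_cring A B h" and k: "ring_hom_cring B C k" and l: "ring_hom_cring A C l"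
    and eq: "\<And>a. a \<in> carrier A \<Longrightarrow> k (h a) = l a"
  shows "eq_morph (Spec C) (Spec A) (comp_morph (Spec B) (Spec_map A B h) (Spec_map B C k)) (Spec_map A C l)"
proof -
  interpret h: ring_hom_cring A B h by fact
  interpret k: ring_hom_cring B C k by fact
  interpret l: ring_hom_cring A C l by fact
  have pt: "spec_pt A h (spec_pt B k q) = spec_pt A l q" for q
    using eq by (auto simp: spec_pt_def)
  have lm: "loc_map C k q (loc_map B h (spec_pt B k q) x) = loc_map C l q x"
    if q: "q \<in> prime_spec C" and x: "x \<in> carrier (loc A (spec_pt A l q))" for q x
  proof -
    obtain a s where *: "a \<in> carrier A" "s \<in> carrier A - spec_pt A l q" "x = frac A (spec_pt A l q) a s"
      using h.R.loc_carrierE[OF x] by metis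
    have s: "l s \<notin> q" "h s \<notin> spec_pt B k q" using *(2) eq by (auto simp: spec_pt_def)
    have "loc_map B h (spec_pt B k q) x = frac B (spec_pt B k q) (h a) (h s)"
      unfolding *(3) pt[symmetric] using * s by (intro h.loc_map_frac k.spec_pt_prime q) auto
    then show ?thesis
      using * s eq k.loc_map_frac[OF q, of "h a" "h s"] l.loc_map_frac[OF q, of a s] by simp
  qed
  have "pb (Spec_map B C k) (preim (Spec B) (spec_pt A h) W) (pb (Spec_map A B h) W \<phi>) = pb (Spec_map A C l) W \<phi>"
    if W: "openin (zariski A) W" and \<phi>: "\<phi> \<in> carrier (spec_sections A W)" for W \<phi>
  proof -
    have P: "preim (Spec C) (spec_pt B k) (preim (Spec B) (spec_pt A h) W) = preim (Spec C) (spec_pt A l) W"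
      using k.spec_pt_prime by (auto simp: h.preim_spec_pt k.preim_spec_pt l.preim_spec_pt pt)
    have "loc_map C k q (pb (Spec_map A B h) W \<phi> (spec_pt B k q)) = loc_map C l q (\<phi> (spec_pt A l q))"
      if q: "q \<in> preim (Spec C) (spec_pt A l) W" for q
    proof -
      have "q \<in> prime_spec C" "spec_pt A l q \<in> W" using q by (simp_all add: l.preim_spec_pt)
      then show ?thesis
        using k.spec_pt_prime[of q] h.R.sec_value[OF \<phi>] by (simp add: Spec_map_simps h.preim_spec_pt pt lm)
    qed
    then show ?thesis unfolding Spec_map_simps(2)[of B] Spec_map_simps(2)[of A C] P
      by (simp cong: restrict_cong)
  qed
  then show ?thesis
    unfolding eq_morph_def comp_morph_def
    by (simp add: Spec_map_simps(1) pt Spec_simps)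
qed

lemma eq_morph_sym: "eq_morph M N F G \<Longrightarrow> eq_morph M N G F"
  by (simp add: eq_morph_def)

lemma eq_morph_trans: "eq_morph M N F G \<Longrightarrow> eq_morph M N G H \<Longrightarrow> eq_morph M N F H"
  by (simp add: eq_morph_def)

section \<open>Inverting one element of a ring\<close>

text \<open>The conditions on unit, numerators and kernel characterize \<open>S\<close> as
  \<open>R\<close> with \<open>g\<close> inverted, up to isomorphism. They stand in for a
  constructed localization because \<open>S\<close> will be the coordinate ring of \<open>Y\<close>,
  which comes with its own presentation.\<close>

locale inverts_element = ring_hom_cring +
  fixes g
  assumes g_carrier: "g \<in> carrier R"
    and g_unit: "h g \<in> Units S"
    and numerator: "\<And>b. b \<in> carrier S \<Longrightarrow> \<exists>k::nat. \<exists>a\<in>carrier R. b \<otimes>\<^bsub>S\<^esub> h g [^]\<^bsub>S\<^esub> k = h a"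
    and kernel: "\<And>a. a \<in> carrier R \<Longrightarrow> h a = \<zero>\<^bsub>S\<^esub> \<Longrightarrow> \<exists>k::nat. g [^] k \<otimes> a = \<zero>"
begin

abbreviation "D \<equiv> {p \<in> prime_spec R. g \<notin> p}"

lemma hg_carrier [simp]: "h g \<in> carrier S" using g_carrier by simp

lemma pow_hom: "h (g [^] (k::nat)) = h g [^]\<^bsub>S\<^esub> k"
  using g_carrier by (induction k) simp_all

lemma g_pow_carrier [simp]: "g [^] (k::nat) \<in> carrier R" using g_carrier by simp

lemma hg_notin: assumes q: "q \<in> prime_spec S" shows "h g [^]\<^bsub>S\<^esub> (k::nat) \<notin> q"
proof
  assume "h g [^]\<^bsub>S\<^esub> k \<in> q"
  then have "h g \<in> q" by (rule S.prime_pow_mem[OF q hg_carrier])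
  moreover obtain v where "v \<in> carrier S" "v \<otimes>\<^bsub>S\<^esub> h g = \<one>\<^bsub>S\<^esub>" using g_unit by (auto simp: Units_def)
  ultimately show False using S.primeD(3,5)[OF q] hg_carrier by metis
qed

lemma spec_pt_D: "q \<in> prime_spec S \<Longrightarrow> spec_pt R h q \<in> D"
  using spec_pt_prime hg_notin[of q 1] g_carrier by (simp add: spec_pt_mem)

section \<open>The homeomorphism of the spectrum of the localization with a basic open set\<close>

lemma mem_iff:
  assumes "q \<in> prime_spec S" "b \<in> carrier S" "a \<in> carrier R" "b \<otimes>\<^bsub>S\<^esub> h g [^]\<^bsub>S\<^esub> (k::nat) = h a"
  shows "b \<in> q \<longleftrightarrow> a \<in> spec_pt R h q"
  using S.primeD(5)[OF assms(1), of b "h g [^]\<^bsub>S\<^esub> k"] hg_notin[OF assms(1), of k] assms(2-4)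
  by (simp add: spec_pt_mem)

lemma spec_pt_inj: "inj_on (spec_pt R h) (prime_spec S)"
proof (rule inj_onI)
  fix q q' assume q: "q \<in> prime_spec S" "q' \<in> prime_spec S" and eq: "spec_pt R h q = spec_pt R h q'"
  have "b \<in> q \<longleftrightarrow> b \<in> q'" if b: "b \<in> carrier S" for b
    using numerator[OF b] mem_iff[OF q(1) b] mem_iff[OF q(2) b] eq by metis
  then show "q = q'" using S.primeD(2) q by blast
qed

lemma hom_eq:
  assumes x: "x \<in> carrier R" "y \<in> carrier R" and eq: "h x = h y"
  obtains k :: nat where "g [^] k \<otimes> x = g [^] k \<otimes> y"
proof -
  have "h (x \<ominus> y) = \<zero>\<^bsub>S\<^esub>" using x eq by (simp add: R.minus_eq S.r_neg)
  then obtain k :: nat where k: "g [^] k \<otimes> (x \<ominus> y) = \<zero>"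
    using kernel[of "x \<ominus> y"] x by auto
  then have "g [^] k \<otimes> x \<ominus> g [^] k \<otimes> y = \<zero>"
    using x by (simp add: R.minus_eq R.r_distr R.r_minus)
  then show ?thesis using x by (intro that[of k]) (simp add: R.minus_eq R.minus_equality R.add.inv_solve_right')
qed

lemma spec_pt_surj:
  assumes p: "p \<in> D"
  shows "p \<in> spec_pt R h ` prime_spec S"
proof -
  have pp: "p \<in> prime_spec R" and gp: "g \<notin> p" using p by auto
  note P = R.primeD[OF pp]
  \<comment> \<open>The extension of \<open>p\<close>: the elements one of whose numerators lies in
    \<open>p\<close>.\<close>
  define q where "q = {b \<in> carrier S. \<exists>k::nat. \<exists>a\<in>p. b \<otimes>\<^bsub>S\<^esub> h g [^]\<^bsub>S\<^esub> k = h a}"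
  have gk: "g [^] (k::nat) \<notin> p" for k using R.prime_pow_mem[OF pp g_carrier] gp by blast
  have pc: "a \<in> carrier R" if "a \<in> p" for a using P(2) that by blast
  have qI: "b \<in> q" if "b \<in> carrier S" "a \<in> p" "b \<otimes>\<^bsub>S\<^esub> h g [^]\<^bsub>S\<^esub> (k::nat) = h a" for b a k
    using that unfolding q_def by blast
  \<comment> \<open>Then every numerator of \<open>b\<close> lies in \<open>p\<close>: two
    numerators agree up to powers of \<open>g\<close> and an element of the kernel of
    \<open>h\<close>, which a power of \<open>g\<close> annihilates, and no power of
    \<open>g\<close> lies in \<open>p\<close>.\<close>
  have key: "b \<in> q \<longleftrightarrow> a \<in> p"
    if b: "b \<in> carrier S" "a \<in> carrier R" and k: "b \<otimes>\<^bsub>S\<^esub> h g [^]\<^bsub>S\<^esub> (k::nat) = h a" for b a k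
  proof
    assume "b \<in> q"
    then obtain k' a' where a': "a' \<in> p" "b \<otimes>\<^bsub>S\<^esub> h g [^]\<^bsub>S\<^esub> (k'::nat) = h a'" unfolding q_def by blast
    have "h (a \<otimes> g [^] k') = b \<otimes>\<^bsub>S\<^esub> h g [^]\<^bsub>S\<^esub> k \<otimes>\<^bsub>S\<^esub> h g [^]\<^bsub>S\<^esub> k'"
      using b k by (simp add: pow_hom)
    also have "\<dots> = h (a' \<otimes> g [^] k)"
      using b pc[OF a'(1)] by (simp add: pow_hom a'(2)[symmetric] S.m_ac)
    finally obtain l :: nat where "g [^] l \<otimes> (a \<otimes> g [^] k') = g [^] l \<otimes> (a' \<otimes> g [^] k)"
      using hom_eq[of "a \<otimes> g [^] k'" "a' \<otimes> g [^] k"] b pc[OF a'(1)] by auto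
    moreover have "g [^] l \<otimes> (a' \<otimes> g [^] k) \<in> p"
      using P(5) a'(1) pc[OF a'(1)] by simp
    ultimately have "g [^] l \<otimes> (a \<otimes> g [^] k') \<in> p" by simp
    then show "a \<in> p" using P(5) b(2) gk by simp
  qed (use qI b k in blast)
  have "primeideal q S"
  proof (rule primeidealI)
    show "cring S" by (rule S.is_cring)
    have "\<one>\<^bsub>S\<^esub> \<notin> q" using key[of "\<one>\<^bsub>S\<^esub>" "\<one>" 0] P(3) by simp
    then show "carrier S \<noteq> q" by blast
    show "b \<in> q \<or> c \<in> q" if bc: "b \<in> carrier S" "c \<in> carrier S" "b \<otimes>\<^bsub>S\<^esub> c \<in> q" for b c
    proof -
      obtain k l a d where *: "b \<otimes>\<^bsub>S\<^esub> h g [^]\<^bsub>S\<^esub> (k::nat) = h a" "a \<in> carrier R"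
        "c \<otimes>\<^bsub>S\<^esub> h g [^]\<^bsub>S\<^esub> (l::nat) = h d" "d \<in> carrier R"
        using numerator[OF bc(1)] numerator[OF bc(2)] by blast
      have "b \<otimes>\<^bsub>S\<^esub> c \<otimes>\<^bsub>S\<^esub> h g [^]\<^bsub>S\<^esub> (k + l) = h (a \<otimes> d)"
        using bc * by (simp add: S.nat_pow_mult[symmetric] flip: *(1,3)) (simp add: S.m_ac)
      then have "a \<otimes> d \<in> p" using key[of "b \<otimes>\<^bsub>S\<^esub> c" "a \<otimes> d" "k + l"] bc * by simp
      then show ?thesis using P(5) * key[OF bc(1) *(2,1)] key[OF bc(2) *(4,3)] by blast
    qed
    have mult: "x \<otimes>\<^bsub>S\<^esub> b \<in> q" if b: "b \<in> q" and x: "x \<in> carrier S" for b x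
    proof -
      obtain k a where ka: "a \<in> p" "b \<otimes>\<^bsub>S\<^esub> h g [^]\<^bsub>S\<^esub> (k::nat) = h a" "b \<in> carrier S" using b unfolding q_def by blast
      obtain j c where jc: "c \<in> carrier R" "x \<otimes>\<^bsub>S\<^esub> h g [^]\<^bsub>S\<^esub> (j::nat) = h c" using numerator[OF x] by blast
      have "x \<otimes>\<^bsub>S\<^esub> b \<otimes>\<^bsub>S\<^esub> h g [^]\<^bsub>S\<^esub> (j + k) = h (c \<otimes> a)"
        using x ka(3) jc(1) pc[OF ka(1)]
        by (simp add: S.nat_pow_mult[symmetric] flip: ka(2) jc(2)) (simp add: S.m_ac)
      moreover have "c \<otimes> a \<in> p" using P(5) jc(1) ka(1) pc by simp
      ultimately show ?thesis using qI x ka(3) by blast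
    qed
    show "ideal q S"
    proof (rule idealI)
      show "ring S" by (rule S.ring_axioms)
      show "subgroup q (add_monoid S)"
      proof (rule S.add.subgroupI)
        show "q \<subseteq> carrier S" by (auto simp: q_def)
        show "q \<noteq> {}" using qI[of "\<zero>\<^bsub>S\<^esub>" "\<zero>" 0] P(4) by auto
        show "\<ominus>\<^bsub>S\<^esub> b \<in> q" if "b \<in> q" for b
          using mult[OF that, of "\<ominus>\<^bsub>S\<^esub> \<one>\<^bsub>S\<^esub>"] that by (simp add: q_def S.l_minus)
        show "b \<oplus>\<^bsub>S\<^esub> c \<in> q" if b: "b \<in> q" and c: "c \<in> q" for b c
        proof -
          obtain k a where ka: "a \<in> p" "b \<otimes>\<^bsub>S\<^esub> h g [^]\<^bsub>S\<^esub> (k::nat) = h a" "b \<in> carrier S" using b unfolding q_def by blast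
          obtain l d where ld: "d \<in> p" "c \<otimes>\<^bsub>S\<^esub> h g [^]\<^bsub>S\<^esub> (l::nat) = h d" "c \<in> carrier S" using c unfolding q_def by blast
          have "(b \<oplus>\<^bsub>S\<^esub> c) \<otimes>\<^bsub>S\<^esub> h g [^]\<^bsub>S\<^esub> (k + l) = h (a \<otimes> g [^] l \<oplus> d \<otimes> g [^] k)"
            using ka(3) ld(3) pc[OF ka(1)] pc[OF ld(1)]
            by (simp add: S.nat_pow_mult[symmetric] pow_hom flip: ka(2) ld(2)) (simp add: S.l_distr S.m_ac)
          moreover have "a \<otimes> g [^] l \<oplus> d \<otimes> g [^] k \<in> p"
            using P(5,6) ka(1) ld(1) pc by simp
          ultimately show ?thesis using qI ka(3) ld(3) by blast
        qed
      qed
    qed (use mult S.m_comm in \<open>auto simp: q_def\<close>)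
  qed
  then have "q \<in> prime_spec S" by (simp add: prime_spec_def)
  moreover have "spec_pt R h q = p"
    using key[of "h a" a 0 for a] pc by (auto simp: spec_pt_def)
  ultimately show ?thesis by blast
qed

lemma spec_pt_image: "spec_pt R h ` prime_spec S = D"
  using spec_pt_D spec_pt_surj by blast

lemma D_open: "openin (zariski R) D"
  using R.openin_basic[OF g_carrier] .

lemma spec_pt_open:
  assumes "openin (zariski S) V"
  shows "openin (zariski R) (spec_pt R h ` V)"
proof -
  from assms obtain E where E: "E \<subseteq> carrier S" "V = {q \<in> prime_spec S. \<not> E \<subseteq> q}"
    unfolding openin_zariski by blast
  \<comment> \<open>The factor \<open>g\<close> keeps primes outside \<open>D\<close> out of the
    open set defined by \<open>E'\<close>; at primes in \<open>D\<close> it does not change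
    membership.\<close>
  define E' where "E' = {a \<otimes> g | a b k. a \<in> carrier R \<and> b \<in> E \<and> b \<otimes>\<^bsub>S\<^esub> h g [^]\<^bsub>S\<^esub> (k::nat) = h a}"
  have *: "\<not> E \<subseteq> q \<longleftrightarrow> \<not> E' \<subseteq> spec_pt R h q" if q: "q \<in> prime_spec S" for q
  proof -
    have gq: "a \<otimes> g \<in> spec_pt R h q \<longleftrightarrow> a \<in> spec_pt R h q" if "a \<in> carrier R" for a
      using R.primeD(5)[OF spec_pt_prime[OF q] that g_carrier] spec_pt_D[OF q] by blast
    show ?thesis
    proof
      assume "\<not> E \<subseteq> q"
      then obtain b where b: "b \<in> E" "b \<notin> q" by blast
      then have bc: "b \<in> carrier S" using E(1) by blast
      obtain k a where a: "a \<in> carrier R" "b \<otimes>\<^bsub>S\<^esub> h g [^]\<^bsub>S\<^esub> (k::nat) = h a" using numerator[OF bc] by blast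
      then have "a \<otimes> g \<notin> spec_pt R h q" using mem_iff[OF q bc a] b gq by blast
      moreover have "a \<otimes> g \<in> E'" using a b unfolding E'_def by blast
      ultimately show "\<not> E' \<subseteq> spec_pt R h q" by blast
    next
      assume "\<not> E' \<subseteq> spec_pt R h q"
      then obtain a b k where "a \<in> carrier R" "b \<in> E" "b \<otimes>\<^bsub>S\<^esub> h g [^]\<^bsub>S\<^esub> (k::nat) = h a"
        "a \<otimes> g \<notin> spec_pt R h q" unfolding E'_def by blast
      then show "\<not> E \<subseteq> q" using mem_iff[OF q, of b a k] gq E(1) by blast
    qed
  qed
  have "p \<in> D" if p: "p \<in> prime_spec R" "\<not> E' \<subseteq> p" for p
    using p R.primeD(5)[OF p(1) _ g_carrier] g_carrier unfolding E'_def by blast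
  then have "p \<in> spec_pt R h ` V" if "p \<in> prime_spec R" "\<not> E' \<subseteq> p" for p
    using spec_pt_surj[of p] that * unfolding E(2) by blast
  then have "spec_pt R h ` V = {p \<in> prime_spec R. \<not> E' \<subseteq> p}"
    unfolding E(2) using * spec_pt_prime by blast
  moreover have "E' \<subseteq> carrier R" using g_carrier by (auto simp: E'_def)
  ultimately show ?thesis unfolding openin_zariski by blast
qed

section \<open>Comparison of localizations and sections over the basic open set\<close>

lemma loc_map_inj:
  assumes q: "q \<in> prime_spec S"
    and x: "x \<in> carrier (loc R (spec_pt R h q))" "y \<in> carrier (loc R (spec_pt R h q))"
    and eq: "loc_map S h q x = loc_map S h q y"
  shows "x = y"
proof -
  let ?p = "spec_pt R h q"
  have p: "?p \<in> prime_spec R" by (rule spec_pt_prime[OF q])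
  obtain a s b t where as: "a \<in> carrier R" "s \<in> carrier R - ?p" "x = frac R ?p a s"
    and bt: "b \<in> carrier R" "t \<in> carrier R - ?p" "y = frac R ?p b t"
    using x by (metis R.loc_carrierE)
  have st: "h s \<in> carrier S - q" "h t \<in> carrier S - q" using as bt by (auto simp: spec_pt_def)
  have "frac S q (h a) (h s) = frac S q (h b) (h t)"
    using eq as bt st by (simp add: loc_map_frac[OF q])
  then obtain u where u: "u \<in> carrier S - q" "u \<otimes>\<^bsub>S\<^esub> (h a \<otimes>\<^bsub>S\<^esub> h t) = u \<otimes>\<^bsub>S\<^esub> (h b \<otimes>\<^bsub>S\<^esub> h s)"
    using S.frac_eq_iff[OF q, of "h a" "h b" "h s" "h t"] as bt st by auto
  then have uc: "u \<in> carrier S" by simp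
  \<comment> \<open>The multiplier \<open>u\<close> lies in \<open>S\<close>. Its numerator
    \<open>w\<close>, times a power of \<open>g\<close> that absorbs the kernel of \<open>h\<close>,
    is a multiplier in \<open>R\<close>.\<close>
  obtain k w where w: "w \<in> carrier R" "u \<otimes>\<^bsub>S\<^esub> h g [^]\<^bsub>S\<^esub> (k::nat) = h w" using numerator[OF uc] by blast
  have "w \<notin> ?p" using mem_iff[OF q uc w] u by blast
  have c: "s \<in> carrier R" "t \<in> carrier R" using as bt by auto
  have "h (w \<otimes> (a \<otimes> t)) = h g [^]\<^bsub>S\<^esub> k \<otimes>\<^bsub>S\<^esub> (u \<otimes>\<^bsub>S\<^esub> (h a \<otimes>\<^bsub>S\<^esub> h t))"
    using w(1) as bt c uc by (simp flip: w(2)) (simp add: S.m_ac)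
  also have "\<dots> = h (w \<otimes> (b \<otimes> s))"
    unfolding u(2) using w(1) as bt c uc by (simp flip: w(2)) (simp add: S.m_ac)
  finally obtain l :: nat where l: "g [^] l \<otimes> (w \<otimes> (a \<otimes> t)) = g [^] l \<otimes> (w \<otimes> (b \<otimes> s))"
    using hom_eq[of "w \<otimes> (a \<otimes> t)" "w \<otimes> (b \<otimes> s)"] w as bt c by auto
  have "g [^] l \<notin> ?p" using R.prime_pow_mem[OF p g_carrier] spec_pt_D[OF q] by blast
  then have "g [^] l \<otimes> w \<in> carrier R - ?p" using R.primeD(5)[OF p] w(1) \<open>w \<notin> ?p\<close> by simp
  moreover have "(g [^] l \<otimes> w) \<otimes> (a \<otimes> t) = (g [^] l \<otimes> w) \<otimes> (b \<otimes> s)"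
    using l w(1) as bt c by (simp add: R.m_assoc)
  ultimately show ?thesis unfolding as(3) bt(3) R.frac_eq_iff[OF p as(1) bt(1) as(2) bt(2)] by blast
qed

lemma Spec_map_bij:
  assumes V: "openin (zariski R) V" "V \<subseteq> D"
  shows "bij_betw (pb (Spec_map R S h) V) (carrier (spec_sections R V))
    (carrier (spec_sections S (preim (Spec S) (spec_pt R h) V)))"
  unfolding bij_betw_def
proof
  let ?P = "preim (Spec S) (spec_pt R h) V"
  define qq where "qq = inv_into (prime_spec S) (spec_pt R h)"
  have qq: "qq p \<in> ?P" "spec_pt R h (qq p) = p" if "p \<in> V" for p
    using spec_pt_surj[of p] that V(2) unfolding qq_def preim_spec_pt
    by (simp_all add: f_inv_into_f inv_into_into subset_eq)
  have qqs: "qq (spec_pt R h q) = q" if "q \<in> ?P" for q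
    using that spec_pt_inj by (simp add: qq_def preim_spec_pt)
  have Pp: "q \<in> prime_spec S" "spec_pt R h q \<in> V" if "q \<in> ?P" for q
    using that by (simp_all add: preim_spec_pt)
  show "inj_on (pb (Spec_map R S h) V) (carrier (spec_sections R V))"
  proof (rule inj_onI)
    fix \<phi> \<tau> assume st: "\<phi> \<in> carrier (spec_sections R V)" "\<tau> \<in> carrier (spec_sections R V)"
      and eq: "pb (Spec_map R S h) V \<phi> = pb (Spec_map R S h) V \<tau>"
    show "\<phi> = \<tau>"
    proof (rule R.sec_ext[OF st])
      fix p assume p: "p \<in> V"
      have "loc_map S h (qq p) (\<phi> p) = loc_map S h (qq p) (\<tau> p)"
        using fun_cong[OF eq, of "qq p"] qq[OF p] by (simp add: Spec_map_simps)
      then show "\<phi> p = \<tau> p"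
        using loc_map_inj[of "qq p" "\<phi> p" "\<tau> p"] Pp(1)[OF qq(1)[OF p]] qq(2)[OF p]
          R.sec_value[OF st(1) p] R.sec_value[OF st(2) p] by simp
    qed
  qed
  show "pb (Spec_map R S h) V ` carrier (spec_sections R V) = carrier (spec_sections S ?P)"
  proof
    show "pb (Spec_map R S h) V ` carrier (spec_sections R V) \<subseteq> carrier (spec_sections S ?P)"
      using Spec_map_sec[OF V(1)] by blast
    show "carrier (spec_sections S ?P) \<subseteq> pb (Spec_map R S h) V ` carrier (spec_sections R V)"
    proof
      fix \<tau> assume \<tau>: "\<tau> \<in> carrier (spec_sections S ?P)"
      \<comment> \<open>Uniqueness in \<open>THE\<close> is \<open>loc_map_inj\<close>; existence
        comes from \<open>local_rep\<close> below.\<close>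
      define \<phi> where "\<phi> = (\<lambda>p\<in>V. THE x. x \<in> carrier (loc R p) \<and> loc_map S h (qq p) x = \<tau> (qq p))"
      have \<phi>q: "\<phi> (spec_pt R h q) = x"
        if q: "q \<in> ?P" and x: "x \<in> carrier (loc R (spec_pt R h q))" "loc_map S h q x = \<tau> q" for q x
        unfolding \<phi>_def using Pp[OF q] qqs[OF q] x loc_map_inj[OF Pp(1)[OF q]]
        by (simp, intro the_equality) auto
      have local_rep: "\<exists>W' a s. openin (zariski S) W' \<and> W' \<subseteq> ?P \<and> q \<in> W' \<and> a \<in> carrier R \<and> s \<in> carrier R \<and>
         (\<forall>q'\<in>W'. h s \<notin> q' \<and> loc_map S h q' (frac R (spec_pt R h q') a s) = \<tau> q')" if q: "q \<in> ?P" for q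
      proof -
        obtain W' b t where *: "openin (zariski S) W'" "W' \<subseteq> ?P" "q \<in> W'" "b \<in> carrier S" "t \<in> carrier S"
          "\<And>q'. q' \<in> W' \<Longrightarrow> t \<notin> q'" "\<And>q'. q' \<in> W' \<Longrightarrow> \<tau> q' = frac S q' b t"
          using S.sec_localE[OF \<tau> q] by metis
        obtain k a where a: "a \<in> carrier R" "b \<otimes>\<^bsub>S\<^esub> h g [^]\<^bsub>S\<^esub> (k::nat) = h a" using numerator[OF *(4)] by blast
        obtain l s where s: "s \<in> carrier R" "t \<otimes>\<^bsub>S\<^esub> h g [^]\<^bsub>S\<^esub> (l::nat) = h s" using numerator[OF *(5)] by blast
        \<comment> \<open>Numerator and denominator have to carry the same total power of
          \<open>g\<close>, hence the exchanged exponents.\<close>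
        let ?a = "a \<otimes> g [^] l" and ?s = "s \<otimes> g [^] k"
        have ha: "h ?a = b \<otimes>\<^bsub>S\<^esub> h g [^]\<^bsub>S\<^esub> k \<otimes>\<^bsub>S\<^esub> h g [^]\<^bsub>S\<^esub> l" and hs: "h ?s = t \<otimes>\<^bsub>S\<^esub> h g [^]\<^bsub>S\<^esub> l \<otimes>\<^bsub>S\<^esub> h g [^]\<^bsub>S\<^esub> k"
          using a s by (simp_all add: pow_hom)
        have "h ?s \<notin> q' \<and> loc_map S h q' (frac R (spec_pt R h q') ?a ?s) = \<tau> q'" if q': "q' \<in> W'" for q'
        proof -
          have q'p: "q' \<in> prime_spec S" using Pp(1) *(2) q' by blast
          have n: "h ?s \<notin> q'"
            unfolding hs using S.primeD(5)[OF q'p] hg_notin[OF q'p] *(5) *(6)[OF q'] by simp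
          moreover have "frac S q' (h ?a) (h ?s) = frac S q' b t"
            using n *(4,5) *(6)[OF q'] a(1) s(1)
            by (intro S.frac_eqI[OF q'p]) (simp_all del: hom_mult add: ha hs S.m_ac)
          ultimately show ?thesis using loc_map_frac[OF q'p, of ?a ?s] a s *(7)[OF q'] by simp
        qed
        then show ?thesis using *(1-3) a(1) s(1)
          by (intro exI[of _ W'] exI[of _ ?a] exI[of _ ?s]) simp
      qed
      have "\<phi> \<in> carrier (spec_sections R V)"
      proof (rule R.sec_carrierI)
        fix p assume p: "p \<in> V"
        obtain W' a s where *: "openin (zariski S) W'" "W' \<subseteq> ?P" "qq p \<in> W'" "a \<in> carrier R" "s \<in> carrier R"
         "\<forall>q'\<in>W'. h s \<notin> q' \<and> loc_map S h q' (frac R (spec_pt R h q') a s) = \<tau> q'"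
          using local_rep[OF qq(1)[OF p]] by (elim exE conjE)
        have "s \<notin> spec_pt R h q' \<and> \<phi> (spec_pt R h q') = frac R (spec_pt R h q') a s" if "q' \<in> W'" for q'
        proof -
          have n: "s \<notin> spec_pt R h q'" using *(5,6) that by (simp add: spec_pt_mem)
          moreover have "\<phi> (spec_pt R h q') = frac R (spec_pt R h q') a s"
            using *(2,6) that n *(4,5) by (intro \<phi>q R.frac_carrier) auto
          ultimately show ?thesis by blast
        qed
        moreover have "spec_pt R h ` W' \<subseteq> V" using *(2) Pp(2) by blast
        moreover have "p \<in> spec_pt R h ` W'" using qq(2)[OF p] *(3) by (metis imageI)
        ultimately show "\<exists>W' a s. openin (zariski R) W' \<and> W' \<subseteq> V \<and> p \<in> W' \<and> a \<in> carrier R \<and> s \<in> carrier R \<and>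
            (\<forall>q\<in>W'. s \<notin> q \<and> \<phi> q = frac R q a s)"
          using spec_pt_open[OF *(1)] *(4,5)
          by (intro exI[of _ "spec_pt R h ` W'"] exI[of _ a] exI[of _ s]) simp
      qed (simp add: \<phi>_def)
      moreover have "pb (Spec_map R S h) V \<phi> = \<tau>"
      proof (rule S.sec_ext[OF Spec_map_sec[OF V(1) calculation] \<tau>])
        fix q assume q: "q \<in> ?P"
        obtain W' a s where *: "q \<in> W'" "a \<in> carrier R" "s \<in> carrier R"
         "\<forall>q'\<in>W'. h s \<notin> q' \<and> loc_map S h q' (frac R (spec_pt R h q') a s) = \<tau> q'"
          using local_rep[OF q] by (elim exE conjE)
        have "s \<notin> spec_pt R h q" using * by (simp add: spec_pt_mem)
        then have "\<phi> (spec_pt R h q) = frac R (spec_pt R h q) a s"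
          using * by (intro \<phi>q[OF q] R.frac_carrier) auto
        then show "pb (Spec_map R S h) V \<phi> q = \<tau> q" using * q by (simp add: Spec_map_simps)
      qed
      ultimately show "\<tau> \<in> pb (Spec_map R S h) V ` carrier (spec_sections R V)" by blast
    qed
  qed
qed

lemma Spec_map_open_immersion:
  "\<exists>G. lrs_inverse (Spec S) (open_subspace (Spec R) D) (Spec_map R S h) G"
proof (rule lrs_inverse_exists)
  have DO: "openin (rs_top (Spec R)) D" using D_open by (simp add: Spec_simps)
  note os = openin_open_subspace[OF DO]
  show "lrs_morphism (Spec S) (open_subspace (Spec R) D) (Spec_map R S h)"
    using lrs_morphism_corestrict[OF Spec_map_morphism DO] spec_pt_image
    by (simp add: Spec_map_simps S.Spec_points)
  show "inj_on (pt (Spec_map R S h)) (rs_points (Spec S))"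
    by (simp add: Spec_map_simps S.Spec_points spec_pt_inj)
  show "pt (Spec_map R S h) ` rs_points (Spec S) = rs_points (open_subspace (Spec R) D)"
    using spec_pt_image by (auto simp: Spec_map_simps S.Spec_points R.Spec_points)
  show "openin (rs_top (open_subspace (Spec R) D)) (pt (Spec_map R S h) ` V)"
    if "openin (rs_top (Spec S)) V" for V
    using that spec_pt_open[of V] S.open_prime[of V] spec_pt_D unfolding os
    by (auto simp: Spec_simps Spec_map_simps)
  show "bij_betw (pb (Spec_map R S h) V) (carrier (rs_sec (open_subspace (Spec R) D) V))
      (carrier (rs_sec (Spec S) (preim (Spec S) (pt (Spec_map R S h)) V)))"
    if "openin (rs_top (open_subspace (Spec R) D)) V" for V
    using that Spec_map_bij[of V] unfolding os by (simp add: Spec_simps Spec_map_simps(1))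
  show "rs_res (open_subspace (Spec R) D) V V' s \<in> carrier (rs_sec (open_subspace (Spec R) D) V')"
    if "openin (rs_top (open_subspace (Spec R) D)) V'" "V' \<subseteq> V"
      "s \<in> carrier (rs_sec (open_subspace (Spec R) D) V)" for V V' s
    using that R.sec_restrict[of s V V'] unfolding os by (simp add: Spec_simps)
  show "\<one>\<^bsub>rs_sec (open_subspace (Spec R) D) V\<^esub> \<in> carrier (rs_sec (open_subspace (Spec R) D) V)"
    if "openin (rs_top (open_subspace (Spec R) D)) V" for V
    using that R.regular_carrier[of V] unfolding os by (simp add: Spec_simps R.sec_one)
qed (simp add: Spec_simps R.sec_mult_closed R.sec_add_closed)

end

section \<open>Evaluation of integer polynomials\<close>

abbreviation "keys \<equiv> Poly_Mapping.keys"
abbreviation "lookup \<equiv> Poly_Mapping.lookup"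
abbreviation "single \<equiv> Poly_Mapping.single"

definition mon :: "(coord \<Rightarrow> 'b::comm_ring_1) \<Rightarrow> (coord \<Rightarrow>\<^sub>0 nat) \<Rightarrow> 'b"
  where "mon \<phi> e = (\<Prod>v\<in>keys e. \<phi> v ^ lookup e v)"

text \<open>The ring of values varies: polynomials for substitutions, fractions of polynomials for
  the inverse of the immersion, a field for points of \<open>X\<close>.\<close>

definition ev :: "(coord \<Rightarrow> 'b::comm_ring_1) \<Rightarrow> mpoly \<Rightarrow> 'b"
  where "ev \<phi> p = (\<Sum>e\<in>keys p. of_int (lookup p e) * mon \<phi> e)"

lemma mon_superset:
  assumes "finite A" "keys e \<subseteq> A"
  shows "mon \<phi> e = (\<Prod>v\<in>A. \<phi> v ^ lookup e v)"
  unfolding mon_def using assms by (intro prod.mono_neutral_left) (auto simp: in_keys_iff)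

lemma mon_0 [simp]: "mon \<phi> 0 = 1" by (simp add: mon_def)

lemma mon_single [simp]: "mon \<phi> (single v k) = \<phi> v ^ k"
  by (cases "k = 0") (simp_all add: mon_def)

lemma mon_add: "mon \<phi> (e + f) = mon \<phi> e * mon \<phi> f"
proof -
  let ?A = "keys e \<union> keys f"
  have "mon \<phi> (e + f) = (\<Prod>v\<in>?A. \<phi> v ^ lookup (e + f) v)"
    using Poly_Mapping.keys_add[of e f] by (intro mon_superset) auto
  also have "\<dots> = (\<Prod>v\<in>?A. \<phi> v ^ lookup e v) * (\<Prod>v\<in>?A. \<phi> v ^ lookup f v)"
    by (simp add: lookup_add power_add prod.distrib)
  also have "\<dots> = mon \<phi> e * mon \<phi> f"
    by (simp add: mon_superset[of ?A])
  finally show ?thesis .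
qed

lemma ev_superset:
  assumes "finite A" "keys p \<subseteq> A"
  shows "ev \<phi> p = (\<Sum>e\<in>A. of_int (lookup p e) * mon \<phi> e)"
  unfolding ev_def using assms by (intro sum.mono_neutral_left) (auto simp: in_keys_iff)

lemma ev_0 [simp]: "ev \<phi> 0 = 0" by (simp add: ev_def)

lemma ev_single [simp]: "ev \<phi> (single e c) = of_int c * mon \<phi> e"
  by (cases "c = 0") (simp_all add: ev_def)

lemma ev_add [simp]: "ev \<phi> (p + q) = ev \<phi> p + ev \<phi> q"
proof -
  let ?A = "keys p \<union> keys q"
  have "ev \<phi> (p + q) = (\<Sum>e\<in>?A. of_int (lookup (p + q) e) * mon \<phi> e)"
    using Poly_Mapping.keys_add[of p q] by (intro ev_superset) auto
  then show ?thesis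
    by (simp add: ev_superset[of ?A] lookup_add distrib_right sum.distrib)
qed

lemma ev_sum: "ev \<phi> (sum f A) = (\<Sum>x\<in>A. ev \<phi> (f x))"
  by (induction A rule: infinite_finite_induct) simp_all

lemma sum_singles:
  fixes p :: "'k \<Rightarrow>\<^sub>0 'c::comm_monoid_add"
  shows "p = (\<Sum>e\<in>keys p. single e (lookup p e))"
proof (rule poly_mapping_eqI)
  fix k
  have "(\<Sum>e\<in>keys p. lookup (single e (lookup p e)) k)
      = (\<Sum>e\<in>keys p. if e = k then lookup p e else 0)"
    by (intro sum.cong) (auto simp: lookup_single when_def)
  then show "lookup p k
      = lookup (\<Sum>e\<in>keys p. single e (lookup p e)) k"
    by (simp add: lookup_sum in_keys_iff)
qed

lemma ev_mult [simp]: "ev \<phi> (p * q) = ev \<phi> p * ev \<phi> q"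
proof -
  have 1: "ev \<phi> (single e c * q) = of_int c * mon \<phi> e * ev \<phi> q" for e c
  proof -
    have "single e c * q = (\<Sum>f\<in>keys q.
        single (e + f) (c * lookup q f))"
      by (subst sum_singles[of q]) (simp add: sum_distrib_left mult_single)
    then show ?thesis
      by (simp add: ev_sum mon_add ev_def[of \<phi> q] sum_distrib_left mult_ac)
  qed
  have "p * q = (\<Sum>e\<in>keys p. single e (lookup p e) * q)"
    by (subst sum_singles[of p]) (simp add: sum_distrib_right)
  then show ?thesis
    by (simp add: ev_sum 1 ev_def[of \<phi> p] sum_distrib_right)
qed

lemma ev_1 [simp]: "ev \<phi> 1 = 1"
  using ev_single[of \<phi> 0 1] by simp

lemma ev_uminus [simp]: "ev \<phi> (- p) = - ev \<phi> p"
  using ev_add[of \<phi> p "- p"] by (simp add: eq_neg_iff_add_eq_0 add.commute)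

lemma ev_diff [simp]: "ev \<phi> (p - q) = ev \<phi> p - ev \<phi> q"
  using ev_add[of \<phi> p "- q"] by simp

lemma ev_power [simp]: "ev \<phi> (p ^ k) = ev \<phi> p ^ k"
  by (induction k) simp_all

lemma ev_prod: "ev \<phi> (prod f A) = (\<Prod>x\<in>A. ev \<phi> (f x))"
  by (induction A rule: infinite_finite_induct) simp_all

lemma ev_of_int [simp]: "ev \<phi> (of_int c) = of_int c"
  using ev_single[of \<phi> 0 "of_int c"] unfolding single_of_int by simp

lemma ev_of_nat [simp]: "ev \<phi> (of_nat c) = of_nat c"
  using ev_of_int[of \<phi> "int c"] by simp

lemma ev_var [simp]: "ev \<phi> (var v) = \<phi> v"
  by (simp add: var_def)

lemma prod_var: "finite A \<Longrightarrow> (\<Prod>v\<in>A. var v ^ k v) = single (\<Sum>v\<in>A. single v (k v)) 1"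
proof (induction A rule: finite_induct)
  case (insert v A)
  have "var v ^ j = single (single v j) 1" for j
    by (induction j) (simp_all add: var_def mult_single flip: single_add)
  then show ?case using insert by (simp add: mult_single)
qed simp

lemma mon_var: "mon var e = single e 1"
  unfolding mon_def by (simp add: prod_var flip: sum_singles)

lemma single_eq: "single e c = of_int c * mon var e"
  by (simp add: mon_var mult_single flip: single_of_int)

lemma ev_var_id [simp]: "ev var p = p"
  unfolding ev_def by (simp flip: single_eq sum_singles)

section \<open>Polynomials in a given set of coordinates\<close>

abbreviation Polys :: "coord set \<Rightarrow> mpoly set"
  where "Polys S \<equiv> carrier (poly_ring S)"

lemma Poly_iff: "p \<in> Polys S \<longleftrightarrow> (\<forall>e\<in>keys p. keys e \<subseteq> S)"
  by (simp add: poly_ring_def)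

lemma poly_ring_ops [simp]:
  "x \<otimes>\<^bsub>poly_ring S\<^esub> y = x * y" "x \<oplus>\<^bsub>poly_ring S\<^esub> y = x + y"
  "\<one>\<^bsub>poly_ring S\<^esub> = 1" "\<zero>\<^bsub>poly_ring S\<^esub> = 0"
  by (simp_all add: poly_ring_def)

lemma Poly_mult [simp]: "p \<in> Polys S \<Longrightarrow> q \<in> Polys S \<Longrightarrow> p * q \<in> Polys S"
  and Poly_add [simp]: "p \<in> Polys S \<Longrightarrow> q \<in> Polys S \<Longrightarrow> p + q \<in> Polys S"
  and Poly_0 [simp]: "0 \<in> Polys S" and Poly_1 [simp]: "1 \<in> Polys S"
  using cring.cring_simprules(1,2,5,6)[OF cring_poly_ring[of S]] by simp_all

lemma Poly_uminus [simp]: "p \<in> Polys S \<Longrightarrow> - p \<in> Polys S"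
  by (simp add: Poly_iff)

lemma Poly_diff [simp]: "p \<in> Polys S \<Longrightarrow> q \<in> Polys S \<Longrightarrow> p - q \<in> Polys S"
  using Poly_add[of p S "- q"] by simp

lemma Poly_power [simp]: "p \<in> Polys S \<Longrightarrow> p ^ k \<in> Polys S"
  by (induction k) simp_all

lemma Poly_prod: "(\<And>x. x \<in> A \<Longrightarrow> f x \<in> Polys S) \<Longrightarrow> prod f A \<in> Polys S"
  by (induction A rule: infinite_finite_induct) simp_all

lemma Poly_sum: "(\<And>x. x \<in> A \<Longrightarrow> f x \<in> Polys S) \<Longrightarrow> sum f A \<in> Polys S"
  by (induction A rule: infinite_finite_induct) simp_all

lemma Poly_var [simp]: "var v \<in> Polys S \<longleftrightarrow> v \<in> S"
  by (simp add: Poly_iff var_def)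

lemma Poly_of_int [simp]: "of_int c \<in> Polys S"
  by (cases "c = 0") (simp_all add: Poly_iff flip: single_of_int)

lemma Poly_of_nat [simp]: "of_nat c \<in> Polys S"
  using Poly_of_int[of "int c"] by simp

lemma Poly_mono: "p \<in> Polys S \<Longrightarrow> S \<subseteq> T \<Longrightarrow> p \<in> Polys T"
  by (auto simp: Poly_iff)

lemma Poly_single: "keys e \<subseteq> S \<Longrightarrow> single e c \<in> Polys S"
  by (simp add: Poly_iff)

lemma Poly_induct [consumes 1, case_names of_int var add mult]:
  assumes p: "p \<in> Polys S"
    and "\<And>c. P (of_int c)" and "\<And>v. v \<in> S \<Longrightarrow> P (var v)"
    and add: "\<And>p q. p \<in> Polys S \<Longrightarrow> q \<in> Polys S \<Longrightarrow> P p \<Longrightarrow> P q \<Longrightarrow> P (p + q)"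
    and mult: "\<And>p q. p \<in> Polys S \<Longrightarrow> q \<in> Polys S \<Longrightarrow> P p \<Longrightarrow> P q \<Longrightarrow> P (p * q)"
  shows "P p"
proof -
  have P01: "P 0" "P 1" using assms(2)[of 0] assms(2)[of 1] by simp_all
  have pow: "P (var v ^ k) \<and> var v ^ k \<in> Polys S" if "v \<in> S" for v k
    using that assms(3)[OF that] by (induction k) (auto simp: P01 intro: mult)
  have prod: "P (\<Prod>v\<in>A. var v ^ k v) \<and> (\<Prod>v\<in>A. var v ^ k v) \<in> Polys S" if "finite A" "A \<subseteq> S" for A k
    using that by (induction A rule: finite_induct) (auto simp: P01 pow intro!: mult)
  have sng: "P (single e c) \<and> single e c \<in> Polys S"
    if "keys e \<subseteq> S" for e c
    unfolding single_eq mon_def using that prod[of "keys e"] by (auto intro: mult assms(2))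
  have "P (\<Sum>e\<in>A. single e (lookup p e)) \<and>
      (\<Sum>e\<in>A. single e (lookup p e)) \<in> Polys S" if "finite A" "A \<subseteq> keys p" for A
    using that p by (induction A rule: finite_induct) (auto simp: P01 sng Poly_iff[of p] intro!: add Poly_add)
  then show ?thesis using sum_singles[of p] by (metis finite_keys order_refl)
qed

lemma ev_cong:
  assumes "p \<in> Polys S" "\<And>v. v \<in> S \<Longrightarrow> \<phi> v = \<tau> v"
  shows "ev \<phi> p = ev \<tau> p"
  using assms(1) by (induction p rule: Poly_induct) (simp_all add: assms(2))

lemma Poly_UNIV: "p \<in> Polys UNIV" by (simp add: Poly_iff)

lemma ev_ev: "ev \<tau> (ev \<phi> p) = ev (\<lambda>v. ev \<tau> (\<phi> v)) p"
  using Poly_UNIV[of p] by (induction p rule: Poly_induct) simp_all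

lemma ev_Poly:
  assumes "p \<in> Polys S" "\<And>v. v \<in> S \<Longrightarrow> \<phi> v \<in> Polys T"
  shows "ev \<phi> p \<in> Polys T"
  using assms(1) by (induction p rule: Poly_induct) (simp_all add: assms(2))


section \<open>Coordinate rings and substitutions\<close>

definition wf_pres :: "presentation \<Rightarrow> bool"
  where "wf_pres P \<longleftrightarrow> snd P \<subseteq> Polys (fst P)"

lemma rel_ideal_ideal:
  assumes "wf_pres P"
  shows "ideal (rel_ideal P) (poly_ring (fst P))"
  unfolding rel_ideal_def using assms
  by (intro ring.genideal_ideal cring.axioms(1) cring_poly_ring) (simp add: wf_pres_def)

lemma rel_ideal_Poly: "wf_pres P \<Longrightarrow> f \<in> rel_ideal P \<Longrightarrow> f \<in> Polys (fst P)"
  using ideal.Icarr[OF rel_ideal_ideal] .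

lemma rel_ideal_gen: "wf_pres P \<Longrightarrow> f \<in> snd P \<Longrightarrow> f \<in> rel_ideal P"
  unfolding rel_ideal_def wf_pres_def
  using ring.genideal_self[OF cring.axioms(1)[OF cring_poly_ring]] by blast

lemma rel_ideal_mult: "wf_pres P \<Longrightarrow> f \<in> rel_ideal P \<Longrightarrow> p \<in> Polys (fst P) \<Longrightarrow> p * f \<in> rel_ideal P"
  using ideal.I_l_closed[OF rel_ideal_ideal] by fastforce

lemma rel_ideal_mult2: "wf_pres P \<Longrightarrow> f \<in> rel_ideal P \<Longrightarrow> p \<in> Polys (fst P) \<Longrightarrow> f * p \<in> rel_ideal P"
  using rel_ideal_mult by (simp add: mult.commute)

lemma rel_ideal_add: "wf_pres P \<Longrightarrow> f \<in> rel_ideal P \<Longrightarrow> g \<in> rel_ideal P \<Longrightarrow> f + g \<in> rel_ideal P"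
  using additive_subgroup.a_closed[OF ideal.axioms(1)[OF rel_ideal_ideal]] by fastforce

lemma rel_ideal_0: "wf_pres P \<Longrightarrow> 0 \<in> rel_ideal P"
  using additive_subgroup.zero_closed[OF ideal.axioms(1)[OF rel_ideal_ideal]] by fastforce

lemma rel_ideal_uminus: "wf_pres P \<Longrightarrow> f \<in> rel_ideal P \<Longrightarrow> - f \<in> rel_ideal P"
  using rel_ideal_mult[of P f "- 1"] by simp

lemma rel_ideal_diff: "wf_pres P \<Longrightarrow> f \<in> rel_ideal P \<Longrightarrow> g \<in> rel_ideal P \<Longrightarrow> f - g \<in> rel_ideal P"
  using rel_ideal_add[of P f "- g"] rel_ideal_uminus by simp

lemma poly_ring_uminus: "p \<in> Polys S \<Longrightarrow> \<ominus>\<^bsub>poly_ring S\<^esub> p = - p"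
  using abelian_group.minus_equality[of "poly_ring S" "- p" p]
    ring.is_abelian_group[OF cring.axioms(1)[OF cring_poly_ring]] by simp

text \<open>The members of the ideal that satisfy \<open>Q\<close> form an ideal containing the
  generators, so by minimality they are everything. Building the membership into \<open>J\<close>
  makes it available in the hypotheses \<open>add\<close> and \<open>mult\<close>.\<close>

lemma rel_ideal_induct [consumes 2, case_names gen zero add mult]:
  assumes wf: "wf_pres P" and f: "f \<in> rel_ideal P"
    and gen: "\<And>f. f \<in> snd P \<Longrightarrow> Q f" and Q0: "Q 0"
    and add: "\<And>f g. f \<in> rel_ideal P \<Longrightarrow> g \<in> rel_ideal P \<Longrightarrow> Q f \<Longrightarrow> Q g \<Longrightarrow> Q (f + g)"
    and mult: "\<And>p f. p \<in> Polys (fst P) \<Longrightarrow> f \<in> rel_ideal P \<Longrightarrow> Q f \<Longrightarrow> Q (p * f)"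
  shows "Q f"
proof -
  let ?R = "poly_ring (fst P)"
  interpret cring ?R by (rule cring_poly_ring)
  define J where "J = {f \<in> rel_ideal P. Q f}"
  have "ideal J ?R"
  proof (rule idealI)
    show "ring ?R" by (rule ring_axioms)
    show "subgroup J (add_monoid ?R)"
    proof (rule add.subgroupI)
      show "J \<subseteq> Polys (fst P)" using rel_ideal_Poly[OF wf] by (auto simp: J_def)
      show "J \<noteq> {}" using Q0 rel_ideal_0[OF wf] by (auto simp: J_def)
      show "\<ominus>\<^bsub>?R\<^esub> a \<in> J" if "a \<in> J" for a
      proof -
        have "a \<in> Polys (fst P)" using that rel_ideal_Poly[OF wf] by (auto simp: J_def)
        moreover have "- a \<in> J"
          using that mult[of "- 1" a] rel_ideal_uminus[OF wf, of a] by (simp add: J_def)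
        ultimately show ?thesis by (simp add: poly_ring_uminus)
      qed
      show "a \<oplus>\<^bsub>?R\<^esub> b \<in> J" if "a \<in> J" "b \<in> J" for a b
        using that add rel_ideal_add[OF wf] by (simp add: J_def)
    qed
    show "x \<otimes>\<^bsub>?R\<^esub> a \<in> J" if "a \<in> J" "x \<in> Polys (fst P)" for a x
      using that mult rel_ideal_mult[OF wf] by (simp add: J_def)
    then show "a \<otimes>\<^bsub>?R\<^esub> x \<in> J" if "a \<in> J" "x \<in> Polys (fst P)" for a x
      using that by (simp add: mult.commute)
  qed
  then have "rel_ideal P \<subseteq> J"
    unfolding rel_ideal_def using gen rel_ideal_gen[OF wf]
    by (intro genideal_minimal) (auto simp: J_def rel_ideal_def)
  then show ?thesis using f by (auto simp: J_def)
qed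

lemma coord_cring: "wf_pres P \<Longrightarrow> cring (coord_ring P)"
  unfolding coord_ring_def by (rule ideal.quotient_is_cring[OF rel_ideal_ideal cring_poly_ring])

lemma cls_hom: "wf_pres P \<Longrightarrow> cls P \<in> ring_hom (poly_ring (fst P)) (coord_ring P)"
  unfolding coord_ring_def cls_def using ideal.rcos_ring_hom[OF rel_ideal_ideal] by fastforce

lemma cls_ops:
  assumes "wf_pres P" "f \<in> Polys (fst P)" "g \<in> Polys (fst P)"
  shows "cls P f \<in> carrier (coord_ring P)"
    "cls P (f * g) = cls P f \<otimes>\<^bsub>coord_ring P\<^esub> cls P g"
    "cls P (f + g) = cls P f \<oplus>\<^bsub>coord_ring P\<^esub> cls P g"
  using ring_hom_closed[OF cls_hom[OF assms(1)]] ring_hom_mult[OF cls_hom[OF assms(1)]]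
    ring_hom_add[OF cls_hom[OF assms(1)]] assms(2,3) by fastforce+

lemma cls_1: "wf_pres P \<Longrightarrow> cls P 1 = \<one>\<^bsub>coord_ring P\<^esub>"
  using ring_hom_one[OF cls_hom] by fastforce

lemma cls_power: "wf_pres P \<Longrightarrow> f \<in> Polys (fst P) \<Longrightarrow> cls P (f ^ k) = cls P f [^]\<^bsub>coord_ring P\<^esub> k"
  using monoid.nat_pow_Suc[OF ring.is_monoid[OF cring.axioms(1)[OF coord_cring]]]
    monoid.nat_pow_0[OF ring.is_monoid[OF cring.axioms(1)[OF coord_cring]]]
  by (induction k) (simp_all add: cls_1 cls_ops mult.commute[of f] del: power_Suc add: power_Suc2)

lemma coord_carrierE:
  assumes "c \<in> carrier (coord_ring P)"
  obtains f where "f \<in> Polys (fst P)" "c = cls P f"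
  using assms unfolding coord_ring_def cls_def FactRing_def A_RCOSETS_def' by auto

lemma cls_eq_iff:
  assumes wf: "wf_pres P" and f: "f \<in> Polys (fst P)" "g \<in> Polys (fst P)"
  shows "cls P f = cls P g \<longleftrightarrow> f - g \<in> rel_ideal P"
proof -
  interpret cring "poly_ring (fst P)" by (rule cring_poly_ring)
  show ?thesis
    using quotient_eq_iff_same_a_r_cos[OF rel_ideal_ideal[OF wf] f] f
    by (simp add: cls_def a_minus_def poly_ring_uminus)
qed

lemma cls_0:
  assumes wf: "wf_pres P"
  shows "cls P 0 = \<zero>\<^bsub>coord_ring P\<^esub>"
proof -
  interpret C: cring "coord_ring P" by (rule coord_cring[OF wf])
  have "cls P 0 \<oplus>\<^bsub>coord_ring P\<^esub> cls P 0 = cls P 0"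
    using cls_ops(3)[OF wf, of 0 0] by simp
  then show ?thesis
    using C.add.l_cancel_one[of "cls P 0" "cls P 0"] cls_ops(1)[OF wf Poly_0 Poly_0] by simp
qed

text \<open>The argument order is that of the morphism from \<open>Aff P\<close> to \<open>Aff Q\<close>; the substitution goes the
  other way.\<close>

definition subst_ok :: "presentation \<Rightarrow> presentation \<Rightarrow> (coord \<Rightarrow> mpoly) \<Rightarrow> bool"
  where "subst_ok P Q \<phi> \<longleftrightarrow> wf_pres P \<and> wf_pres Q \<and> (\<forall>v\<in>fst Q. \<phi> v \<in> Polys (fst P)) \<and>
    (\<forall>r\<in>snd Q. ev \<phi> r \<in> rel_ideal P)"

text \<open>Classes are sets without a distinguished member, so one is chosen; by
  \<open>poly_hom_cls\<close> every choice gives the same value when the substitution respects the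
  equations.\<close>

definition poly_hom :: "presentation \<Rightarrow> presentation \<Rightarrow> (coord \<Rightarrow> mpoly) \<Rightarrow> mpoly set \<Rightarrow> mpoly set"
  where "poly_hom P Q \<phi> c = cls P (ev \<phi> (SOME f. f \<in> Polys (fst Q) \<and> c = cls Q f))"

lemma subst_okD:
  assumes "subst_ok P Q \<phi>"
  shows "wf_pres P" "wf_pres Q" "\<And>v. v \<in> fst Q \<Longrightarrow> \<phi> v \<in> Polys (fst P)"
    "\<And>f. f \<in> Polys (fst Q) \<Longrightarrow> ev \<phi> f \<in> Polys (fst P)"
    "\<And>r. r \<in> snd Q \<Longrightarrow> ev \<phi> r \<in> rel_ideal P"
  using assms ev_Poly unfolding subst_ok_def by blast+

lemma subst_ok_rel:
  assumes ok: "subst_ok P Q \<phi>" and f: "f \<in> rel_ideal Q"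
  shows "ev \<phi> f \<in> rel_ideal P"
  using subst_okD(2)[OF ok] f
  by (induction f rule: rel_ideal_induct)
    (use subst_okD[OF ok] in \<open>simp_all add: rel_ideal_0 rel_ideal_add rel_ideal_mult\<close>)

lemma poly_hom_cls:
  assumes ok: "subst_ok P Q \<phi>" and f: "f \<in> Polys (fst Q)"
  shows "poly_hom P Q \<phi> (cls Q f) = cls P (ev \<phi> f)"
proof -
  note wf = subst_okD(1,2)[OF ok]
  define g where "g = (SOME g. g \<in> Polys (fst Q) \<and> cls Q f = cls Q g)"
  have g: "g \<in> Polys (fst Q)" "cls Q f = cls Q g"
    unfolding g_def using someI[of "\<lambda>g. g \<in> Polys (fst Q) \<and> cls Q f = cls Q g" f] f by blast+
  then have "f - g \<in> rel_ideal Q" using cls_eq_iff[OF wf(2)] f by blast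
  then have "ev \<phi> f - ev \<phi> g \<in> rel_ideal P" using subst_ok_rel[OF ok] by force
  then have "cls P (ev \<phi> f) = cls P (ev \<phi> g)"
    using cls_eq_iff[OF wf(1)] subst_okD(4)[OF ok] f g by blast
  then show ?thesis by (simp add: poly_hom_def g_def)
qed

lemma poly_hom_ring_hom:
  assumes ok: "subst_ok P Q \<phi>"
  shows "ring_hom_cring (coord_ring Q) (coord_ring P) (poly_hom P Q \<phi>)"
proof -
  note wf = subst_okD(1,2)[OF ok]
  note c = subst_okD(4)[OF ok]
  interpret Q: cring "coord_ring Q" by (rule coord_cring[OF wf(2)])
  interpret P: cring "coord_ring P" by (rule coord_cring[OF wf(1)])
  show ?thesis
  proof
    show "poly_hom P Q \<phi> \<in> ring_hom (coord_ring Q) (coord_ring P)"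
    proof (rule ring_hom_memI)
      fix x y assume "x \<in> carrier (coord_ring Q)" "y \<in> carrier (coord_ring Q)"
      then obtain f g where fg: "f \<in> Polys (fst Q)" "x = cls Q f" "g \<in> Polys (fst Q)" "y = cls Q g"
        by (metis coord_carrierE)
      show "poly_hom P Q \<phi> x \<in> carrier (coord_ring P)"
        using fg c by (simp add: poly_hom_cls[OF ok] cls_ops(1)[OF wf(1) _ Poly_0])
      show "poly_hom P Q \<phi> (x \<otimes>\<^bsub>coord_ring Q\<^esub> y) = poly_hom P Q \<phi> x \<otimes>\<^bsub>coord_ring P\<^esub> poly_hom P Q \<phi> y"
        using fg c by (simp add: poly_hom_cls[OF ok] wf flip: cls_ops)
      show "poly_hom P Q \<phi> (x \<oplus>\<^bsub>coord_ring Q\<^esub> y) = poly_hom P Q \<phi> x \<oplus>\<^bsub>coord_ring P\<^esub> poly_hom P Q \<phi> y"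
        using fg c by (simp add: poly_hom_cls[OF ok] wf flip: cls_ops)
    next
      show "poly_hom P Q \<phi> \<one>\<^bsub>coord_ring Q\<^esub> = \<one>\<^bsub>coord_ring P\<^esub>"
        by (simp add: wf poly_hom_cls[OF ok] flip: cls_1)
    qed
  qed
qed

lemma ev_congruent:
  assumes wf: "wf_pres P" and f: "f \<in> Polys S"
    and \<phi>: "\<And>v. v \<in> S \<Longrightarrow> \<phi> v \<in> Polys (fst P)" and \<tau>: "\<And>v. v \<in> S \<Longrightarrow> \<tau> v \<in> Polys (fst P)"
    and eq: "\<And>v. v \<in> S \<Longrightarrow> \<phi> v - \<tau> v \<in> rel_ideal P"
  shows "ev \<phi> f - ev \<tau> f \<in> rel_ideal P"
  using f
proof (induction f rule: Poly_induct)
  case (add p q)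
  have "ev \<phi> (p + q) - ev \<tau> (p + q) = (ev \<phi> p - ev \<tau> p) + (ev \<phi> q - ev \<tau> q)" by simp
  then show ?case using rel_ideal_add[OF wf] add by metis
next
  case (mult p q)
  have "ev \<phi> (p * q) - ev \<tau> (p * q) = ev \<phi> q * (ev \<phi> p - ev \<tau> p) + ev \<tau> p * (ev \<phi> q - ev \<tau> q)"
    by (simp add: algebra_simps)
  moreover have "ev \<phi> q \<in> Polys (fst P)" "ev \<tau> p \<in> Polys (fst P)"
    using ev_Poly[of q S \<phi>, OF mult(2) \<phi>] ev_Poly[of p S \<tau>, OF mult(1) \<tau>] by simp_all
  ultimately show ?case
    using rel_ideal_add[OF wf] rel_ideal_mult[OF wf] mult by metis
qed (simp_all add: rel_ideal_0[OF wf] eq)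

section \<open>Morphisms of affine schemes given by substitutions\<close>

definition Aff_map :: "presentation \<Rightarrow> presentation \<Rightarrow> (coord \<Rightarrow> mpoly) \<Rightarrow> aff_morph"
  where "Aff_map P Q \<phi> = Spec_map (coord_ring Q) (coord_ring P) (poly_hom P Q \<phi>)"

lemma Aff_map_morphism: "subst_ok P Q \<phi> \<Longrightarrow> lrs_morphism (Aff P) (Aff Q) (Aff_map P Q \<phi>)"
  unfolding Aff_map_def Aff_def by (rule ring_hom_cring.Spec_map_morphism[OF poly_hom_ring_hom])

lemma Aff_map_pulls_back:
  assumes ok: "subst_ok P Q \<phi>" and v: "v \<in> fst Q"
  shows "pulls_back P (aff_points P) Q (Aff_map P Q \<phi>) v (cls P (\<phi> v))"
proof -
  interpret h: ring_hom_cring "coord_ring Q" "coord_ring P" "poly_hom P Q \<phi>"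
    by (rule poly_hom_ring_hom[OF ok])
  have "preim (Aff P) (spec_pt (coord_ring Q) (poly_hom P Q \<phi>)) (aff_points Q) = aff_points P"
    using h.spec_pt_prime unfolding Aff_def h.preim_spec_pt h.R.Spec_points h.S.Spec_points by blast
  then show ?thesis
    using v h.Spec_map_regular[OF cls_ops(1)[OF subst_okD(2)[OF ok] _ Poly_0], of "var v" "aff_points Q"]
    by (simp add: pulls_back_def Aff_map_def poly_hom_cls[OF ok] Aff_def)
qed

lemma Aff_map_given_by:
  assumes "subst_ok P Q \<phi>" and "\<And>v. v \<in> fst Q \<Longrightarrow> \<theta> v = cls P (\<phi> v)"
  shows "given_by P Q (Aff_map P Q \<phi>) \<theta>"
  unfolding given_by_def using Aff_map_morphism Aff_map_pulls_back assms by auto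

lemma Aff_map_id:
  assumes ok: "subst_ok P P \<phi>" and id: "\<And>v. v \<in> fst P \<Longrightarrow> \<phi> v - var v \<in> rel_ideal P"
  shows "eq_morph (Aff P) (Aff P) (Aff_map P P \<phi>) id_morph"
  unfolding Aff_map_def Aff_def
proof (rule Spec_map_id)
  note wf = subst_okD(1)[OF ok]
  show "cring (coord_ring P)" by (rule coord_cring[OF wf])
  fix c assume "c \<in> carrier (coord_ring P)"
  then obtain f where f: "f \<in> Polys (fst P)" "c = cls P f" by (rule coord_carrierE)
  have "ev \<phi> f - ev var f \<in> rel_ideal P"
    using ev_congruent[OF wf f(1), of \<phi> var] subst_okD(3)[OF ok] id by simp
  then show "poly_hom P P \<phi> c = c"
    using f cls_eq_iff[OF wf] subst_okD(4)[OF ok] by (simp add: poly_hom_cls[OF ok])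
qed

lemma subst_ok_comp:
  assumes \<phi>: "subst_ok P Q \<phi>" and \<tau>: "subst_ok Q R \<tau>"
  shows "subst_ok P R (\<lambda>v. ev \<phi> (\<tau> v))"
  using subst_okD[OF \<phi>] subst_okD[OF \<tau>] subst_ok_rel[OF \<phi>]
  by (simp add: subst_ok_def flip: ev_ev)

lemma Aff_map_comp:
  assumes \<phi>: "subst_ok P Q \<phi>" and \<tau>: "subst_ok Q R \<tau>" and \<rho>: "subst_ok P R \<rho>"
    and eq: "\<And>v. v \<in> fst R \<Longrightarrow> ev \<phi> (\<tau> v) - \<rho> v \<in> rel_ideal P"
  shows "eq_morph (Aff P) (Aff R) (comp_morph (Aff Q) (Aff_map Q R \<tau>) (Aff_map P Q \<phi>)) (Aff_map P R \<rho>)"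
  unfolding Aff_map_def Aff_def
proof (rule Spec_map_comp[OF poly_hom_ring_hom[OF \<tau>] poly_hom_ring_hom[OF \<phi>] poly_hom_ring_hom[OF \<rho>]])
  note wf = subst_okD(1)[OF \<phi>]
  fix c assume "c \<in> carrier (coord_ring R)"
  then obtain f where f: "f \<in> Polys (fst R)" "c = cls R f" by (rule coord_carrierE)
  have "ev \<phi> (ev \<tau> f) - ev \<rho> f \<in> rel_ideal P"
    unfolding ev_ev using subst_okD(3,4) \<phi> \<tau> \<rho> eq by (intro ev_congruent[OF wf f(1)]) auto
  then show "poly_hom P Q \<phi> (poly_hom Q R \<tau> c) = poly_hom P R \<rho> c"
    using f cls_eq_iff[OF wf] subst_okD(4)[OF \<phi>] subst_okD(4)[OF \<tau>] subst_okD(4)[OF \<rho>]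
    by (simp add: poly_hom_cls[OF \<phi>] poly_hom_cls[OF \<tau>] poly_hom_cls[OF \<rho>])
qed

text \<open>Squares of morphisms commute as soon as the two composite substitutions agree on
  coordinates; associativity and equivariance are checked in this form.\<close>

lemma Aff_map_comp_eq:
  assumes \<phi>: "subst_ok P Q \<phi>" and \<tau>: "subst_ok Q R \<tau>" and \<phi>': "subst_ok P Q' \<phi>'" and \<tau>': "subst_ok Q' R \<tau>'"
    and eq: "\<And>v. v \<in> fst R \<Longrightarrow> ev \<phi> (\<tau> v) = ev \<phi>' (\<tau>' v)"
  shows "eq_morph (Aff P) (Aff R) (comp_morph (Aff Q) (Aff_map Q R \<tau>) (Aff_map P Q \<phi>))
    (comp_morph (Aff Q') (Aff_map Q' R \<tau>') (Aff_map P Q' \<phi>'))"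
proof -
  note \<rho> = subst_ok_comp[OF \<phi> \<tau>]
  have "eq_morph (Aff P) (Aff R) (comp_morph (Aff Q) (Aff_map Q R \<tau>) (Aff_map P Q \<phi>)) (Aff_map P R (\<lambda>v. ev \<phi> (\<tau> v)))"
    by (rule Aff_map_comp[OF \<phi> \<tau> \<rho>]) (simp add: rel_ideal_0 subst_okD(1)[OF \<phi>])
  moreover have "eq_morph (Aff P) (Aff R) (comp_morph (Aff Q') (Aff_map Q' R \<tau>') (Aff_map P Q' \<phi>')) (Aff_map P R (\<lambda>v. ev \<phi> (\<tau> v)))"
    by (rule Aff_map_comp[OF \<phi>' \<tau>' \<rho>]) (simp add: eq rel_ideal_0 subst_okD(1)[OF \<phi>])
  ultimately show ?thesis by (rule eq_morph_trans[OF _ eq_morph_sym])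
qed


section \<open>Weighted actions of the roots of unity\<close>

lemma mu_prod_simps [simp]:
  "fst (mu_prod m j P) = insert (C_z j) (fst P)"
  "snd (mu_prod m j P) = insert (var (C_z j) ^ m - 1) (snd P)"
  by (simp_all add: mu_prod_def)

lemma wf_mu_prod: "wf_pres P \<Longrightarrow> wf_pres (mu_prod m j P)"
  unfolding wf_pres_def by (auto intro: Poly_mono)

lemma rel_ideal_mono:
  assumes "wf_pres P" "wf_pres Q" "fst P \<subseteq> fst Q" "snd P \<subseteq> snd Q" "f \<in> rel_ideal P"
  shows "f \<in> rel_ideal Q"
  using assms(1,5)
  by (induction f rule: rel_ideal_induct)
    (use assms(2-4) Poly_mono rel_ideal_gen[OF assms(2)] in
      \<open>auto simp: rel_ideal_0 rel_ideal_add intro!: rel_ideal_mult\<close>)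

lemma rel_ideal_mu_prod: "wf_pres P \<Longrightarrow> f \<in> rel_ideal P \<Longrightarrow> f \<in> rel_ideal (mu_prod m j P)"
  by (rule rel_ideal_mono[OF _ wf_mu_prod]) auto

lemma subst_ok_mu_proj: "wf_pres P \<Longrightarrow> subst_ok (mu_prod m j P) P var"
  unfolding subst_ok_def by (auto simp: wf_mu_prod intro!: rel_ideal_gen)

lemma mu_proj_Aff_map: "wf_pres P \<Longrightarrow> mu_proj m j P (Aff_map (mu_prod m j P) P var)"
  unfolding mu_proj_def by (rule Aff_map_given_by[OF subst_ok_mu_proj]) simp_all

text \<open>Overwriting \<phi> at \<open>C_z j\<close> does not disturb the equations of
  \<open>Q\<close>, because that coordinate does not occur there.\<close>

lemma subst_ok_id_times:
  assumes ok: "subst_ok P Q \<phi>" and j: "C_z j \<notin> fst Q"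
  shows "subst_ok (mu_prod m i P) (mu_prod m j Q) (\<phi>(C_z j := var (C_z i)))"
proof -
  note wf = subst_okD(1,2)[OF ok]
  have "ev (\<phi>(C_z j := var (C_z i))) r = ev \<phi> r" if "r \<in> snd Q" for r
    using that wf(2) j by (intro ev_cong[of r "fst Q"]) (auto simp: wf_pres_def)
  then have "ev (\<phi>(C_z j := var (C_z i))) r \<in> rel_ideal (mu_prod m i P)" if "r \<in> snd Q" for r
    using that rel_ideal_mu_prod[OF wf(1) subst_okD(5)[OF ok]] by simp
  moreover have "var (C_z i) ^ m - 1 \<in> rel_ideal (mu_prod m i P)"
    by (rule rel_ideal_gen[OF wf_mu_prod[OF wf(1)]]) simp
  moreover have "\<phi> v \<in> Polys (insert (C_z i) (fst P))" if "v \<in> fst Q" for v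
    using Poly_mono[OF subst_okD(3)[OF ok that]] by blast
  ultimately show ?thesis
    unfolding subst_ok_def by (auto simp: wf_mu_prod wf)
qed

lemma id_times_Aff_map:
  assumes ok: "subst_ok P Q \<phi>" and j: "C_z j \<notin> fst Q"
  shows "id_times m i P j Q (Aff_map P Q \<phi>) (Aff_map (mu_prod m i P) (mu_prod m j Q) (\<phi>(C_z j := var (C_z i))))"
proof -
  note wf = subst_okD(1,2)[OF ok]
  note ok' = subst_ok_id_times[OF ok j, of m i]
  have "pulls_back (mu_prod m i P) (aff_points (mu_prod m i P)) (mu_prod m j Q)
      (Aff_map (mu_prod m i P) (mu_prod m j Q) (\<phi>(C_z j := var (C_z i)))) (C_z j) (cls (mu_prod m i P) (var (C_z i)))"
    using Aff_map_pulls_back[OF ok', of "C_z j"] by simp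
  moreover have "eq_morph (Aff (mu_prod m i P)) (Aff Q)
     (comp_morph (Aff (mu_prod m j Q)) (Aff_map (mu_prod m j Q) Q var)
       (Aff_map (mu_prod m i P) (mu_prod m j Q) (\<phi>(C_z j := var (C_z i)))))
     (comp_morph (Aff P) (Aff_map P Q \<phi>) (Aff_map (mu_prod m i P) P var))"
    using j by (intro Aff_map_comp_eq ok' ok subst_ok_mu_proj wf) auto
  ultimately show ?thesis
    unfolding id_times_def using Aff_map_morphism[OF ok'] mu_proj_Aff_map wf by blast
qed

text \<open>The coaction of a grading: a root of unity \<open>z\<close> multiplies a coordinate of
  weight \<open>k\<close> by \<open>z^k\<close>.\<close>

definition weighted :: "(coord \<Rightarrow> nat) \<Rightarrow> coord \<Rightarrow> mpoly"
  where "weighted w v = var (C_z 1) ^ w v * var v"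

text \<open>For such an action the unit law is \<open>1^k = 1\<close> and the associative law is
  \<open>(z2 z1)^k = z2^k z1^k\<close>; the real condition is \<open>ok\<close>, that the equations
  are respected. Weight 0 on the base coordinates makes the action one over the base.\<close>

lemma weighted_action:
  assumes ok: "subst_ok (mu_prod m 1 P) P (weighted w)"
    and z: "C_z 1 \<notin> fst P" "C_z 2 \<notin> fst P"
    and base: "\<And>v. v \<in> fst (base_pres m) \<Longrightarrow> v \<in> fst P \<and> w v = 0"
  shows "mu_action m P (Aff_map (mu_prod m 1 P) P (weighted w))"
proof -
  define P1 P2 where "P1 = mu_prod m 1 P" and "P2 = mu_prod m 2 P1"
  note wf = subst_okD(2)[OF ok]
  have wf1: "wf_pres P1" and wf2: "wf_pres P2" unfolding P1_def P2_def using wf by (simp_all add: wf_mu_prod)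
  note ok = ok[folded P1_def]
  have z1: "C_z 1 \<in> fst P2" "C_z 2 \<in> fst P2" "C_z 1 \<in> fst P1" by (simp_all add: P1_def P2_def)
  have sub: "fst P \<subseteq> fst P2" "fst P \<subseteq> fst P1" by (auto simp: P1_def P2_def)
  define \<epsilon> :: "coord \<Rightarrow> mpoly" where "\<epsilon> = var(C_z 1 := 1)"
  have ok\<epsilon>: "subst_ok P P1 \<epsilon>"
  proof -
    have "ev \<epsilon> r = r" if "r \<in> snd P" for r
      using ev_cong[of r "fst P" \<epsilon> var] that wf z unfolding wf_pres_def \<epsilon>_def by (metis ev_var_id fun_upd_other subsetD)
    then show ?thesis
      using wf wf1 by (auto simp: subst_ok_def P1_def \<epsilon>_def rel_ideal_gen rel_ideal_0)
  qed
  have unit: "eq_morph (Aff P) (Aff P) (comp_morph (Aff P1) (Aff_map P1 P (weighted w)) (Aff_map P P1 \<epsilon>)) id_morph"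
  proof -
    have idok: "subst_ok P P var" using wf by (simp add: subst_ok_def rel_ideal_gen)
    have "eq_morph (Aff P) (Aff P) (comp_morph (Aff P1) (Aff_map P1 P (weighted w)) (Aff_map P P1 \<epsilon>)) (Aff_map P P var)"
      using z wf by (intro Aff_map_comp ok\<epsilon> ok idok) (auto simp: weighted_def \<epsilon>_def rel_ideal_0)
    moreover have "eq_morph (Aff P) (Aff P) (Aff_map P P var) id_morph"
      by (rule Aff_map_id[OF idok]) (simp add: rel_ideal_0 wf)
    ultimately show ?thesis by (rule eq_morph_trans)
  qed
  define \<mu> :: "coord \<Rightarrow> mpoly" where "\<mu> = var(C_z 1 := var (C_z 2) * var (C_z 1))"
  have zrel: "var (C_z 2) ^ m - 1 \<in> rel_ideal P2" "var (C_z 1) ^ m - 1 \<in> rel_ideal P2"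
    by (rule rel_ideal_gen[OF wf2], simp add: P2_def P1_def)+
  have ok\<mu>: "subst_ok P2 P1 \<mu>"
  proof -
    have "ev \<mu> r = r" if "r \<in> snd P" for r
      using ev_cong[of r "fst P" \<mu> var] that wf z unfolding wf_pres_def \<mu>_def by (metis ev_var_id fun_upd_other subsetD)
    then have "ev \<mu> r \<in> rel_ideal P2" if "r \<in> snd P" for r
      using that rel_ideal_gen[OF wf2, of r] by (simp add: P2_def P1_def)
    \<comment> \<open>The relation \<open>z2^m z1^m = 1\<close> as a combination of the relations
      for the two factors.\<close>
    moreover have "ev \<mu> (var (C_z 1) ^ m - 1) =
        var (C_z 1) ^ m * (var (C_z 2) ^ m - 1) + (var (C_z 1) ^ m - 1)"
      by (simp add: \<mu>_def algebra_simps)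
    then have "ev \<mu> (var (C_z 1) ^ m - 1) \<in> rel_ideal P2"
      using rel_ideal_add[OF wf2] rel_ideal_mult[OF wf2 zrel(1)] zrel(2) z1 by (metis Poly_power Poly_var)
    ultimately show ?thesis
      using wf1 wf2 z1 sub by (auto simp: subst_ok_def P1_def \<mu>_def)
  qed
  have gmu: "given_by P2 P1 (Aff_map P2 P1 \<mu>)
      (\<lambda>v. if v = C_z 1 then cls P2 (var (C_z 2) * var (C_z 1)) else cls P2 (var v))"
    by (rule Aff_map_given_by[OF ok\<mu>]) (simp add: \<mu>_def)
  have geps: "given_by P P1 (Aff_map P P1 \<epsilon>) (\<lambda>v. if v = C_z 1 then cls P 1 else cls P (var v))"
    by (rule Aff_map_given_by[OF ok\<epsilon>]) (simp add: \<epsilon>_def)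
  define \<alpha>' where "\<alpha>' = (weighted w)(C_z 1 := var (C_z 2))"
  have idt: "id_times m 2 P1 1 P (Aff_map P1 P (weighted w)) (Aff_map P2 P1 \<alpha>')"
    using id_times_Aff_map[OF ok z(1), of m 2] by (simp add: P1_def P2_def \<alpha>'_def)
  have ok': "subst_ok P2 P1 \<alpha>'"
    using subst_ok_id_times[OF ok z(1), of m 2] by (simp add: P1_def P2_def \<alpha>'_def)
  have assoc: "eq_morph (Aff P2) (Aff P) (comp_morph (Aff P1) (Aff_map P1 P (weighted w)) (Aff_map P2 P1 \<alpha>'))
      (comp_morph (Aff P1) (Aff_map P1 P (weighted w)) (Aff_map P2 P1 \<mu>))"
    using z by (intro Aff_map_comp_eq ok ok' ok\<mu>) (auto simp: weighted_def \<alpha>'_def \<mu>_def power_mult_distrib)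
  have bs: "pulls_back P1 (aff_points P1) P (Aff_map P1 P (weighted w)) v (cls P1 (var v))"
    if "v \<in> fst (base_pres m)" for v
    using Aff_map_pulls_back[OF ok, of v] base[OF that] by (simp add: weighted_def)
  show ?thesis
    unfolding mu_action_def Let_def P1_def[symmetric] P2_def[symmetric]
    using Aff_map_morphism[OF ok] bs geps unit gmu idt assoc by blast
qed

section \<open>Fractions of polynomials\<close>

text \<open>Poly_Mapping makes polynomials an integral domain only for linearly ordered variables; the
  choice of the order is irrelevant.\<close>

instance coord :: countable by countable_datatype

instantiation coord :: linorder
begin

definition less_eq_coord :: "coord \<Rightarrow> coord \<Rightarrow> bool"
  where "less_eq_coord u v \<longleftrightarrow> to_nat u \<le> to_nat v"

definition less_coord :: "coord \<Rightarrow> coord \<Rightarrow> bool"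
  where "less_coord u v \<longleftrightarrow> to_nat u < to_nat v"

instance
  by standard (auto simp: less_eq_coord_def less_coord_def)

end

lemma to_fract_power [simp]: "to_fract (x ^ k) = to_fract x ^ k"
  by (induction k) simp_all

lemma to_fract_prod: "to_fract (prod f A) = (\<Prod>x\<in>A. to_fract (f x))"
  by (induction A rule: infinite_finite_induct) simp_all

lemma to_fract_ev:
  fixes \<phi> :: "coord \<Rightarrow> mpoly"
  shows "to_fract (ev \<phi> p) = ev (\<lambda>v. to_fract (\<phi> v)) p"
proof -
  have nat: "to_fract (of_nat k :: mpoly) = of_nat k" for k
    by (induction k) simp_all
  have "to_fract (of_int c :: mpoly) = of_int c" for c
    by (cases c rule: int_cases2) (simp_all add: nat)
  note * = this
  show ?thesis using Poly_UNIV[of p] by (induction p rule: Poly_induct) (simp_all add: *)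
qed


section \<open>Congruence modulo the equations of a presentation\<close>

definition eqv :: "presentation \<Rightarrow> mpoly \<Rightarrow> mpoly \<Rightarrow> bool"
  where "eqv P f g \<longleftrightarrow> f \<in> Polys (fst P) \<and> g \<in> Polys (fst P) \<and> f - g \<in> rel_ideal P"

lemma eqv_refl: "wf_pres P \<Longrightarrow> f \<in> Polys (fst P) \<Longrightarrow> eqv P f f"
  by (simp add: eqv_def rel_ideal_0)

lemma eqv_sym: "wf_pres P \<Longrightarrow> eqv P f g \<Longrightarrow> eqv P g f"
  using rel_ideal_uminus[of P "f - g"] by (simp add: eqv_def)

lemma eqv_trans: "wf_pres P \<Longrightarrow> eqv P f g \<Longrightarrow> eqv P g h \<Longrightarrow> eqv P f h"
  using rel_ideal_add[of P "f - g" "g - h"] by (simp add: eqv_def)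

lemma eqv_add:
  assumes "wf_pres P" "eqv P f g" "eqv P f' g'"
  shows "eqv P (f + f') (g + g')"
proof -
  have "f + f' - (g + g') = (f - g) + (f' - g')" by simp
  then show ?thesis using assms rel_ideal_add[of P "f - g" "f' - g'"] unfolding eqv_def by (metis Poly_add)
qed

lemma eqv_mult:
  assumes wf: "wf_pres P" and "eqv P f g" "eqv P f' g'"
  shows "eqv P (f * f') (g * g')"
proof -
  have "f * f' - g * g' = f' * (f - g) + g * (f' - g')" by (simp add: algebra_simps)
  moreover have "f' * (f - g) + g * (f' - g') \<in> rel_ideal P"
    using assms by (intro rel_ideal_add rel_ideal_mult) (auto simp: eqv_def)
  ultimately show ?thesis using assms unfolding eqv_def by auto
qed

lemma eqv_power: "wf_pres P \<Longrightarrow> eqv P f g \<Longrightarrow> eqv P (f ^ k) (g ^ k)"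
  by (induction k) (simp_all add: eqv_refl eqv_mult)

lemma eqv_prod: "wf_pres P \<Longrightarrow> (\<And>x. x \<in> A \<Longrightarrow> eqv P (f x) (g x)) \<Longrightarrow> eqv P (prod f A) (prod g A)"
  by (induction A rule: infinite_finite_induct) (simp_all add: eqv_refl eqv_mult)

lemma eqv_gen: "wf_pres P \<Longrightarrow> f \<in> Polys (fst P) \<Longrightarrow> g \<in> Polys (fst P) \<Longrightarrow> f - g \<in> snd P \<Longrightarrow> eqv P f g"
  by (simp add: eqv_def rel_ideal_gen)

lemma eqv_cls: "wf_pres P \<Longrightarrow> eqv P f g \<Longrightarrow> cls P f = cls P g"
  using cls_eq_iff[of P f g] by (simp add: eqv_def)


text \<open>The polynomials that a power of \<open>g\<close> carries into \<open>A\<close> modulo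
  the equations are closed under sums and products, because \<open>A\<close> is a subring containing
  \<open>g\<close>; hence it suffices to treat the coordinates. Applied twice: to \<open>Y\<close>
  over \<open>X\<close>, and to \<open>V\<close> over the polynomials in the
  \<open>x i\<close>.\<close>

lemma clear_denominators:
  assumes wf: "wf_pres P" and q: "q \<in> Polys (fst P)" and g: "g \<in> A" and sub: "A \<subseteq> Polys (fst P)"
    and int: "\<And>c. of_int c \<in> A"
    and add: "\<And>p q. p \<in> A \<Longrightarrow> q \<in> A \<Longrightarrow> p + q \<in> A" and mult: "\<And>p q. p \<in> A \<Longrightarrow> q \<in> A \<Longrightarrow> p * q \<in> A"
    and var: "\<And>v. v \<in> fst P \<Longrightarrow> \<exists>k. \<exists>p\<in>A. eqv P (var v * g ^ k) p"
  shows "\<exists>k. \<exists>p\<in>A. eqv P (q * g ^ k) p"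
  using q
proof (induction q rule: Poly_induct)
  case (of_int c)
  show ?case by (intro exI[of _ 0] bexI[of _ "of_int c"]) (simp_all add: int eqv_refl[OF wf])
next
  case (add p q)
  then obtain k l c d where *: "c \<in> A" "eqv P (p * g ^ k) c" "d \<in> A" "eqv P (q * g ^ l) d" by blast
  have pow: "g ^ i \<in> A" for i using int[of 1] by (induction i) (simp_all add: g mult)
  have "eqv P (p * g ^ k * g ^ l + q * g ^ l * g ^ k) (c * g ^ l + d * g ^ k)"
    using pow sub by (intro eqv_add eqv_mult * wf eqv_refl) blast+
  then have "eqv P ((p + q) * g ^ (k + l)) (c * g ^ l + d * g ^ k)"
    by (simp add: power_add algebra_simps)
  then show ?case using * pow assms(6) mult by blast
next
  case (mult p q)
  then obtain k l c d where *: "c \<in> A" "eqv P (p * g ^ k) c" "d \<in> A" "eqv P (q * g ^ l) d" by blast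
  have "eqv P (p * g ^ k * (q * g ^ l)) (c * d)"
    by (intro eqv_mult * wf)
  then have "eqv P (p * q * g ^ (k + l)) (c * d)"
    by (simp add: power_add mult_ac)
  then show ?case using * assms(7) by blast
qed (rule var)


section \<open>The equations of the families\<close>

lemma div_mult_chain:
  fixes h d e :: nat
  assumes "h dvd d" "d dvd e"
  shows "e div d * (d div h) = e div h"
proof -
  from assms obtain k l where "d = h * k" "e = h * k * l" by (metis dvdE)
  then show ?thesis by (cases "h = 0 \<or> k = 0") auto
qed

text \<open>Each index contributes to exactly one divisor, \<open>e = gcd m (k i)\<close>, and since
  \<open>e\<close> divides \<open>k i\<close>, raising to the power \<open>e\<close> restores the
  full exponent. This gives the factorization of f into the powers \<open>F e ^ e\<close>.\<close>

lemma prod_gcd_regroup: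
  fixes g :: "nat \<Rightarrow> 'r::comm_semiring_1" and m :: nat
  assumes "finite I" "m > 0"
  shows "(\<Prod>e\<in>{e. e dvd m}. (\<Prod>i\<in>{i \<in> I. gcd m (k i) = e}. g i ^ (k i div e)) ^ e) = (\<Prod>i\<in>I. g i ^ k i)"
proof -
  have "(\<Prod>i\<in>{i \<in> I. gcd m (k i) = e}. g i ^ (k i div e)) ^ e = (\<Prod>i\<in>{i \<in> I. gcd m (k i) = e}. g i ^ k i)" for e
  proof -
    have "(g i ^ (k i div e)) ^ e = g i ^ k i" if "gcd m (k i) = e" for i
      using that by (metis dvd_div_mult_self gcd_dvd2 power_mult)
    then show ?thesis by (auto simp: prod_power_distrib intro!: prod.cong)
  qed
  then show ?thesis
    using prod.group[of I "{e. e dvd m}" "\<lambda>i. gcd m (k i)" "\<lambda>i. g i ^ k i"] assms by auto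
qed

locale family =
  fixes n m :: nat and a b :: "nat \<Rightarrow> nat"
  assumes n1: "n \<ge> 1" and m1: "m \<ge> 1"
    and ab: "\<And>i. i \<in> {1..n} \<Longrightarrow> a i \<le> b i"
begin

abbreviation "PV \<equiv> V_pres n m"
abbreviation "PX \<equiv> X_pres n m a b"
abbreviation "PY \<equiv> Y_pres n m a b"
abbreviation "F \<equiv> f_abe n m a b"
definition g :: mpoly
  where "g = (\<Prod>i\<in>{1..n}. 1 - var (C_x i))"

abbreviation "multiples d \<equiv> {e. d dvd e \<and> e dvd m}"

lemma finite_divisors [simp]: "finite {e. e dvd m}" "finite {e. e dvd m \<and> Q e}" "finite {e. Q e \<and> e dvd m}"
  using m1 by (auto intro: finite_subset[OF _ finite_divisors_nat[of m]])

lemma dvd_pos: "d dvd m \<Longrightarrow> d > 0" using m1 by (auto intro: Nat.gr0I)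

lemma f_ab_eq: "f_ab n a b = (\<Prod>e\<in>{e. e dvd m}. F e ^ e)"
  using prod_gcd_regroup[of "{1..n}" m "\<lambda>i. - var (C_x i)" a]
    prod_gcd_regroup[of "{1..n}" m "\<lambda>i. 1 - var (C_x i)" "\<lambda>i. b i - a i"] m1
  by (simp add: f_ab_def f_abe_def power_mult_distrib prod.distrib)

lemma coords [simp]:
  "C_x i \<in> fst PV \<longleftrightarrow> i \<in> {1..n}" "C_inv_x i \<in> fst PV \<longleftrightarrow> i \<in> {1..n}"
  "C_t \<in> fst PV" "C_inv_m \<in> fst PV" "C_inv_t \<in> fst PV" "C_inv_1t \<in> fst PV"
  "C_inv_1x i \<notin> fst PV" "C_y \<notin> fst PV" "C_yd d \<notin> fst PV" "C_z j \<notin> fst PV"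
  by (auto simp: V_pres_def base_pres_def)

lemma fst_PX: "fst PX = fst PV \<union> C_yd ` {d. d dvd m}" by (simp add: X_pres_def)
lemma fst_PY: "fst PY = insert C_y (fst PV \<union> C_inv_1x ` {1..n})" by (simp add: Y_pres_def U_pres_def)
lemma snd_PY: "snd PY = insert (var C_y ^ m - f_ab n a b)
    (snd PV \<union> (\<lambda>i. (1 - var (C_x i)) * var (C_inv_1x i) - 1) ` {1..n})"
  by (simp add: Y_pres_def U_pres_def)

lemma coords_XY [simp]:
  "C_yd d \<in> fst PX \<longleftrightarrow> d dvd m" "C_y \<in> fst PY" "C_yd d \<notin> fst PY" "C_z j \<notin> fst PX" "C_z j \<notin> fst PY"
  "C_inv_1x i \<in> fst PY \<longleftrightarrow> i \<in> {1..n}" "C_inv_x i \<in> fst PY \<longleftrightarrow> i \<in> {1..n}" "C_x i \<in> fst PY \<longleftrightarrow> i \<in> {1..n}"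
  "C_x i \<in> fst PX \<longleftrightarrow> i \<in> {1..n}" "C_inv_1x i \<notin> fst PX" "C_y \<notin> fst PX"
  by (auto simp: fst_PX fst_PY)

lemma snd_PX: "snd PX = snd PV \<union> {var (C_yd 1) - 1} \<union>
       {var (C_yd d) ^ (d div h) -
          var (C_yd h) * (\<Prod>e\<in>{e. e dvd m \<and> h dvd e \<and> \<not> d dvd e}. F e ^ (e div h))
        | h d. h dvd d \<and> d dvd m}"
  by (simp add: X_pres_def)

lemma F_Poly: "C_x ` {1..n} \<subseteq> S \<Longrightarrow> F e \<in> Polys S"
  unfolding f_abe_def by (intro Poly_mult Poly_prod Poly_power Poly_uminus Poly_diff Poly_1) auto

lemma xs_sub: "C_x ` {1..n} \<subseteq> fst PV" "C_x ` {1..n} \<subseteq> fst PX" "C_x ` {1..n} \<subseteq> fst PY"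
  by (auto simp: fst_PX fst_PY)

lemma F_Poly' [simp]: "F e \<in> Polys (fst PV)" "F e \<in> Polys (fst PX)" "F e \<in> Polys (fst PY)"
  using F_Poly xs_sub by blast+

lemma f_ab_Poly [simp]: "f_ab n a b \<in> Polys (fst PV)" "f_ab n a b \<in> Polys (fst PX)" "f_ab n a b \<in> Polys (fst PY)"
  unfolding f_ab_eq by (intro Poly_prod; simp)+

lemma g_Poly [simp]: "g \<in> Polys (fst PV)" "g \<in> Polys (fst PX)" "g \<in> Polys (fst PY)"
  unfolding g_def by (intro Poly_prod; simp add: fst_PX fst_PY)+

lemma wf_PV [simp]: "wf_pres PV"
  unfolding wf_pres_def by (auto simp: V_pres_def base_pres_def intro!: Poly_prod Poly_mult Poly_diff)

lemma V_sub: "fst PV \<subseteq> fst PX" "fst PV \<subseteq> fst PY" "snd PV \<subseteq> snd PX" "snd PV \<subseteq> snd PY"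
  by (auto simp: fst_PX fst_PY snd_PY X_pres_def)

lemma wf_PX [simp]: "wf_pres PX"
proof -
  have "snd PV \<subseteq> Polys (fst PX)" using wf_PV V_sub(1) Poly_mono unfolding wf_pres_def by blast
  moreover have "C_yd d \<in> fst PX" if "d dvd m" for d using that by (simp add: fst_PX)
  ultimately show ?thesis
    unfolding wf_pres_def using dvd_trans
    by (auto simp: snd_PX intro!: Poly_diff Poly_power Poly_mult Poly_prod)
qed

lemma wf_PY [simp]: "wf_pres PY"
proof -
  have "snd PV \<subseteq> Polys (fst PY)" using wf_PV V_sub(2) Poly_mono unfolding wf_pres_def by blast
  then show ?thesis
    unfolding wf_pres_def by (auto simp: snd_PY intro!: Poly_diff Poly_mult)
qed

section \<open>The equations of \<open>X\<close> and \<open>Y\<close> as congruences\<close>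

lemma X_eqn:
  assumes "h dvd d" "d dvd m"
  shows "eqv PX (var (C_yd d) ^ (d div h))
    (var (C_yd h) * (\<Prod>e\<in>{e. e dvd m \<and> h dvd e \<and> \<not> d dvd e}. F e ^ (e div h)))"
proof (rule eqv_gen)
  show "var (C_yd d) ^ (d div h) - var (C_yd h) * (\<Prod>e\<in>{e. e dvd m \<and> h dvd e \<and> \<not> d dvd e}. F e ^ (e div h)) \<in> snd PX"
    using assms unfolding X_pres_def snd_conv by blast
qed (use assms dvd_trans in \<open>auto intro!: Poly_mult Poly_prod Poly_power\<close>)

lemma X_eqn_1: "eqv PX (var (C_yd 1)) 1"
  by (rule eqv_gen) (simp_all, simp add: X_pres_def)

lemma Y_eqn: "eqv PY (var C_y ^ m) (\<Prod>e\<in>{e. e dvd m}. F e ^ e)"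
  unfolding f_ab_eq[symmetric] by (rule eqv_gen) (simp_all add: snd_PY)

text \<open>On \<open>Y\<close> the inverses of \<open>x i\<close> and \<open>1 - x i\<close> are
  coordinates, so the inverse of \<open>F e\<close> is again a polynomial. This replaces the
  division in the formula for \<open>y_d\<close>.\<close>

definition Finv :: "nat \<Rightarrow> mpoly"
  where "Finv e = (\<Prod>i\<in>{i \<in> {1..n}. gcd m (a i) = e}. (- var (C_inv_x i)) ^ (a i div e)) *
    (\<Prod>i\<in>{i \<in> {1..n}. gcd m (b i - a i) = e}. (var (C_inv_1x i)) ^ ((b i - a i) div e))"

lemma Finv_Poly [simp]: "Finv e \<in> Polys (fst PY)"
  unfolding Finv_def by (intro Poly_mult Poly_prod Poly_power Poly_uminus) auto

lemma inv_1x_eqn: "i \<in> {1..n} \<Longrightarrow> eqv PY ((1 - var (C_x i)) * var (C_inv_1x i)) 1"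
  by (rule eqv_gen) (simp_all add: snd_PY)

lemma inv_x_eqn: "i \<in> {1..n} \<Longrightarrow> eqv PY (- var (C_x i) * - var (C_inv_x i)) 1"
  by (rule eqv_gen) (auto simp: snd_PY V_pres_def)

lemma F_Finv: "eqv PY (F e * Finv e) 1"
proof -
  have eq: "F e * Finv e =
      (\<Prod>i\<in>{i \<in> {1..n}. gcd m (a i) = e}. (- var (C_x i) * - var (C_inv_x i)) ^ (a i div e)) *
      (\<Prod>i\<in>{i \<in> {1..n}. gcd m (b i - a i) = e}. ((1 - var (C_x i)) * var (C_inv_1x i)) ^ ((b i - a i) div e))"
    unfolding f_abe_def Finv_def power_mult_distrib prod.distrib by (simp only: mult_ac)
  have "eqv PY (F e * Finv e) ((\<Prod>i\<in>{i \<in> {1..n}. gcd m (a i) = e}. 1 ^ (a i div e)) *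
      (\<Prod>i\<in>{i \<in> {1..n}. gcd m (b i - a i) = e}. 1 ^ ((b i - a i) div e)))"
    unfolding eq by (intro eqv_mult eqv_prod eqv_power wf_PY inv_x_eqn inv_1x_eqn) simp_all
  then show ?thesis by simp
qed

section \<open>The substitution that defines the immersion\<close>

abbreviation "FF d \<equiv> (\<Prod>e\<in>multiples d. F e ^ (e div d))"
abbreviation "GG d \<equiv> (\<Prod>e\<in>multiples d. Finv e ^ (e div d))"

lemma FF_Poly [simp]: "FF d \<in> Polys (fst PX)" "FF d \<in> Polys (fst PY)" and GG_Poly [simp]: "GG d \<in> Polys (fst PY)"
  by (intro Poly_prod; simp)+

lemma FF_GG: "eqv PY (FF d * GG d) 1"
proof -
  have "FF d * GG d = (\<Prod>e\<in>multiples d. (F e * Finv e) ^ (e div d))"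
    by (simp add: power_mult_distrib prod.distrib)
  moreover have "eqv PY \<dots> (\<Prod>e\<in>multiples d. 1 ^ (e div d))"
    by (intro eqv_prod eqv_power wf_PY F_Finv)
  ultimately show ?thesis by simp
qed

definition \<iota>s :: "coord \<Rightarrow> mpoly"
  where "\<iota>s v = (case v of C_yd d \<Rightarrow> var C_y ^ (m div d) * GG d | _ \<Rightarrow> var v)"

lemma \<iota>s_yd [simp]: "\<iota>s (C_yd d) = var C_y ^ (m div d) * GG d" by (simp add: \<iota>s_def)

lemma \<iota>s_V: "v \<in> fst PV \<Longrightarrow> \<iota>s v = var v"
  by (cases v) (simp_all add: \<iota>s_def)

lemma ev_\<iota>s_V: "f \<in> Polys (fst PV) \<Longrightarrow> ev \<iota>s f = f"
  using ev_cong[of f "fst PV" \<iota>s var] \<iota>s_V by simp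

lemma multiples_split:
  fixes G :: "nat \<Rightarrow> 'r::comm_monoid_mult"
  assumes "h dvd d"
  shows "prod G (multiples h) = prod G (multiples d) * prod G {e. e dvd m \<and> h dvd e \<and> \<not> d dvd e}"
proof -
  have "multiples h = multiples d \<union> {e. e dvd m \<and> h dvd e \<and> \<not> d dvd e}"
    using assms dvd_trans by blast
  then show ?thesis
    by (simp add: prod.union_disjoint[symmetric] Int_def)
qed

lemma pow_div:
  fixes f :: "nat \<Rightarrow> 'r::comm_semiring_1"
  assumes "h dvd d"
  shows "(\<Prod>e\<in>multiples d. f e ^ (e div d)) ^ (d div h) = (\<Prod>e\<in>multiples d. f e ^ (e div h))"
  unfolding prod_power_distrib
proof (rule prod.cong)
  fix e assume "e \<in> multiples d"
  then show "(f e ^ (e div d)) ^ (d div h) = f e ^ (e div h)"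
    using div_mult_chain[OF assms, of e] by (simp flip: power_mult)
qed simp

lemma \<iota>s_ok: "subst_ok PY PX \<iota>s"
proof -
  have c: "\<iota>s v \<in> Polys (fst PY)" if v: "v \<in> fst PX" for v
  proof (cases "v \<in> fst PV")
    case True
    then show ?thesis using V_sub(2) by (simp add: \<iota>s_V subset_eq)
  next
    case False
    then show ?thesis using v by (auto simp: fst_PX)
  qed
  have V: "ev \<iota>s r \<in> rel_ideal PY" if r: "r \<in> snd PV" for r
  proof -
    have "r \<in> Polys (fst PV)" using wf_PV r by (auto simp: wf_pres_def)
    moreover have "r \<in> rel_ideal PY" using rel_ideal_gen[OF wf_PY subsetD[OF V_sub(4) r]] .
    ultimately show ?thesis using ev_\<iota>s_V by simp
  qed
  \<comment> \<open>The coordinate \<open>y_1\<close> goes to \<open>y^m\<close> divided by the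
    product of all \<open>F e ^ e\<close>, which is 1 by the equation of \<open>Y\<close>.\<close>
  have "eqv PY (var C_y ^ m * GG 1) (FF 1 * GG 1)"
    using Y_eqn by (intro eqv_mult wf_PY eqv_refl GG_Poly) simp
  from eqv_trans[OF wf_PY this FF_GG]
  have 1: "ev \<iota>s (var (C_yd 1) - 1) \<in> rel_ideal PY" by (simp add: eqv_def)
  have "ev \<iota>s (var (C_yd d) ^ (d div h) -
      var (C_yd h) * (\<Prod>e\<in>{e. e dvd m \<and> h dvd e \<and> \<not> d dvd e}. F e ^ (e div h))) \<in> rel_ideal PY"
    if hd: "h dvd d" "d dvd m" for h d
  proof -
    let ?N = "{e. e dvd m \<and> h dvd e \<and> \<not> d dvd e}"
    have l: "(var C_y ^ (m div d) * GG d) ^ (d div h) = var C_y ^ (m div h) * (\<Prod>e\<in>multiples d. Finv e ^ (e div h))"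
      by (simp add: power_mult_distrib pow_div[OF hd(1)] div_mult_chain[OF hd] flip: power_mult)
    \<comment> \<open>The indices in \<open>?N\<close> occur in \<open>GG h\<close> but not in
      \<open>GG d\<close>; inserting the factor 1 formed by their \<open>F e\<close> and
      \<open>Finv e\<close> turns one side of the equation for \<open>h\<close> and \<open>d\<close>
      into the other.\<close>
    have "(\<Prod>e\<in>?N. Finv e ^ (e div h)) * (\<Prod>e\<in>?N. F e ^ (e div h)) = (\<Prod>e\<in>?N. (F e * Finv e) ^ (e div h))"
      by (simp add: power_mult_distrib prod.distrib)
    moreover have "eqv PY \<dots> (\<Prod>e\<in>?N. 1 ^ (e div h))"
      by (intro eqv_prod eqv_power wf_PY F_Finv)
    ultimately have N: "eqv PY ((\<Prod>e\<in>?N. Finv e ^ (e div h)) * (\<Prod>e\<in>?N. F e ^ (e div h))) 1" by simp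
    have "eqv PY ((var C_y ^ (m div h) * (\<Prod>e\<in>multiples d. Finv e ^ (e div h))) *
        ((\<Prod>e\<in>?N. Finv e ^ (e div h)) * (\<Prod>e\<in>?N. F e ^ (e div h))))
        ((var C_y ^ (m div h) * (\<Prod>e\<in>multiples d. Finv e ^ (e div h))) * 1)"
      by (intro eqv_mult wf_PY N eqv_refl Poly_mult Poly_power Poly_prod) simp_all
    then have "eqv PY ((var C_y ^ (m div h) * GG h) * (\<Prod>e\<in>?N. F e ^ (e div h)))
        ((var C_y ^ (m div d) * GG d) ^ (d div h))"
      unfolding multiples_split[OF hd(1)] l by (simp add: mult_ac)
    then have "eqv PY ((var C_y ^ (m div d) * GG d) ^ (d div h))
        ((var C_y ^ (m div h) * GG h) * (\<Prod>e\<in>?N. F e ^ (e div h)))"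
      by (rule eqv_sym[OF wf_PY])
    then show ?thesis by (simp add: eqv_def ev_prod ev_\<iota>s_V)
  qed
  then show ?thesis
    unfolding subst_ok_def using c V 1 by (auto simp: snd_PX)
qed

end

section \<open>\<open>Y\<close> as a localization of \<open>X\<close>\<close>

context family
begin

lemma FF_Unit:
  shows "cls PY (FF d) \<in> Units (coord_ring PY)" "inv\<^bsub>coord_ring PY\<^esub> cls PY (FF d) = cls PY (GG d)"
proof -
  interpret Y: cring "coord_ring PY" by (rule coord_cring) simp
  have "cls PY (FF d) \<otimes>\<^bsub>coord_ring PY\<^esub> cls PY (GG d) = cls PY (FF d * GG d)"
    by (simp add: cls_ops(2))
  also have "\<dots> = \<one>\<^bsub>coord_ring PY\<^esub>"
    using eqv_cls[OF wf_PY FF_GG] by (simp add: cls_1)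
  finally have *: "cls PY (FF d) \<otimes>\<^bsub>coord_ring PY\<^esub> cls PY (GG d) = \<one>\<^bsub>coord_ring PY\<^esub>" .
  have c: "cls PY (FF d) \<in> carrier (coord_ring PY)" "cls PY (GG d) \<in> carrier (coord_ring PY)"
    by (simp_all add: cls_ops(1)[OF _ _ Poly_0])
  show "inv\<^bsub>coord_ring PY\<^esub> cls PY (FF d) = cls PY (GG d)"
    using Y.comm_inv_char[OF c *] .
  show "cls PY (FF d) \<in> Units (coord_ring PY)"
    using c * Y.m_comm[OF c] unfolding Units_def by auto
qed

lemma multiples_m: "multiples m = {m}"
  by (auto intro: Nat.dvd_antisym simp: dvd_antisym)

text \<open>The equation of \<open>X\<close> for the pair \<open>d | m\<close>, multiplied by \<open>f\<^sub>m^(m/d)\<close>.\<close>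

lemma X_top_eqn:
  assumes "d dvd m"
  shows "eqv PX ((var (C_yd m) * F m) ^ (m div d)) (var (C_yd d) * FF d)"
proof -
  note multiples_m
  then have s: "FF d = F m ^ (m div d) * (\<Prod>e\<in>{e. e dvd m \<and> d dvd e \<and> \<not> m dvd e}. F e ^ (e div d))"
    using multiples_split[OF assms, of "\<lambda>e. F e ^ (e div d)"] by simp
  have "eqv PX (var (C_yd m) ^ (m div d) * F m ^ (m div d))
    (var (C_yd d) * (\<Prod>e\<in>{e. e dvd m \<and> d dvd e \<and> \<not> m dvd e}. F e ^ (e div d)) * F m ^ (m div d))"
    by (intro eqv_mult wf_PX X_eqn assms eqv_refl) simp_all
  then show ?thesis unfolding s power_mult_distrib by (simp only: mult_ac)
qed

text \<open>The case \<open>d = 1\<close> of the previous congruence, where \<open>y_1 = 1\<close>.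
  So \<open>y_m f_m\<close> satisfies the equation of \<open>Y\<close> on all of \<open>X\<close>,
  and only the inverses of the \<open>1 - x i\<close> are missing for a map back to
  \<open>Y\<close>.\<close>

lemma X_full_eqn: "eqv PX ((var (C_yd m) * F m) ^ m) (f_ab n a b)"
proof -
  have "eqv PX (var (C_yd 1) * FF 1) (1 * FF 1)"
    by (intro eqv_mult wf_PX X_eqn_1 eqv_refl FF_Poly)
  from eqv_trans[OF wf_PX X_top_eqn[of 1] this] show ?thesis by (simp add: f_ab_eq)
qed

lemma ev_\<iota>s_F [simp]: "ev \<iota>s (F e) = F e" "ev \<iota>s g = g" "ev \<iota>s (f_ab n a b) = f_ab n a b"
  by (rule ev_\<iota>s_V; simp)+

lemma \<iota>s_y: "eqv PY (ev \<iota>s (var (C_yd m) * F m)) (var C_y)"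
proof -
  note multiples_m
  then have eq: "ev \<iota>s (var (C_yd m) * F m) = var C_y * (F m * Finv m)"
    using m1 by (simp add: mult_ac)
  have "eqv PY (var C_y * (F m * Finv m)) (var C_y * 1)"
    by (intro eqv_mult wf_PY F_Finv eqv_refl) simp
  then show ?thesis unfolding eq by (simp only: mult_1_right)
qed

lemma g_split: "i \<in> {1..n} \<Longrightarrow> g = (1 - var (C_x i)) * (\<Prod>j\<in>{1..n} - {i}. 1 - var (C_x j))"
  unfolding g_def by (rule prod.remove) simp_all

lemma g_remove_Poly: "(\<Prod>j\<in>{1..n} - {i}. 1 - var (C_x j)) \<in> Polys (fst PV)"
  by (intro Poly_prod Poly_diff) simp_all

text \<open>The function y is already the image of \<open>y_m f_m\<close>; denominators come only
  from the inverses of the \<open>1 - x i\<close>, each of which is cleared by one factor of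
  \<open>g\<close>.\<close>

lemma Y_denominators:
  assumes "q \<in> Polys (fst PY)"
  shows "\<exists>k. \<exists>p\<in>Polys (fst PX). eqv PY (q * g ^ k) (ev \<iota>s p)"
proof -
  let ?A = "ev \<iota>s ` Polys (fst PX)"
  have "\<exists>k. \<exists>p\<in>?A. eqv PY (q * g ^ k) p"
  proof (rule clear_denominators[OF wf_PY assms])
    show "g \<in> ?A" by (rule image_eqI[of _ _ g]) simp_all
    show "?A \<subseteq> Polys (fst PY)" using subst_okD(4)[OF \<iota>s_ok] by blast
    show "of_int c \<in> ?A" for c by (rule image_eqI[of _ _ "of_int c"]) simp_all
    show "p + q \<in> ?A" "p * q \<in> ?A" if "p \<in> ?A" "q \<in> ?A" for p q
      using that by (auto simp flip: ev_add ev_mult)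
    fix v assume v: "v \<in> fst PY"
    then consider "v \<in> fst PV" | "v = C_y" | i where "v = C_inv_1x i" "i \<in> {1..n}"
      by (auto simp: fst_PY)
    then show "\<exists>k. \<exists>p\<in>?A. eqv PY (var v * g ^ k) p"
    proof cases
      case 1
      then have "var v \<in> ?A" using V_sub(1) by (intro image_eqI[of _ _ "var v"]) (auto simp: \<iota>s_V)
      then show ?thesis using v by (intro exI[of _ 0] bexI[of _ "var v"]) (simp_all add: eqv_refl)
    next
      case 2
      show ?thesis unfolding 2
        using eqv_sym[OF wf_PY \<iota>s_y]
        by (intro exI[of _ 0] bexI[of _ "ev \<iota>s (var (C_yd m) * F m)"] imageI) simp_all
    next
      case 3
      let ?p = "\<Prod>j\<in>{1..n} - {i}. 1 - var (C_x j)"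
      have p: "?p \<in> Polys (fst PX)" "?p \<in> Polys (fst PY)"
        using g_remove_Poly Poly_mono V_sub by blast+
      have "eqv PY ((1 - var (C_x i)) * var (C_inv_1x i) * ?p) (1 * ?p)"
        by (intro eqv_mult wf_PY inv_1x_eqn 3 eqv_refl p)
      then have "eqv PY (var v * g ^ 1) (ev \<iota>s ?p)"
        unfolding g_split[OF 3(2)] ev_\<iota>s_V[OF g_remove_Poly] 3(1) by (simp add: mult_ac)
      then show ?thesis using p(1) by blast
    qed
  qed
  then show ?thesis by blast
qed

text \<open>The substitution \<open>\<iota>s\<close> is inverted over the ring obtained from the coordinate ring of \<open>X\<close> by
  inverting \<open>g\<close>.  That ring is modelled inside the field of fractions of the polynomial ring: \<open>Loc\<close> is
  the polynomial ring of \<open>X\<close> with \<open>g\<close> inverted, and \<open>LIdeal\<close> is the ideal that the equations of \<open>X\<close>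
  generate in it.\<close>

definition \<kappa>s :: "coord \<Rightarrow> mpoly fract"
  where "\<kappa>s v = (case v of C_y \<Rightarrow> to_fract (var (C_yd m) * F m)
    | C_inv_1x i \<Rightarrow> 1 / to_fract (1 - var (C_x i)) | _ \<Rightarrow> to_fract (var v))"

definition scaled :: "mpoly set \<Rightarrow> mpoly fract set"
  where "scaled M = {z. \<exists>k. \<exists>p\<in>M. to_fract (g ^ k) * z = to_fract p}"

abbreviation "Loc \<equiv> scaled (Polys (fst PX))"
abbreviation "LIdeal \<equiv> scaled (rel_ideal PX)"

lemma \<kappa>s_simps [simp]:
  "\<kappa>s C_y = to_fract (var (C_yd m) * F m)" "\<kappa>s (C_inv_1x i) = 1 / to_fract (1 - var (C_x i))"
  by (simp_all add: \<kappa>s_def)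

lemma \<kappa>s_X: "v \<in> fst PX \<Longrightarrow> \<kappa>s v = to_fract (var v)"
  by (cases v) (auto simp: \<kappa>s_def)

lemma ev_\<kappa>s_X: "f \<in> Polys (fst PX) \<Longrightarrow> ev \<kappa>s f = to_fract f"
  using ev_cong[of f "fst PX" \<kappa>s "\<lambda>v. to_fract (var v)"] \<kappa>s_X to_fract_ev[of var f] by simp

lemma ev_\<kappa>s_V: "f \<in> Polys (fst PV) \<Longrightarrow> ev \<kappa>s f = to_fract f"
  using ev_\<kappa>s_X Poly_mono V_sub by blast

lemma scaled_I: "p \<in> M \<Longrightarrow> to_fract p \<in> scaled M"
  unfolding scaled_def by (intro CollectI exI[of _ 0] bexI[of _ p]) simp_all

lemma scaled_add:
  assumes "x \<in> scaled M" "y \<in> scaled M"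
    and M: "\<And>p q. p \<in> M \<Longrightarrow> q \<in> M \<Longrightarrow> p + q \<in> M" "\<And>p k. p \<in> M \<Longrightarrow> g ^ k * p \<in> M"
  shows "x + y \<in> scaled M"
proof -
  obtain k l c d where *: "c \<in> M" "to_fract (g ^ k) * x = to_fract c"
    "d \<in> M" "to_fract (g ^ l) * y = to_fract d" using assms(1,2) unfolding scaled_def by blast
  have "to_fract (g ^ (k + l)) * (x + y) =
      to_fract (g ^ l) * (to_fract (g ^ k) * x) + to_fract (g ^ k) * (to_fract (g ^ l) * y)"
    by (simp add: power_add algebra_simps)
  also have "\<dots> = to_fract (g ^ l * c + g ^ k * d)" unfolding * by simp
  finally show ?thesis unfolding scaled_def using * M
    by (intro CollectI exI[of _ "k + l"] bexI[of _ "g ^ l * c + g ^ k * d"]) simp_all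
qed

lemma scaled_mult:
  assumes "x \<in> scaled M" "y \<in> scaled N" and M: "\<And>p q. p \<in> M \<Longrightarrow> q \<in> N \<Longrightarrow> p * q \<in> K"
  shows "x * y \<in> scaled K"
proof -
  obtain k l c d where *: "c \<in> M" "to_fract (g ^ k) * x = to_fract c"
    "d \<in> N" "to_fract (g ^ l) * y = to_fract d" using assms(1,2) unfolding scaled_def by blast
  have "to_fract (g ^ (k + l)) * (x * y) = (to_fract (g ^ k) * x) * (to_fract (g ^ l) * y)"
    by (simp add: power_add algebra_simps)
  also have "\<dots> = to_fract (c * d)" unfolding * by simp
  finally show ?thesis unfolding scaled_def using * M
    by (intro CollectI exI[of _ "k + l"] bexI[of _ "c * d"]) simp_all
qed

lemma Loc_add: "x \<in> Loc \<Longrightarrow> y \<in> Loc \<Longrightarrow> x + y \<in> Loc"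
  by (rule scaled_add) simp_all

lemma Loc_mult: "x \<in> Loc \<Longrightarrow> y \<in> Loc \<Longrightarrow> x * y \<in> Loc"
  by (erule (1) scaled_mult) (rule Poly_mult)

lemma LIdeal_add: "x \<in> LIdeal \<Longrightarrow> y \<in> LIdeal \<Longrightarrow> x + y \<in> LIdeal"
  by (rule scaled_add) (simp_all add: rel_ideal_add rel_ideal_mult)

lemma LIdeal_mult: "x \<in> Loc \<Longrightarrow> y \<in> LIdeal \<Longrightarrow> x * y \<in> LIdeal"
  by (erule (1) scaled_mult) (rule rel_ideal_mult[OF wf_PX])

lemma one_minus_x_nz: "1 - var (C_x i) \<noteq> 0"
proof
  assume "1 - var (C_x i) = 0"
  then have "ev (\<lambda>_. 0 :: int) (1 - var (C_x i)) = 0" by simp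
  then show False by simp
qed

lemma g_nz: "g \<noteq> 0"
  unfolding g_def using one_minus_x_nz by (subst prod_zero_iff) (rule finite_atLeastAtMost, blast)

lemma \<kappa>s_Loc: assumes "f \<in> Polys (fst PY)" shows "ev \<kappa>s f \<in> Loc"
  using assms
proof (induction f rule: Poly_induct)
  case (of_int c)
  then show ?case using scaled_I[of "of_int c"] ev_\<kappa>s_X[of "of_int c"] by simp
next
  case (var v)
  then consider "v \<in> fst PX" | "v = C_y" | i where "v = C_inv_1x i" "i \<in> {1..n}"
    by (auto simp: fst_PY fst_PX)
  then show ?case
  proof cases
    case 1 then show ?thesis using scaled_I[of "var v"] \<kappa>s_X by simp
  next
    case 2
    then show ?thesis using scaled_I[of "var (C_yd m) * F m"] by simp
  next
    case 3
    let ?p = "\<Prod>j\<in>{1..n} - {i}. 1 - var (C_x j)"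
    have "?p \<in> Polys (fst PX)" using g_remove_Poly Poly_mono V_sub by blast
    moreover have "to_fract (g ^ 1) * \<kappa>s v = to_fract ?p"
      unfolding g_split[OF 3(2)] 3(1) power_one_right to_fract_mult \<kappa>s_simps
      using one_minus_x_nz[of i] by (simp del: to_fract_diff)
    ultimately show ?thesis unfolding scaled_def by (simp only: ev_var) blast
  qed
qed (simp_all add: Loc_add Loc_mult)

text \<open>The equation of \<open>Y\<close> is respected by \<open>X_full_eqn\<close>; the
  equations for the inverses of the \<open>1 - x i\<close> hold exactly in the field of fractions.
  So \<open>\<kappa>s\<close> is defined on the coordinate ring of \<open>Y\<close>, modulo
  \<open>LIdeal\<close>.\<close>

lemma \<kappa>s_LIdeal:
  assumes "f \<in> rel_ideal PY" shows "ev \<kappa>s f \<in> LIdeal"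
  using wf_PY assms
proof (induction f rule: rel_ideal_induct)
  case (gen f)
  then consider "f \<in> snd PV" | "f = var C_y ^ m - f_ab n a b"
    | i where "f = (1 - var (C_x i)) * var (C_inv_1x i) - 1" "i \<in> {1..n}"
    by (auto simp: snd_PY)
  then show ?case
  proof cases
    case 1
    then have "f \<in> Polys (fst PV)" "f \<in> rel_ideal PX"
      using wf_PV V_sub(3) rel_ideal_gen[OF wf_PX] by (auto simp: wf_pres_def)
    then show ?thesis using scaled_I by (simp add: ev_\<kappa>s_V)
  next
    case 2
    have "ev \<kappa>s f = to_fract ((var (C_yd m) * F m) ^ m - f_ab n a b)"
      unfolding 2 by (simp add: ev_\<kappa>s_V)
    moreover have "to_fract ((var (C_yd m) * F m) ^ m - f_ab n a b) \<in> LIdeal"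
      using X_full_eqn by (intro scaled_I) (simp add: eqv_def)
    ultimately show ?thesis by (simp only:)
  next
    case 3
    have "ev \<kappa>s (var (C_x i)) = to_fract (var (C_x i))"
      using 3 by (intro ev_\<kappa>s_V) simp
    then have "ev \<kappa>s f = to_fract 0"
      using one_minus_x_nz[of i] unfolding 3 by (simp flip: to_fract_1 to_fract_diff)
    then show ?thesis using scaled_I[OF rel_ideal_0[OF wf_PX]] by simp
  qed
next
  case zero
  then show ?case using scaled_I[OF rel_ideal_0[OF wf_PX]] by simp
qed (simp_all add: LIdeal_add LIdeal_mult \<kappa>s_Loc)

text \<open>Going to \<open>Y\<close> and back sends \<open>y_d\<close> to
  \<open>(y_m f_m)^(m/d)\<close> divided by \<open>FF d\<close>, which is \<open>y_d\<close> again
  by \<open>X_top_eqn\<close>; the coordinates of \<open>V\<close> are fixed.\<close>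

lemma \<kappa>s_\<iota>s:
  assumes "f \<in> Polys (fst PX)"
  shows "ev \<kappa>s (ev \<iota>s f) - to_fract f \<in> LIdeal"
  using assms
proof (induction f rule: Poly_induct)
  case (of_int c)
  show ?case using scaled_I[OF rel_ideal_0[OF wf_PX]] ev_\<kappa>s_X[of "of_int c"] by simp
next
  case (var v)
  then consider "v \<in> fst PV" | d where "v = C_yd d" "d dvd m" by (auto simp: fst_PX)
  then show ?case
  proof cases
    case 1
    then show ?thesis using scaled_I[OF rel_ideal_0[OF wf_PX]] var by (simp add: \<iota>s_V \<kappa>s_X)
  next
    case 2
    let ?u = "(var (C_yd m) * F m) ^ (m div d)"
    have "?u - var (C_yd d) * FF d \<in> rel_ideal PX" using X_top_eqn[OF 2(2)] by (simp add: eqv_def)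
    then have k1: "ev \<kappa>s (GG d) * to_fract (?u - var (C_yd d) * FF d) \<in> LIdeal"
      using LIdeal_mult[OF \<kappa>s_Loc scaled_I] GG_Poly by blast
    have "FF d * GG d - 1 \<in> rel_ideal PY" using FF_GG[of d] by (simp add: eqv_def)
    then have k2: "to_fract (var (C_yd d)) * ev \<kappa>s (FF d * GG d - 1) \<in> LIdeal"
      using 2 by (intro LIdeal_mult scaled_I \<kappa>s_LIdeal) simp_all
    have "ev \<kappa>s (FF d) = to_fract (FF d)" by (rule ev_\<kappa>s_X) simp
    then have "ev \<kappa>s (ev \<iota>s (var v)) - to_fract (var v) =
       ev \<kappa>s (GG d) * to_fract (?u - var (C_yd d) * FF d) + to_fract (var (C_yd d)) * ev \<kappa>s (FF d * GG d - 1)"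
      unfolding 2(1) by (simp add: algebra_simps)
    then show ?thesis using LIdeal_add[OF k1 k2] by simp
  qed
next
  case (add p q)
  have "ev \<kappa>s (ev \<iota>s (p + q)) - to_fract (p + q) =
      (ev \<kappa>s (ev \<iota>s p) - to_fract p) + (ev \<kappa>s (ev \<iota>s q) - to_fract q)" by simp
  then show ?case using LIdeal_add add by metis
next
  case (mult p q)
  have "ev \<kappa>s (ev \<iota>s (p * q)) - to_fract (p * q) =
      ev \<kappa>s (ev \<iota>s q) * (ev \<kappa>s (ev \<iota>s p) - to_fract p) + to_fract p * (ev \<kappa>s (ev \<iota>s q) - to_fract q)"
    by (simp add: algebra_simps)
  moreover have "ev \<kappa>s (ev \<iota>s q) \<in> Loc" using \<kappa>s_Loc subst_okD(4)[OF \<iota>s_ok] mult by blast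
  ultimately show ?case using LIdeal_add LIdeal_mult scaled_I mult by metis
qed

text \<open>Apply \<open>\<kappa>s\<close>: the result differs from \<open>f\<close> by an element
  of \<open>LIdeal\<close> and lies in \<open>LIdeal\<close> itself, hence so does \<open>f\<close>.
  As the polynomial ring embeds in its fractions, the equation obtained holds between
  polynomials.\<close>

lemma \<iota>s_kernel:
  assumes f: "f \<in> Polys (fst PX)" and "ev \<iota>s f \<in> rel_ideal PY"
  shows "\<exists>k. g ^ k * f \<in> rel_ideal PX"
proof -
  have "to_fract (- 1) * (ev \<kappa>s (ev \<iota>s f) - to_fract f) \<in> LIdeal"
    by (intro LIdeal_mult scaled_I \<kappa>s_\<iota>s f) simp
  then have "ev \<kappa>s (ev \<iota>s f) + to_fract (- 1) * (ev \<kappa>s (ev \<iota>s f) - to_fract f) \<in> LIdeal"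
    using LIdeal_add \<kappa>s_LIdeal assms(2) by blast
  then have "to_fract f \<in> LIdeal" by simp
  then obtain k p where "p \<in> rel_ideal PX" "to_fract (g ^ k) * to_fract f = to_fract p"
    unfolding scaled_def by blast
  then show ?thesis by (metis to_fract_eq_iff to_fract_mult)
qed

abbreviation "\<theta> \<equiv> poly_hom PY PX \<iota>s"

lemma Y_localization: "inverts_element (coord_ring PX) (coord_ring PY) \<theta> (cls PX g)"
proof -
  interpret h: ring_hom_cring "coord_ring PX" "coord_ring PY" \<theta> by (rule poly_hom_ring_hom[OF \<iota>s_ok])
  have hg: "\<theta> (cls PX g) = cls PY g" using poly_hom_cls[OF \<iota>s_ok, of g] by simp
  note cls_carrier = cls_ops(1)[OF _ _ Poly_0]
  show ?thesis
  proof
    show "cls PX g \<in> carrier (coord_ring PX)" by (simp add: cls_carrier)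
    let ?w = "\<Prod>i\<in>{1..n}. var (C_inv_1x i)"
    have w: "?w \<in> Polys (fst PY)" by (intro Poly_prod) simp
    have "eqv PY (\<Prod>i\<in>{1..n}. (1 - var (C_x i)) * var (C_inv_1x i)) (\<Prod>i\<in>{1..n}. 1)"
      by (intro eqv_prod wf_PY inv_1x_eqn)
    then have "cls PY (g * ?w) = \<one>\<^bsub>coord_ring PY\<^esub>"
      using eqv_cls[OF wf_PY] cls_1[OF wf_PY] by (simp add: prod.distrib g_def)
    then have "cls PY g \<otimes>\<^bsub>coord_ring PY\<^esub> cls PY ?w = \<one>\<^bsub>coord_ring PY\<^esub>"
      using cls_ops(2)[OF wf_PY _ w, of g] by simp
    then show "\<theta> (cls PX g) \<in> Units (coord_ring PY)"
      unfolding hg using h.S.m_comm[of "cls PY g" "cls PY ?w"] cls_carrier[OF wf_PY, of g] cls_carrier[OF wf_PY w]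
      by (auto simp: Units_def)
    show "\<exists>k::nat. \<exists>c\<in>carrier (coord_ring PX). q \<otimes>\<^bsub>coord_ring PY\<^esub> \<theta> (cls PX g) [^]\<^bsub>coord_ring PY\<^esub> k = \<theta> c"
      if q: "q \<in> carrier (coord_ring PY)" for q
    proof -
      obtain f where f: "f \<in> Polys (fst PY)" "q = cls PY f" using coord_carrierE[OF q] by metis
      obtain k p where p: "p \<in> Polys (fst PX)" "eqv PY (f * g ^ k) (ev \<iota>s p)"
        using Y_denominators[OF f(1)] by blast
      have "q \<otimes>\<^bsub>coord_ring PY\<^esub> \<theta> (cls PX g) [^]\<^bsub>coord_ring PY\<^esub> k = cls PY (f * g ^ k)"
        using f by (simp add: hg cls_ops(2) cls_power)
      also have "\<dots> = \<theta> (cls PX p)"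
        using eqv_cls[OF wf_PY p(2)] poly_hom_cls[OF \<iota>s_ok p(1)] by simp
      finally show ?thesis using cls_carrier[OF wf_PX p(1)] by blast
    qed
    show "\<exists>k::nat. cls PX g [^]\<^bsub>coord_ring PX\<^esub> k \<otimes>\<^bsub>coord_ring PX\<^esub> c = \<zero>\<^bsub>coord_ring PX\<^esub>"
      if c: "c \<in> carrier (coord_ring PX)" "\<theta> c = \<zero>\<^bsub>coord_ring PY\<^esub>" for c
    proof -
      obtain f where f: "f \<in> Polys (fst PX)" "c = cls PX f" using coord_carrierE[OF c(1)] by metis
      have "cls PY (ev \<iota>s f) = cls PY 0" using c(2) f by (simp add: poly_hom_cls[OF \<iota>s_ok] cls_0)
      then have "ev \<iota>s f \<in> rel_ideal PY" using cls_eq_iff[OF wf_PY] subst_okD(4)[OF \<iota>s_ok f(1)] by simp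
      then obtain k where "g ^ k * f \<in> rel_ideal PX" using \<iota>s_kernel[OF f(1)] by blast
      then have "cls PX (g ^ k * f) = cls PX 0" using cls_eq_iff[OF wf_PX] f by simp
      then show ?thesis using f
        by (intro exI[of _ k]) (simp add: cls_0 flip: cls_power cls_ops(2))
    qed
  qed
qed

end

section \<open>Primes of the coordinate ring of \<open>X\<close>\<close>

text \<open>When \<open>m\<close> is nonzero in the field, \<open>z^m - 1\<close> has
  \<open>m\<close> distinct roots, too many for a nonzero polynomial of smaller degree. It serves to
  separate the homogeneous parts of a function by its values on an orbit of points.\<close>

lemma roots_of_unity_poly_eq_0:
  fixes \<Phi> :: "'a::alg_closed_field poly"
  assumes m: "of_nat m \<noteq> (0::'a)" and deg: "Polynomial.degree \<Phi> < m"
    and roots: "\<And>w. w ^ m = 1 \<Longrightarrow> Polynomial.poly \<Phi> w = 0"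
  shows "\<Phi> = 0"
proof (rule ccontr)
  assume nz: "\<Phi> \<noteq> 0"
  define Z where "Z = Polynomial.monom (1::'a) m + [:-1:]"
  have m0: "m > 0" using deg by simp
  have Zdeg: "Polynomial.degree Z = m"
    unfolding Z_def using m0 by (simp add: degree_add_eq_left degree_monom_eq)
  then have "Z \<noteq> 0" using m0 by auto
  then obtain A where A: "size A = m" "Z = Polynomial.smult (Polynomial.lead_coeff Z) (\<Prod>x\<in>#A. [:-x, 1:])"
    using alg_closed_imp_factorization[of Z] Zdeg by auto
  have pZ: "Polynomial.poly Z w = w ^ m - 1" for w by (simp add: Z_def poly_monom)
  have root: "w ^ m = 1" if "w \<in># A" for w
  proof -
    have "Polynomial.poly (\<Prod>x\<in>#A. [:-x, 1:]) w = 0" using that by (simp add: poly_prod_mset)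
    then have "Polynomial.poly Z w = 0" by (subst A(2)) simp
    then show ?thesis by (simp add: pZ)
  qed
  have le: "count A w \<le> 1" for w
  proof (rule ccontr)
    assume "\<not> count A w \<le> 1"
    \<comment> \<open>A double root would be a zero of the derivative \<open>m z^(m - 1)\<close>,
      hence 0, which is not a root of unity.\<close>
    then have "{#w, w#} \<subseteq># A" by (simp add: subseteq_mset_def)
    then obtain B where B: "A = {#w, w#} + B" by (metis subset_mset.le_iff_add)
    define C where "C = [:-w, 1:] * (\<Prod>x\<in>#B. [:-x, 1:])"
    have "Z = Polynomial.smult (Polynomial.lead_coeff Z) ([:-w, 1:] * C)"
      by (subst A(2)) (simp only: B C_def image_mset_union image_mset_add_mset image_mset_empty
        prod_mset_Un prod_mset.add_mset prod_mset_empty mult_1_right mult.assoc)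
    then have "pderiv Z = Polynomial.smult (Polynomial.lead_coeff Z) (pderiv ([:-w, 1:] * C))"
      by (metis pderiv_smult)
    moreover have "Polynomial.poly (pderiv ([:-w, 1:] * C)) w = 0"
      unfolding pderiv_mult by (simp add: C_def)
    ultimately have "Polynomial.poly (pderiv Z) w = 0" by simp
    moreover have "Polynomial.poly (pderiv Z) w = of_nat m * w ^ (m - 1)"
      by (simp add: Z_def pderiv_add pderiv_pCons pderiv_monom poly_monom)
    ultimately have "w = 0" using m by simp
    then show False using root[of w] B m0 by (simp add: power_0_left)
  qed
  have "count A w = count (mset_set (set_mset A)) w" for w
  proof (cases "w \<in># A")
    case True
    then have "count A w = 1" using le[of w] count_greater_zero_iff[of A w] by linarith
    then show ?thesis using True by (simp add: count_mset_set')
  qed (simp add: count_mset_set' not_in_iff)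
  then have "A = mset_set (set_mset A)" by (rule multiset_eqI)
  then have "card (set_mset A) = m" using A(1) by (metis size_mset_set)
  moreover have "set_mset A \<subseteq> {w. Polynomial.poly \<Phi> w = 0}" using root roots by auto
  ultimately have "m \<le> card {w. Polynomial.poly \<Phi> w = 0}"
    using card_mono[OF poly_roots_finite[OF nz]] by metis
  then show False using card_poly_roots_bound[OF nz] deg by simp
qed

section \<open>Points of a presentation as prime ideals of polynomials\<close>

definition prime_pres :: "presentation \<Rightarrow> bool"
  where "prime_pres Q \<longleftrightarrow> wf_pres Q \<and> 1 \<notin> rel_ideal Q \<and>
    (\<forall>f\<in>Polys (fst Q). \<forall>h\<in>Polys (fst Q). f * h \<in> rel_ideal Q \<longrightarrow> f \<in> rel_ideal Q \<or> h \<in> rel_ideal Q)"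

text \<open>A point is encoded by adding to the equations all polynomials that vanish there, so that equality
  in its residue ring is again expressed by \<open>eqv\<close>.\<close>

lemma prime_pres_of_prime:
  assumes wf: "wf_pres P" and p: "p \<in> prime_spec (coord_ring P)"
  defines "Q \<equiv> (fst P, {f \<in> Polys (fst P). cls P f \<in> p})"
  shows "prime_pres Q" "rel_ideal Q = snd Q" "snd P \<subseteq> snd Q"
proof -
  interpret R: cring "coord_ring P" by (rule coord_cring[OF wf])
  note p' = R.primeD[OF p]
  have c: "cls P f \<in> carrier (coord_ring P)" if "f \<in> Polys (fst P)" for f
    using cls_ops(1)[OF wf that Poly_0] .
  have wfQ: "wf_pres Q" by (auto simp: wf_pres_def Q_def)
  have "f \<in> snd Q" if "f \<in> rel_ideal Q" for f
    using wfQ that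
  proof (induction f rule: rel_ideal_induct)
    case zero
    then show ?case using p'(4) by (simp add: Q_def cls_0[OF wf])
  next
    case (add f h)
    then show ?case using p'(6) by (simp add: Q_def cls_ops[OF wf])
  next
    case (mult q f)
    then show ?case using p'(5)[OF c c] by (simp add: Q_def cls_ops[OF wf])
  qed
  then show eq: "rel_ideal Q = snd Q" using rel_ideal_gen[OF wfQ] by blast
  show "prime_pres Q"
    unfolding prime_pres_def eq using wfQ p'(3) p'(5)[OF c c]
    by (auto simp: Q_def cls_1[OF wf] cls_ops[OF wf])
  have "cls P f = \<zero>\<^bsub>coord_ring P\<^esub>" if "f \<in> snd P" for f
    using cls_eq_iff[OF wf, of f 0] that wf rel_ideal_gen[OF wf that] by (auto simp: wf_pres_def cls_0[OF wf])
  then show "snd P \<subseteq> snd Q" using wf p'(4) by (auto simp: Q_def wf_pres_def)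
qed

lemma ev_rel_ideal:
  assumes "wf_pres P" "\<And>r. r \<in> snd P \<Longrightarrow> ev \<phi> r = 0" "f \<in> rel_ideal P"
  shows "ev \<phi> f = 0"
  using assms(1,3) by (induction f rule: rel_ideal_induct) (simp_all add: assms(2))

lemma prime_pres_of_point:
  fixes \<phi> :: "coord \<Rightarrow> 'k::idom"
  assumes "wf_pres P" "\<And>r. r \<in> snd P \<Longrightarrow> ev \<phi> r = 0"
  defines "Q \<equiv> (fst P, {f \<in> Polys (fst P). ev \<phi> f = 0})"
  shows "prime_pres Q" "rel_ideal Q = snd Q" "snd P \<subseteq> snd Q"
proof -
  have wfQ: "wf_pres Q" by (auto simp: wf_pres_def Q_def)
  have "f \<in> snd Q" if "f \<in> rel_ideal Q" for f
    using rel_ideal_Poly[OF wfQ that] ev_rel_ideal[OF wfQ _ that, of \<phi>] by (auto simp: Q_def)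
  then show eq: "rel_ideal Q = snd Q" using rel_ideal_gen[OF wfQ] by blast
  show "prime_pres Q" unfolding prime_pres_def eq using wfQ by (auto simp: Q_def)
  show "snd P \<subseteq> snd Q" using assms(1,2) by (auto simp: Q_def wf_pres_def)
qed

text \<open>The prime is the kernel of the evaluation at \<phi>, carried over to the coordinate
  ring. The points of \<open>X\<close> that establish density arise in this way from generic
  points.\<close>

lemma point_prime:
  fixes \<phi> :: "coord \<Rightarrow> 'k::idom"
  assumes wf: "wf_pres P" and \<phi>: "\<And>r. r \<in> snd P \<Longrightarrow> ev \<phi> r = 0"
  obtains q where "q \<in> prime_spec (coord_ring P)"
    "\<And>f. f \<in> Polys (fst P) \<Longrightarrow> cls P f \<in> q \<longleftrightarrow> ev \<phi> f = 0"
proof -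
  interpret R: cring "coord_ring P" by (rule coord_cring[OF wf])
  define q where "q = cls P ` {f \<in> Polys (fst P). ev \<phi> f = 0}"
  have mem: "cls P f \<in> q \<longleftrightarrow> ev \<phi> f = 0" if f: "f \<in> Polys (fst P)" for f
  proof
    assume "cls P f \<in> q"
    then obtain h where h: "h \<in> Polys (fst P)" "ev \<phi> h = 0" "cls P f = cls P h" by (auto simp: q_def)
    then have "f - h \<in> rel_ideal P" using cls_eq_iff[OF wf f h(1)] by simp
    then have "ev \<phi> (f - h) = 0" using ev_rel_ideal[of P \<phi> "f - h"] wf \<phi> by blast
    then show "ev \<phi> f = 0" using h(2) by simp
  qed (use f in \<open>auto simp: q_def\<close>)
  have qc: "q \<subseteq> carrier (coord_ring P)" using cls_ops(1)[OF wf _ Poly_0] by (auto simp: q_def)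
  have mult: "x \<otimes>\<^bsub>coord_ring P\<^esub> c \<in> q" if cx: "c \<in> q" "x \<in> carrier (coord_ring P)" for c x
  proof -
    obtain f where "f \<in> Polys (fst P)" "ev \<phi> f = 0" "c = cls P f"
      using cx(1) unfolding q_def by blast
    moreover obtain h where "h \<in> Polys (fst P)" "x = cls P h" using coord_carrierE[OF cx(2)] .
    ultimately show ?thesis using mem[of "h * f"] by (simp add: cls_ops[OF wf])
  qed
  have "primeideal q (coord_ring P)"
  proof (rule primeidealI)
    show "cring (coord_ring P)" by (rule R.is_cring)
    have "\<one>\<^bsub>coord_ring P\<^esub> \<notin> q" using mem[of 1] by (simp add: cls_1[OF wf])
    then show "carrier (coord_ring P) \<noteq> q" by blast
    show "x \<in> q \<or> y \<in> q"
      if xy: "x \<in> carrier (coord_ring P)" "y \<in> carrier (coord_ring P)" "x \<otimes>\<^bsub>coord_ring P\<^esub> y \<in> q" for x y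
    proof -
      obtain f h where f: "f \<in> Polys (fst P)" "x = cls P f" "h \<in> Polys (fst P)" "y = cls P h"
        using coord_carrierE[OF xy(1)] coord_carrierE[OF xy(2)] by metis
      then have "ev \<phi> (f * h) = 0" using xy(3) mem[of "f * h"] by (simp add: cls_ops[OF wf])
      then show ?thesis using f mem by simp
    qed
    show "ideal q (coord_ring P)"
    proof (rule idealI)
      show "ring (coord_ring P)" by (rule R.ring_axioms)
      show "subgroup q (add_monoid (coord_ring P))"
      proof (rule R.add.subgroupI)
        show "q \<subseteq> carrier (coord_ring P)" by (rule qc)
        show "q \<noteq> {}" using mem[of 0] by auto
        show "\<ominus>\<^bsub>coord_ring P\<^esub> c \<in> q" if "c \<in> q" for c
          using mult[OF that, of "\<ominus>\<^bsub>coord_ring P\<^esub> \<one>\<^bsub>coord_ring P\<^esub>"] subsetD[OF qc that] by (simp add: R.l_minus)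
        show "c \<oplus>\<^bsub>coord_ring P\<^esub> d \<in> q" if cd: "c \<in> q" "d \<in> q" for c d
        proof -
          obtain f h where f: "f \<in> Polys (fst P)" "ev \<phi> f = 0" "c = cls P f"
            "h \<in> Polys (fst P)" "ev \<phi> h = 0" "d = cls P h" using cd by (auto simp: q_def)
          then show ?thesis using mem[of "f + h"] by (simp add: cls_ops[OF wf])
        qed
      qed
    qed (use mult R.m_comm qc in \<open>auto simp: subset_eq\<close>)
  qed
  then show ?thesis using mem by (intro that[of q]) (simp_all add: prime_spec_def)
qed

lemma prime_pres_mult:
  assumes "prime_pres Q" "f \<in> Polys (fst Q)" "h \<in> Polys (fst Q)"
  shows "f * h \<in> rel_ideal Q \<longleftrightarrow> f \<in> rel_ideal Q \<or> h \<in> rel_ideal Q"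
  using assms rel_ideal_mult rel_ideal_mult2 unfolding prime_pres_def by blast

lemma prime_pres_power:
  assumes "prime_pres Q" "f \<in> Polys (fst Q)" "f ^ k \<in> rel_ideal Q"
  shows "f \<in> rel_ideal Q"
  using assms(3)
proof (induction k)
  case 0
  then show ?case using assms(1) by (simp add: prime_pres_def)
next
  case (Suc k)
  then show ?case using prime_pres_mult[OF assms(1,2), of "f ^ k"] assms(2) by auto
qed

lemma prime_pres_prod:
  assumes "prime_pres Q" "finite A" "\<And>x. x \<in> A \<Longrightarrow> f x \<in> Polys (fst Q)" "prod f A \<in> rel_ideal Q"
  shows "\<exists>x\<in>A. f x \<in> rel_ideal Q"
  using assms(2-4)
proof (induction A rule: finite_induct)
  case empty
  then show ?case using assms(1) by (simp add: prime_pres_def)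
next
  case (insert x A)
  have "f x \<in> Polys (fst Q)" "prod f A \<in> Polys (fst Q)" using insert by (auto intro: Poly_prod)
  then show ?case using insert prime_pres_mult[OF assms(1), of "f x" "prod f A"] by auto
qed

lemma rel_ideal_prod:
  assumes wf: "wf_pres Q" and "finite A" "x \<in> A" "\<And>x. x \<in> A \<Longrightarrow> f x \<in> Polys (fst Q)" "f x \<in> rel_ideal Q"
  shows "prod f A \<in> rel_ideal Q"
  using assms(2-) rel_ideal_mult2[OF wf assms(5) Poly_prod, of "A - {x}" f] by (simp add: prod.remove)

lemma rel_ideal_power: "wf_pres Q \<Longrightarrow> f \<in> rel_ideal Q \<Longrightarrow> k > 0 \<Longrightarrow> f ^ k \<in> rel_ideal Q"
  using rel_ideal_mult2[of Q f "f ^ (k - 1)"] rel_ideal_Poly[of Q f]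
  by (cases k) simp_all

lemma eqv_rel_ideal: "wf_pres Q \<Longrightarrow> eqv Q f h \<Longrightarrow> f \<in> rel_ideal Q \<longleftrightarrow> h \<in> rel_ideal Q"
  using rel_ideal_add[of Q "f - h" h] rel_ideal_diff[of Q f "f - h"] by (auto simp: eqv_def)

section \<open>Monomials of weight zero\<close>

context family
begin

abbreviation "divisors \<equiv> {d. d dvd m}"

text \<open>On \<open>Y\<close> the monomial \<open>\<Prod>d. y\<^sub>d ^ k d\<close> of weight \<open>m * j\<close> equals the product of the \<open>f\<^sub>e\<close> with the
  exponents below.  In the quotient of the coordinate ring of \<open>X\<close> by a prime this identity persists:
  if some \<open>y\<^sub>d\<close> that occurs vanishes, both sides do; otherwise it can be checked after
  multiplication by a non-zero factor, expressing all \<open>y\<^sub>d\<close> through \<open>y\<^sub>l\<close> for \<open>l\<close> the least common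
  multiple of the \<open>d\<close> that occur.\<close>

lemma weight_0_monomial:
  assumes Q: "prime_pres Q" "fst Q = fst PX" "snd PX \<subseteq> snd Q"
    and wt: "(\<Sum>d\<in>divisors. k d * (m div d)) = m * j"
  shows "eqv Q (\<Prod>d\<in>divisors. var (C_yd d) ^ k d)
    (\<Prod>e\<in>divisors. F e ^ (e * j - (\<Sum>d\<in>{d. d dvd e}. k d * (e div d))))"
proof -
  have wf: "wf_pres Q" using Q(1) by (simp add: prime_pres_def)
  note Q(2) [simp]
  have XQ: "eqv Q f h" if "eqv PX f h" for f h
    using that Q(2) rel_ideal_mono[OF wf_PX wf _ Q(3)] by (simp add: eqv_def)
  have FQ [simp]: "F e \<in> Polys (fst Q)" for e using F_Poly'(2) Q(2) by simp
  have YQ [simp]: "var (C_yd d) \<in> Polys (fst Q)" if "d dvd m" for d using that by (simp add: Q(2))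
  define N where "N e = e * j - (\<Sum>d\<in>{d. d dvd e}. k d * (e div d))" for e
  let ?M = "\<Prod>d\<in>divisors. var (C_yd d) ^ k d"
  let ?A = "\<Prod>e\<in>divisors. F e ^ N e"
  have poly: "?M \<in> Polys (fst Q)" "?A \<in> Polys (fst Q)" by (intro Poly_prod Poly_power; simp)+
  \<comment> \<open>\<open>T e\<close> is the exponent of \<open>F e\<close> in the denominators of
    the \<open>y_d\<close>. On \<open>Y\<close> the power \<open>y^(m j)\<close> supplies the
    exponent \<open>e j\<close>, so that \<open>N e = e j - T e\<close> remains.\<close>
  define T where "T e = (\<Sum>d\<in>{d. d dvd e}. k d * (e div d))" for e
  have T_m: "m * T e = (\<Sum>d\<in>{d. d dvd e}. e * (k d * (m div d)))" if em: "e dvd m" for e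
    unfolding T_def sum_distrib_left
  proof (rule sum.cong)
    fix d assume "d \<in> {d. d dvd e}"
    then obtain e' where e: "e = d * e'" by (auto elim: dvdE)
    moreover obtain m' where m: "m = e * m'" using em by (rule dvdE)
    moreover have "d \<noteq> 0" using e m m1 by auto
    ultimately show "m * (k d * (e div d)) = e * (k d * (m div d))" by (simp add: mult_ac)
  qed simp
  have sub: "{d. d dvd e} \<subseteq> divisors" if "e dvd m" for e using that dvd_trans by blast
  have ej: "m * (e * j) = (\<Sum>d\<in>divisors. e * (k d * (m div d)))" for e
    using wt by (simp add: sum_distrib_left[symmetric] mult_ac)
  \<comment> \<open>So the subtraction in \<open>N\<close> is never truncated: \<open>m T e\<close>
    is a partial sum of the sum for \<open>m e j\<close>.\<close>
  have T_le: "T e \<le> e * j" if "e dvd m" for e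
  proof -
    have "m * T e \<le> m * (e * j)"
      unfolding T_m[OF that] ej by (rule sum_mono2) (use sub[OF that] in auto)
    then show ?thesis using m1 by simp
  qed
  have N_T: "N e + T e = e * j" if "e dvd m" for e
    using T_le[OF that] by (simp add: N_def T_def)
  \<comment> \<open>The equation of \<open>X\<close> for the pair of 1 and \<open>d\<close>, with
    \<open>y_1 = 1\<close>. It relates the vanishing of \<open>y_d\<close> to that of the
    \<open>F e\<close> with \<open>d\<close> not dividing \<open>e\<close>.\<close>
  have Yd: "eqv Q (var (C_yd d) ^ d) (\<Prod>e\<in>{e. e dvd m \<and> \<not> d dvd e}. F e ^ e)" if "d dvd m" for d
  proof -
    let ?P = "\<Prod>e\<in>{e. e dvd m \<and> \<not> d dvd e}. F e ^ e"
    have 1: "eqv Q (var (C_yd d) ^ d) (var (C_yd 1) * ?P)"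
      using XQ[OF X_eqn[of 1 d]] that by simp
    have 2: "eqv Q (var (C_yd 1) * ?P) (1 * ?P)"
      by (intro eqv_mult wf XQ X_eqn_1 eqv_refl Poly_prod Poly_power FQ)
    show ?thesis using eqv_trans[OF wf 1 2] by (simp only: mult_1_left)
  qed
  define D where "D = {d. d dvd m \<and> k d > 0}"
  have "eqv Q ?M ?A"
  proof (cases "\<exists>d\<in>D. var (C_yd d) \<in> rel_ideal Q")
    case True
    then obtain d where d: "d dvd m" "k d > 0" "var (C_yd d) \<in> rel_ideal Q" by (auto simp: D_def)
    have MQ: "?M \<in> rel_ideal Q"
      using d by (intro rel_ideal_prod[OF wf, of _ d] rel_ideal_power wf) simp_all
    have "(\<Prod>e\<in>{e. e dvd m \<and> \<not> d dvd e}. F e ^ e) \<in> rel_ideal Q"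
      using rel_ideal_power[OF wf d(3) dvd_pos[OF d(1)]] eqv_rel_ideal[OF wf Yd[OF d(1)]] by simp
    then obtain e where e: "e dvd m" "\<not> d dvd e" "F e \<in> rel_ideal Q"
      using prime_pres_prod[OF Q(1), of "{e. e dvd m \<and> \<not> d dvd e}" "\<lambda>e. F e ^ e"]
        prime_pres_power[OF Q(1) FQ] by auto
    \<comment> \<open>As \<open>d\<close> occurs in the monomial but does not divide
      \<open>e\<close>, its term is missing from \<open>T e\<close>; the bound is strict and
      \<open>F e\<close> occurs in \<open>?A\<close>.\<close>
    have "insert d {d. d dvd e} \<subseteq> divisors" using sub[OF e(1)] d(1) by simp
    then have "(\<Sum>d\<in>insert d {d. d dvd e}. e * (k d * (m div d))) \<le> m * (e * j)"
      unfolding ej by (intro sum_mono2) simp_all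
    moreover have "(\<Sum>d\<in>insert d {d. d dvd e}. e * (k d * (m div d))) = e * (k d * (m div d)) + m * T e"
      unfolding T_m[OF e(1)] using finite_subset[OF sub[OF e(1)]] e(2) by (intro sum.insert) simp_all
    moreover have "e * (k d * (m div d)) > 0"
      using e(1) d dvd_pos by (simp add: div_greater_zero_iff dvd_imp_le m1[THEN less_le_trans[OF zero_less_one]])
    ultimately have "m * T e < m * (e * j)" by linarith
    then have "N e > 0" using N_T[OF e(1)] by simp
    then have "?A \<in> rel_ideal Q"
      using e by (intro rel_ideal_prod[OF wf, of _ e] rel_ideal_power wf) simp_all
    with MQ show ?thesis using poly rel_ideal_diff[OF wf] by (simp add: eqv_def)
  next
    case False
    define l where "l = Lcm D"
    have fD: "finite D" by (simp add: D_def)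
    have dl: "d dvd l" if "d \<in> D" for d using that by (simp add: l_def dvd_Lcm)
    have lm: "l dvd m" unfolding l_def by (rule Lcm_least) (simp add: D_def)
    let ?B = "{e. e dvd m \<and> \<not> l dvd e}"
    \<comment> \<open>If \<open>l\<close> does not divide \<open>e\<close>, then some
      \<open>d\<close> in \<open>D\<close> does not divide it either; \<open>F e\<close> is then a
      factor in the formula for \<open>y_d^d\<close> and cannot vanish.\<close>
    have F_nz: "F e \<notin> rel_ideal Q" if e: "e \<in> ?B" for e
    proof
      assume Fe: "F e \<in> rel_ideal Q"
      from e obtain d where d: "d \<in> D" "\<not> d dvd e" unfolding l_def by (metis Lcm_least mem_Collect_eq)
      then have dm: "d dvd m" by (simp add: D_def)
      have "(\<Prod>e\<in>{e. e dvd m \<and> \<not> d dvd e}. F e ^ e) \<in> rel_ideal Q"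
        using Fe e d dvd_pos by (intro rel_ideal_prod[OF wf, of _ e] rel_ideal_power wf) simp_all
      then have "var (C_yd d) ^ d \<in> rel_ideal Q" using eqv_rel_ideal[OF wf Yd[OF dm]] by simp
      then show False using prime_pres_power[OF Q(1) YQ[OF dm]] False d(1) by blast
    qed
    have "k d = 0" if "d \<in> divisors - D" for d using that by (simp add: D_def)
    note k0 = this
    have M_D: "?M = (\<Prod>d\<in>D. var (C_yd d) ^ k d)"
      by (rule prod.mono_neutral_right) (use k0 in \<open>auto simp: D_def\<close>)
    have sum_D: "(\<Sum>d\<in>divisors. k d * G d) = (\<Sum>d\<in>D. k d * G d)" for G
      by (rule sum.mono_neutral_right) (use k0 in \<open>auto simp: D_def\<close>)
    have T_D: "T e = (\<Sum>d\<in>{d \<in> D. d dvd e}. k d * (e div d))" if "e dvd m" for e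
      unfolding T_def using sub[OF that] finite_subset[OF sub[OF that]] k0
      by (intro sum.mono_neutral_right) (auto simp: D_def)
    \<comment> \<open>For \<open>e\<close> a multiple of \<open>l\<close>, every \<open>d\<close>
      that occurs divides \<open>e\<close>: the partial sum is complete, and \<open>F e\<close> has
      exponent 0 in \<open>?A\<close>.\<close>
    have "T e = e * j" if e: "e dvd m" "l dvd e" for e
    proof -
      have "k d = 0" if "d \<in> divisors - {d. d dvd e}" for d
        using that k0[of d] dl[of d] dvd_trans[of d l e] e(2) by blast
      then have "m * T e = m * (e * j)"
        unfolding ej T_m[OF e(1)] using sub[OF e(1)] by (intro sum.mono_neutral_left) simp_all
      then show ?thesis using m1 by simp
    qed
    then have N0: "N e = 0" if "e dvd m" "l dvd e" for e using N_T[OF that(1)] that by simp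
    have A_B: "?A = (\<Prod>e\<in>?B. F e ^ N e)"
      by (rule prod.mono_neutral_right) (use N0 in auto)
    \<comment> \<open>The equations of \<open>X\<close> for the pairs \<open>d | l\<close> express
      \<open>y_l^(l/d)\<close> as \<open>y_d\<close> times a product of nonvanishing
      \<open>F e\<close>; \<open>P\<close> collects these products, each to the power
      \<open>k d\<close>.\<close>
    define P where "P = (\<Prod>d\<in>D. (\<Prod>e\<in>{e. e dvd m \<and> d dvd e \<and> \<not> l dvd e}. F e ^ (e div d)) ^ k d)"
    have "(\<Prod>e\<in>{e. e dvd m \<and> d dvd e \<and> \<not> l dvd e}. F e ^ (e div d)) ^ k d
        = (\<Prod>e\<in>?B. F e ^ (if d dvd e then k d * (e div d) else 0))" for d
    proof -
      have "(\<Prod>e\<in>{e. e dvd m \<and> d dvd e \<and> \<not> l dvd e}. F e ^ (e div d)) ^ k d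
          = (\<Prod>e\<in>{e. e dvd m \<and> d dvd e \<and> \<not> l dvd e}. F e ^ (if d dvd e then k d * (e div d) else 0))"
        unfolding prod_power_distrib power_mult[symmetric] mult.commute[of _ "k d"]
        by (rule prod.cong) (simp_all only: mem_Collect_eq if_True)
      also have "\<dots> = (\<Prod>e\<in>?B. F e ^ (if d dvd e then k d * (e div d) else 0))"
        by (rule prod.mono_neutral_left) auto
      finally show ?thesis .
    qed
    then have "P = (\<Prod>d\<in>D. \<Prod>e\<in>?B. F e ^ (if d dvd e then k d * (e div d) else 0))"
      unfolding P_def by (intro prod.cong refl)
    also have "\<dots> = (\<Prod>e\<in>?B. \<Prod>d\<in>D. F e ^ (if d dvd e then k d * (e div d) else 0))"
      by (rule prod.swap)
    also have "\<dots> = (\<Prod>e\<in>?B. F e ^ T e)"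
    proof (rule prod.cong)
      fix e assume "e \<in> ?B"
      then have "T e = (\<Sum>d\<in>D. if d dvd e then k d * (e div d) else 0)"
        by (simp add: T_D sum.inter_filter[OF fD])
      then show "(\<Prod>d\<in>D. F e ^ (if d dvd e then k d * (e div d) else 0)) = F e ^ T e"
        by (simp only: power_sum)
    qed simp
    finally have P_T: "P = (\<Prod>e\<in>?B. F e ^ T e)" .
    have PQ: "P \<in> Polys (fst Q)" unfolding P_T by (intro Poly_prod Poly_power FQ)
    have P_nz: "P \<notin> rel_ideal Q"
      using prime_pres_prod[OF Q(1), of ?B "\<lambda>e. F e ^ T e"] prime_pres_power[OF Q(1) FQ] F_nz
      unfolding P_T by auto
    have AP: "?A * P = (\<Prod>e\<in>?B. F e ^ e) ^ j"
      unfolding A_B P_T prod.distrib[symmetric] power_add[symmetric] prod_power_distrib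
      unfolding power_mult[symmetric] by (intro prod.cong) (simp_all add: N_T)
    have "eqv Q (\<Prod>d\<in>D. (var (C_yd l) ^ (l div d)) ^ k d)
        (\<Prod>d\<in>D. (var (C_yd d) * (\<Prod>e\<in>{e. e dvd m \<and> d dvd e \<and> \<not> l dvd e}. F e ^ (e div d))) ^ k d)"
      using dl lm by (intro eqv_prod eqv_power wf XQ X_eqn)
    moreover have "(\<Prod>d\<in>D. (var (C_yd l) ^ (l div d)) ^ k d) = (var (C_yd l) ^ l) ^ j"
    proof -
      \<comment> \<open>Dividing the weight condition by \<open>r = m/l\<close> turns
        \<open>m/d\<close> into \<open>l/d\<close>.\<close>
      obtain r where r: "m = l * r" using lm by (rule dvdE)
      then have r0: "r > 0" "l > 0" using m1 by auto
      have "r * (l div d) = m div d" if "d \<in> D" for d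
        using dl[OF that] r by (simp add: div_mult_swap mult.commute)
      then have "r * (\<Sum>d\<in>D. k d * (l div d)) = (\<Sum>d\<in>D. k d * (m div d))"
        unfolding sum_distrib_left by (intro sum.cong) (simp_all add: mult_ac)
      also have "\<dots> = m * j" using wt unfolding sum_D .
      also have "\<dots> = r * (l * j)" unfolding r by (simp only: mult_ac)
      finally have "(\<Sum>d\<in>D. k d * (l div d)) = l * j" using r0 by simp
      moreover have "(\<Prod>d\<in>D. (var (C_yd l) ^ (l div d)) ^ k d) = var (C_yd l) ^ (\<Sum>d\<in>D. k d * (l div d))"
        unfolding power_mult[symmetric] mult.commute[of _ "k _"] power_sum ..
      ultimately show ?thesis by (simp add: power_mult)
    qed
    \<comment> \<open>Both sides times \<open>P\<close> equal \<open>y_l^(l j)\<close>: the monomial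
      by the weight condition, the product of the \<open>F e\<close> because
      \<open>N e + T e = e j\<close>.\<close>
    ultimately have 1: "eqv Q ((var (C_yd l) ^ l) ^ j) (?M * P)"
      by (simp add: M_D P_def power_mult_distrib prod.distrib)
    have 2: "eqv Q ((var (C_yd l) ^ l) ^ j) (?A * P)"
      unfolding AP by (intro eqv_power wf Yd lm)
    have "eqv Q (?M * P) (?A * P)" by (rule eqv_trans[OF wf eqv_sym[OF wf 1] 2])
    then have "(?M - ?A) * P \<in> rel_ideal Q" by (simp add: eqv_def left_diff_distrib)
    then have "?M - ?A \<in> rel_ideal Q"
      using prime_pres_mult[OF Q(1), of "?M - ?A" P] poly PQ P_nz by auto
    then show ?thesis using poly by (simp add: eqv_def)
  qed
  then show ?thesis by (simp add: N_def)
qed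

end

section \<open>Density of the image\<close>

lemma to_fract_of_int [simp]: "to_fract (of_int c :: mpoly) = of_int c"
  using to_fract_ev[of var "of_int c"] by simp

lemma to_fract_of_nat [simp]: "to_fract (of_nat c :: mpoly) = of_nat c"
  using to_fract_of_int[of "int c"] by simp

text \<open>Here the \<open>x i\<close> are independent, f has an m-th root and all m-th roots of
  unity exist; characteristic 0 keeps them distinct.\<close>

type_synonym generic = "mpoly fract alg_closure"

definition gen :: "mpoly \<Rightarrow> generic"
  where "gen f = to_ac (to_fract f)"

lemma gen_simps [simp]:
  "gen (f + h) = gen f + gen h" "gen (f - h) = gen f - gen h" "gen (f * h) = gen f * gen h"
  "gen (- f) = - gen f" "gen 0 = 0" "gen 1 = 1" "gen (f ^ k) = gen f ^ k" "gen (of_nat c) = of_nat c"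
  "gen (of_int i) = of_int i"
  "gen f = gen h \<longleftrightarrow> f = h"
  by (simp_all add: gen_def)

lemma gen_eq_0_iff [simp]: "gen f = 0 \<longleftrightarrow> f = 0" by (simp add: gen_def)

lemma gen_prod: "gen (prod f A) = (\<Prod>x\<in>A. gen (f x))"
  by (simp add: gen_def to_fract_prod to_ac_prod)

lemma ev_gen: "ev (\<lambda>v. gen (var v)) f = gen f"
  using Poly_UNIV[of f] by (induction f rule: Poly_induct) simp_all

section \<open>The grading of polynomials by weight modulo \<open>m\<close>\<close>

context family
begin

definition wX :: "coord \<Rightarrow> nat"
  where "wX v = (case v of C_yd d \<Rightarrow> m div d | _ \<Rightarrow> 0)"

lemma wX_simps [simp]: "wX (C_yd d) = m div d" "(\<nexists>d. v = C_yd d) \<Longrightarrow> wX v = 0"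
  by (simp add: wX_def) (cases v; simp add: wX_def)

lemma wX_V: "v \<in> fst PV \<Longrightarrow> wX v = 0"
  by (cases v) (simp_all add: wX_def)

definition wt :: "(coord \<Rightarrow>\<^sub>0 nat) \<Rightarrow> nat"
  where "wt e = (\<Sum>v\<in>keys e. lookup e v * wX v)"

lemma wt_superset:
  assumes "finite A" "keys e \<subseteq> A"
  shows "wt e = (\<Sum>v\<in>A. lookup e v * wX v)"
  unfolding wt_def using assms by (intro sum.mono_neutral_left) (auto simp: in_keys_iff)

lemma wt_0 [simp]: "wt 0 = 0" by (simp add: wt_def)

lemma wt_add: "wt (e + f) = wt e + wt f"
proof -
  let ?A = "keys e \<union> keys f"
  have "wt (e + f) = (\<Sum>v\<in>?A. lookup (e + f) v * wX v)"
    using Poly_Mapping.keys_add[of e f] by (intro wt_superset) auto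
  then show ?thesis
    by (simp add: wt_superset[of ?A] lookup_add distrib_right sum.distrib)
qed

definition part :: "nat \<Rightarrow> mpoly \<Rightarrow> mpoly"
  where "part k f = (\<Sum>e\<in>{e \<in> keys f. wt e mod m = k}.
    single e (lookup f e))"

text \<open>Both sides are reduced modulo \<open>m\<close>, so that degrees add under products and
  the m-th power of any part has degree 0.\<close>

definition homog :: "nat \<Rightarrow> mpoly \<Rightarrow> bool"
  where "homog k f \<longleftrightarrow> (\<forall>e\<in>keys f. wt e mod m = k mod m)"

lemma sum_parts: "f = (\<Sum>k<m. part k f)"
proof -
  have "(\<Sum>k<m. part k f) = (\<Sum>e\<in>keys f. single e (lookup f e))"
    unfolding part_def using m1 by (intro sum.group) auto
  then show ?thesis using sum_singles[of f] by simp
qed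

lemma part_Polys: "f \<in> Polys S \<Longrightarrow> part k f \<in> Polys S"
  unfolding part_def by (intro Poly_sum Poly_single) (auto simp: Poly_iff)

lemma homog_part:
  assumes "k < m"
  shows "homog k (part k f)"
proof -
  have "keys (part k f) \<subseteq> (\<Union>e\<in>{e \<in> keys f. wt e mod m = k}.
      keys (single e (lookup f e)))"
    unfolding part_def by (rule keys_sum)
  also have "\<dots> \<subseteq> {e. wt e mod m = k}" by (auto split: if_splits)
  finally have "wt e mod m = k" if "e \<in> keys (part k f)" for e
    using that by blast
  then show ?thesis using assms by (simp add: homog_def)
qed

lemma homog_mult: assumes "homog k f" "homog l h" shows "homog (k + l) (f * h)"
  unfolding homog_def
proof
  fix e assume "e \<in> keys (f * h)"
  then obtain u v where *: "u \<in> keys f" "v \<in> keys h" "e = u + v"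
    using keys_mult[of f h] by blast
  have "wt u mod m = k mod m" "wt v mod m = l mod m"
    using assms *(1,2) unfolding homog_def by blast+
  then show "wt e mod m = (k + l) mod m" unfolding *(3) wt_add by (rule mod_add_cong)
qed

lemma homog_power: "homog k f \<Longrightarrow> homog (i * k) (f ^ i)"
  by (induction i) (simp_all add: homog_mult, simp add: homog_def)

lemma monomial_split:
  assumes "keys e \<subseteq> fst PX"
  obtains u where "u \<in> Polys (fst PV)"
    "mon var e = u * (\<Prod>d\<in>divisors. var (C_yd d) ^ lookup e (C_yd d))"
    "wt e = (\<Sum>d\<in>divisors. lookup e (C_yd d) * (m div d))"
proof -
  let ?K = "keys e \<inter> fst PV" and ?Y = "C_yd ` divisors"
  have K: "keys e \<subseteq> ?K \<union> ?Y" using assms by (auto simp: fst_PX)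
  have disj: "?K \<inter> ?Y = {}" by auto
  have inj: "inj_on C_yd divisors" by (simp add: inj_on_def)
  have "mon var e = (\<Prod>v\<in>?K. var v ^ lookup e v) * (\<Prod>v\<in>?Y. var v ^ lookup e v)"
    using mon_superset[OF _ K, of var] prod.union_disjoint[OF _ _ disj] by simp
  also have "(\<Prod>v\<in>?Y. var v ^ lookup e v) = (\<Prod>d\<in>divisors. var (C_yd d) ^ lookup e (C_yd d))"
    using prod.reindex[OF inj] by simp
  finally have 1: "mon var e = (\<Prod>v\<in>?K. var v ^ lookup e v) *
    (\<Prod>d\<in>divisors. var (C_yd d) ^ lookup e (C_yd d))" .
  have "wt e = (\<Sum>v\<in>?K. lookup e v * wX v) + (\<Sum>v\<in>?Y. lookup e v * wX v)"
    using wt_superset[OF _ K] sum.union_disjoint[OF _ _ disj] by simp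
  also have "(\<Sum>v\<in>?K. lookup e v * wX v) = 0"
    by (rule sum.neutral) (simp add: wX_V)
  also have "(\<Sum>v\<in>?Y. lookup e v * wX v) = (\<Sum>d\<in>divisors. lookup e (C_yd d) * (m div d))"
    by (simp add: sum.reindex[OF inj])
  finally have 2: "wt e = (\<Sum>d\<in>divisors. lookup e (C_yd d) * (m div d))" by simp
  have "(\<Prod>v\<in>?K. var v ^ lookup e v) \<in> Polys (fst PV)" by (intro Poly_prod) simp
  then show ?thesis using 1 2 by (rule that)
qed

text \<open>The exponents in \<open>weight_0_monomial\<close> do not depend on the prime, so one
  \<open>u\<close> serves all primes at once. This uniformity is what transfers vanishing from a
  generic point to an arbitrary prime; congruence modulo all primes is congruence up to
  nilpotents.\<close>

lemma weight_0_polynomial: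
  assumes f: "f \<in> Polys (fst PX)" and h: "homog 0 f"
  obtains u where "u \<in> Polys (fst PV)"
    "\<And>Q. prime_pres Q \<Longrightarrow> fst Q = fst PX \<Longrightarrow> snd PX \<subseteq> snd Q \<Longrightarrow> eqv Q f u"
proof -
  have "\<exists>u\<in>Polys (fst PV). \<forall>Q. prime_pres Q \<and> fst Q = fst PX \<and> snd PX \<subseteq> snd Q \<longrightarrow>
      eqv Q (single e (lookup f e)) u" if e: "e \<in> keys f" for e
  proof -
    have eX: "keys e \<subseteq> fst PX" using f e by (simp add: Poly_iff)
    let ?k = "\<lambda>d. lookup e (C_yd d)"
    obtain w where w: "w \<in> Polys (fst PV)" "mon var e = w * (\<Prod>d\<in>divisors. var (C_yd d) ^ ?k d)"
      "wt e = (\<Sum>d\<in>divisors. ?k d * (m div d))"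
      by (rule monomial_split[OF eX])
    have "m dvd wt e" using h e by (simp add: homog_def dvd_eq_mod_eq_0)
    then obtain j where j: "(\<Sum>d\<in>divisors. ?k d * (m div d)) = m * j" unfolding w(3) by (rule dvdE)
    let ?c = "of_int (lookup f e) * w"
    let ?a = "\<Prod>e\<in>divisors. F e ^ (e * j - (\<Sum>d\<in>{d. d dvd e}. ?k d * (e div d)))"
    have "eqv Q (single e (lookup f e)) (?c * ?a)"
      if Q: "prime_pres Q" "fst Q = fst PX" "snd PX \<subseteq> snd Q" for Q
    proof -
      have wf: "wf_pres Q" using Q(1) by (simp add: prime_pres_def)
      have "?c \<in> Polys (fst Q)" using Poly_mono[OF w(1) V_sub(1)] Q(2) by simp
      then have "eqv Q (?c * (\<Prod>d\<in>divisors. var (C_yd d) ^ ?k d)) (?c * ?a)"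
        using weight_0_monomial[OF Q j] by (intro eqv_mult wf eqv_refl)
      then show ?thesis by (simp only: single_eq w(2) mult.assoc)
    qed
    moreover have "?c * ?a \<in> Polys (fst PV)" using w(1) by (intro Poly_mult Poly_prod Poly_power) simp_all
    ultimately show ?thesis by blast
  qed
  then obtain U where U: "\<And>e. e \<in> keys f \<Longrightarrow> U e \<in> Polys (fst PV)"
    "\<And>e Q. e \<in> keys f \<Longrightarrow> prime_pres Q \<Longrightarrow> fst Q = fst PX \<Longrightarrow> snd PX \<subseteq> snd Q \<Longrightarrow>
      eqv Q (single e (lookup f e)) (U e)"
    by metis
  have "eqv Q (\<Sum>e\<in>A. single e (lookup f e)) (sum U A)"
    if Q: "prime_pres Q" "fst Q = fst PX" "snd PX \<subseteq> snd Q" and "finite A" "A \<subseteq> keys f" for A Q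
    using that(4,5)
  proof (induction A rule: finite_induct)
    case empty
    then show ?case using Q(1) by (simp add: prime_pres_def eqv_refl)
  next
    case (insert e A)
    then show ?case using Q U(2)[of e Q] by (simp add: prime_pres_def eqv_add)
  qed
  from this[OF _ _ _ finite_keys order_refl]
  have "eqv Q f (sum U (keys f))"
    if "prime_pres Q" "fst Q = fst PX" "snd PX \<subseteq> snd Q" for Q
    using that by (simp flip: sum_singles)
  then show ?thesis using U(1) by (intro that[of "sum U (keys f)"] Poly_sum)
qed

section \<open>The coordinate ring of \<open>V\<close>\<close>

definition XX :: mpoly
  where "XX = (\<Prod>i\<in>{1..n}. var (C_x i))"

text \<open>Inverting \<open>den\<close> in the polynomials in the \<open>x i\<close> yields the
  functions on \<open>V\<close>: there \<open>t = 1/XX\<close> and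
  \<open>1 - t = (XX - 1)/XX\<close>, and \<open>m\<close> is a unit.\<close>

definition den :: mpoly
  where "den = of_nat m * XX * (XX - 1)"

lemma xs_Poly: "XX \<in> Polys (C_x ` {1..n})" "den \<in> Polys (C_x ` {1..n})"
proof -
  show X: "XX \<in> Polys (C_x ` {1..n})" unfolding XX_def by (intro Poly_prod) simp
  show "den \<in> Polys (C_x ` {1..n})" unfolding den_def by (intro Poly_mult Poly_diff X) simp_all
qed

lemma xs_Poly' [simp]: "XX \<in> Polys (fst PV)" "den \<in> Polys (fst PV)"
  using xs_Poly Poly_mono xs_sub(1) by blast+

lemma V_gens:
  "of_nat m * var C_inv_m - 1 \<in> rel_ideal PV" "var C_t * var C_inv_t - 1 \<in> rel_ideal PV"
  "(1 - var C_t) * var C_inv_1t - 1 \<in> rel_ideal PV" "var C_t * XX - 1 \<in> rel_ideal PV"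
  "i \<in> {1..n} \<Longrightarrow> var (C_x i) * var (C_inv_x i) - 1 \<in> rel_ideal PV"
  by (rule rel_ideal_gen[OF wf_PV]; force simp: V_pres_def base_pres_def XX_def)+

lemma V_combination:
  assumes "f - h = c * r + d * s" "r \<in> rel_ideal PV" "s \<in> rel_ideal PV"
    "c \<in> Polys (fst PV)" "d \<in> Polys (fst PV)" "f \<in> Polys (fst PV)" "h \<in> Polys (fst PV)"
  shows "eqv PV f h"
  using assms by (simp add: eqv_def rel_ideal_add rel_ideal_mult)

lemma den_unit: "\<exists>u\<in>Polys (fst PV). eqv PV (den * u) 1"
proof -
  have "eqv PV (of_nat m * var C_inv_m) 1" "eqv PV (XX * var C_t) 1"
    using V_gens(1,4) by (simp_all add: eqv_def mult.commute)
  \<comment> \<open>Since \<open>XX - 1 = XX (1 - t)\<close>, its inverse is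
    \<open>t/(1 - t)\<close>.\<close>
  moreover have "eqv PV ((XX - 1) * (var C_t * var C_inv_1t)) 1"
    by (rule V_combination[where c = 1 and d = "var C_inv_1t", OF _ V_gens(3,4)])
      (simp_all add: algebra_simps)
  ultimately have "eqv PV (of_nat m * var C_inv_m * (XX * var C_t) * ((XX - 1) * (var C_t * var C_inv_1t))) (1 * 1 * 1)"
    by (intro eqv_mult wf_PV)
  then have "eqv PV (den * (var C_inv_m * var C_t * (var C_t * var C_inv_1t))) 1"
    unfolding den_def by (simp only: mult_ac mult_1_right)
  then show ?thesis by (rule bexI) simp
qed

lemma V_denominators:
  assumes "q \<in> Polys (fst PV)"
  shows "\<exists>k. \<exists>p\<in>Polys (C_x ` {1..n}). eqv PV (q * den ^ k) p"
    (is "\<exists>k. \<exists>p\<in>?A. _ k p")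
proof (rule clear_denominators[OF wf_PV assms])
  show "den \<in> ?A" by (rule xs_Poly)
  show "?A \<subseteq> Polys (fst PV)" using Poly_mono xs_sub(1) by blast
  fix v assume v: "v \<in> fst PV"
  have one: "\<exists>k. \<exists>p\<in>?A. eqv PV (var v * den ^ k) p" if "eqv PV (var v * den) p" "p \<in> Polys (C_x ` {1..n})" for p
    using that by (intro exI[of _ 1] bexI[of _ p]) simp_all
  note X = xs_Poly xs_Poly'
  from v consider "v = C_t" | "v = C_inv_m" | "v = C_inv_t" | "v = C_inv_1t"
    | i where "v = C_x i" "i \<in> {1..n}" | i where "v = C_inv_x i" "i \<in> {1..n}"
    by (auto simp: V_pres_def base_pres_def)
  \<comment> \<open>The numerators are read off from the fractions \<open>1/XX\<close>,
    \<open>XX\<close> and \<open>XX/(XX - 1)\<close> for \<open>t\<close>, \<open>1/t\<close> and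
    \<open>1/(1 - t)\<close>; \<open>c\<close> and \<open>d\<close> are the coefficients with which
    the equations of \<open>V\<close> prove them.\<close>
  then show "\<exists>k. \<exists>p\<in>?A. eqv PV (var v * den ^ k) p"
  proof cases
    case 1
    have "eqv PV (var v * den) (of_nat m * (XX - 1))"
      by (rule V_combination[where c = "of_nat m * (XX - 1)" and d = 0, OF _ V_gens(4,4)])
        (use X v in \<open>simp_all add: 1 den_def algebra_simps\<close>)
    then show ?thesis by (rule one) (use X in \<open>simp_all\<close>)
  next
    case 2
    have "eqv PV (var v * den) (XX * (XX - 1))"
      by (rule V_combination[where c = "XX * (XX - 1)" and d = 0, OF _ V_gens(1,1)])
        (use X v in \<open>simp_all add: 2 den_def algebra_simps\<close>)
    then show ?thesis by (rule one) (use X in \<open>simp_all\<close>)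
  next
    case 3
    have "eqv PV (var v * den) (XX * den)"
      by (rule V_combination[where c = "den * XX" and d = "- (den * var C_inv_t)", OF _ V_gens(2,4)])
        (use X v in \<open>simp_all add: 3 algebra_simps\<close>)
    then show ?thesis by (rule one) (use X in \<open>simp_all\<close>)
  next
    case 4
    have "eqv PV (var v * den) (of_nat m * XX * XX)"
      by (rule V_combination[where c = "of_nat m * XX * XX" and d = "of_nat m * XX * var C_inv_1t", OF _ V_gens(3,4)])
        (use X v in \<open>simp_all add: 4 den_def algebra_simps\<close>)
    then show ?thesis by (rule one) (use X in \<open>simp_all\<close>)
  next
    case 5
    then show ?thesis
      by (intro exI[of _ 0] bexI[of _ "var v"]) (auto intro!: eqv_refl)
  next
    case 6
    let ?r = "\<Prod>j\<in>{1..n} - {i}. var (C_x j)"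
    have r: "?r \<in> Polys (C_x ` {1..n})" "?r \<in> Polys (fst PV)" by (intro Poly_prod; simp)+
    have s: "XX = var (C_x i) * ?r" unfolding XX_def using 6(2) by (intro prod.remove) simp_all
    have "var v * den - of_nat m * ?r * (XX - 1) =
        of_nat m * ?r * (XX - 1) * (var (C_x i) * var (C_inv_x i) - 1) + 0 * (var (C_x i) * var (C_inv_x i) - 1)"
      unfolding den_def 6(1) by (subst (1) s) (simp add: algebra_simps)
    then have "eqv PV (var v * den) (of_nat m * ?r * (XX - 1))"
      by (rule V_combination[OF _ V_gens(5)[OF 6(2)] V_gens(5)[OF 6(2)]]) (use X r v in simp_all)
    then show ?thesis by (rule one) (use X r in \<open>simp_all\<close>)
  qed
qed simp_all

section \<open>Generic points of \<open>X\<close> and separation of weights\<close>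

definition y0 :: generic
  where "y0 = (SOME y. y ^ m = gen (f_ab n a b))"

lemma y0: "y0 ^ m = gen (f_ab n a b)"
proof -
  have "m > 0" using m1 by simp
  then show ?thesis unfolding y0_def by (rule someI_ex[OF nth_root_exists])
qed

text \<open>The generic points of \<open>X\<close>: the \<open>x\<^sub>i\<close> are independent variables and \<open>y = w * y0\<close>.\<close>

definition pnt :: "generic \<Rightarrow> coord \<Rightarrow> generic"
  where "pnt w v = (case v of C_t \<Rightarrow> 1 / gen XX | C_inv_t \<Rightarrow> gen XX | C_inv_m \<Rightarrow> 1 / of_nat m
    | C_inv_1t \<Rightarrow> 1 / (1 - 1 / gen XX) | C_x i \<Rightarrow> gen (var (C_x i)) | C_inv_x i \<Rightarrow> 1 / gen (var (C_x i))
    | C_yd d \<Rightarrow> (w * y0) ^ (m div d) / gen (FF d) | _ \<Rightarrow> 0)"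

lemma pnt_xs: assumes "f \<in> Polys (C_x ` {1..n})" shows "ev (pnt w) f = gen f"
proof -
  have "ev (pnt w) f = ev (\<lambda>v. gen (var v)) f"
    using assms by (rule ev_cong) (auto simp: pnt_def)
  then show ?thesis by (simp add: ev_gen)
qed

lemma x_nz: "var (C_x i) \<noteq> 0"
proof
  assume "var (C_x i) = 0"
  then have "ev (\<lambda>_. 1 :: int) (var (C_x i)) = 0" by simp
  then show False by simp
qed

lemma F_nonzero: "F e \<noteq> 0"
  unfolding f_abe_def using x_nz one_minus_x_nz by (auto simp del: right_minus_eq)

lemma FF_nonzero: "FF d \<noteq> 0"
  using F_nonzero by simp

lemma XX_nz: "XX \<noteq> 0" "XX \<noteq> 1"
proof -
  show "XX \<noteq> 0" using x_nz by (simp add: XX_def)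
  show "XX \<noteq> 1"
  proof
    assume "XX = 1"
    then have "ev (\<lambda>_. 0 :: int) XX = 1" by simp
    then show False using n1 by (simp add: XX_def ev_prod power_0_left)
  qed
qed

text \<open>All equations other than \<open>y_1 = 1\<close> are homogeneous for the scaling by
  \<open>w\<close>; that one is where \<open>w^m = 1\<close> and the choice of \<open>y0\<close> as
  an m-th root of f enter.\<close>

lemma pnt_PX:
  assumes w: "w ^ m = 1" and r: "r \<in> snd PX"
  shows "ev (pnt w) r = 0"
proof -
  have X: "gen XX \<noteq> 0" "gen XX \<noteq> 1"
    using XX_nz gen_simps(10)[of XX 1] by (simp_all only: gen_eq_0_iff gen_simps(6) not_False_eq_True)
  have m0: "of_nat m \<noteq> (0 :: generic)"
    using m1 gen_simps(8)[of m, symmetric] by (simp only: gen_eq_0_iff of_nat_eq_0_iff)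
  have FFg: "gen (FF d) \<noteq> 0" for d using FF_nonzero by (simp only: gen_eq_0_iff not_False_eq_True)
  have Fp: "ev (pnt w) (F e) = gen (F e)" for e by (rule pnt_xs[OF F_Poly]) simp
  from r consider "r \<in> snd (base_pres m)" | "r = var C_t * XX - 1"
    | i where "r = var (C_x i) * var (C_inv_x i) - 1" | "r = var (C_yd 1) - 1"
    | h d where "r = var (C_yd d) ^ (d div h) -
          var (C_yd h) * (\<Prod>e\<in>{e. e dvd m \<and> h dvd e \<and> \<not> d dvd e}. F e ^ (e div h))"
      "h dvd d" "d dvd m"
    unfolding snd_PX V_pres_def snd_conv XX_def by blast
  then show ?thesis
  proof cases
    case 1
    then have "r = of_nat m * var C_inv_m - 1 \<or> r = var C_t * var C_inv_t - 1 \<or>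
        r = (1 - var C_t) * var C_inv_1t - 1"
      by (simp add: base_pres_def)
    moreover have "1 - 1 / gen XX \<noteq> 0" using X by simp
    ultimately show ?thesis using X m0 by (elim disjE) (simp_all add: pnt_def)
  next
    case 2
    have "ev (pnt w) XX = gen XX" by (rule pnt_xs[OF xs_Poly(1)])
    then show ?thesis unfolding 2 ev_diff ev_mult ev_1 ev_var using X by (simp add: pnt_def)
  next
    case 3
    then show ?thesis using x_nz by (simp add: pnt_def)
  next
    case 4
    have "gen (FF 1) = y0 ^ m" by (simp add: y0 f_ab_eq)
    then have "(w * y0) ^ m / gen (FF 1) = 1" using FFg[of 1] w by (simp only: power_mult_distrib) simp
    then show ?thesis by (simp only: 4 ev_diff ev_var ev_1 pnt_def coord.case div_by_1 diff_self)
  next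
    case 5
    let ?N = "\<Prod>e\<in>{e. e dvd m \<and> h dvd e \<and> \<not> d dvd e}. F e ^ (e div h)"
    let ?P = "\<Prod>e\<in>multiples d. F e ^ (e div h)"
    have FFh: "FF h = ?P * ?N" by (rule multiples_split[OF 5(2)])
    have "?P \<noteq> 0" "?N \<noteq> 0" using F_nonzero by simp_all
    then have nz: "gen ?P \<noteq> 0" "gen ?N \<noteq> 0" by (simp_all only: gen_eq_0_iff not_False_eq_True)
    have N: "ev (pnt w) ?N = gen ?N" by (simp add: ev_prod Fp gen_prod)
    have "pnt w (C_yd d) ^ (d div h) = (w * y0) ^ (m div h) / gen (FF d ^ (d div h))"
      by (simp only: pnt_def coord.case power_divide gen_simps(7) div_mult_chain[OF 5(2,3)] flip: power_mult)
    also have "FF d ^ (d div h) = ?P" by (rule pow_div[OF 5(2)])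
    also have "(w * y0) ^ (m div h) / gen ?P = pnt w (C_yd h) * gen ?N"
      unfolding pnt_def coord.case FFh gen_simps(3) using nz by simp
    finally show ?thesis unfolding 5(1) ev_diff ev_mult ev_power ev_var N by simp
  qed
qed

lemma pnt_weight: "pnt w v = w ^ wX v * pnt 1 v"
  by (cases v) (simp_all add: pnt_def wX_def power_mult_distrib)

text \<open>Every monomial is scaled by \<open>w\<close> to the power of its weight, which matters
  only modulo \<open>m\<close>. So the values along the orbit are those of a polynomial in
  \<open>w\<close> of degree below \<open>m\<close>.\<close>

lemma ev_pnt:
  assumes w: "w ^ m = 1"
  shows "ev (pnt w) f = (\<Sum>k<m. ev (pnt 1) (part k f) * w ^ k)"
proof -
  have mon: "mon (pnt w) e = w ^ wt e * mon (pnt 1) e" for e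
    unfolding mon_def wt_def
    by (subst pnt_weight) (simp add: power_mult_distrib prod.distrib power_sum mult.commute flip: power_mult)
  have wmod: "w ^ k = w ^ (k mod m)" for k
    using power_mult[of w m "k div m"] power_add[of w "m * (k div m)" "k mod m"] w by simp
  have "ev (pnt w) (part k f) = w ^ k * ev (pnt 1) (part k f)" for k
    unfolding part_def ev_sum sum_distrib_left
  proof (rule sum.cong)
    fix e assume "e \<in> {e \<in> keys f. wt e mod m = k}"
    then have "w ^ wt e = w ^ k" using wmod[of "wt e"] by simp
    then show "ev (pnt w) (single e (lookup f e)) =
        w ^ k * ev (pnt 1) (single e (lookup f e))"
      by (simp add: mon mult_ac)
  qed simp
  then show ?thesis
    by (subst sum_parts[of f]) (simp add: ev_sum mult.commute)
qed

text \<open>The polynomial in \<open>w\<close> from \<open>ev_pnt\<close> has all m-th roots of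
  unity as zeros, so its coefficients vanish.\<close>

lemma parts_vanish:
  assumes "\<And>w. w ^ m = 1 \<Longrightarrow> ev (pnt w) f = 0" and k: "k < m"
  shows "ev (pnt 1) (part k f) = 0"
proof -
  define \<Phi> where "\<Phi> = (\<Sum>k<m. Polynomial.monom (ev (pnt 1) (part k f)) k)"
  have c: "Polynomial.coeff \<Phi> k = ev (pnt 1) (part k f)"
    using k by (simp add: \<Phi>_def coeff_sum)
  have "Polynomial.degree \<Phi> \<le> m - 1"
    unfolding \<Phi>_def
    by (intro degree_sum_le) (auto intro: order_trans[OF degree_monom_le])
  then have "Polynomial.degree \<Phi> < m" using m1 by simp
  moreover have "Polynomial.poly \<Phi> w = 0" if "w ^ m = 1" for w
    using ev_pnt[OF that, of f] assms(1)[OF that] by (simp add: \<Phi>_def poly_sum poly_monom)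
  moreover have "of_nat m \<noteq> (0 :: generic)"
    using m1 gen_simps(8)[of m, symmetric] by (simp only: gen_eq_0_iff of_nat_eq_0_iff)
  ultimately have "\<Phi> = 0" by (intro roots_of_unity_poly_eq_0)
  then show ?thesis using c by simp
qed

text \<open>This is the integrality of \<open>V\<close>: up to a power of the unit
  \<open>den\<close>, \<open>u\<close> is a polynomial in the \<open>x i\<close>, and these take
  independent values at the generic point.\<close>

lemma V_injective:
  assumes u: "u \<in> Polys (fst PV)" and z: "ev (pnt 1) u = 0"
  shows "u \<in> rel_ideal PV"
proof -
  obtain k p where p: "p \<in> Polys (C_x ` {1..n})" "eqv PV (u * den ^ k) p"
    using V_denominators[OF u] by blast
  have "ev (pnt 1) r = 0" if "r \<in> snd PV" for r
    using pnt_PX[of 1 r] that V_sub(3) by auto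
  then have "ev (pnt 1) (u * den ^ k - p) = 0"
    using ev_rel_ideal[OF wf_PV] p(2) unfolding eqv_def by blast
  then have "gen p = 0" using z by (simp add: pnt_xs[OF p(1)])
  then have den0: "eqv PV (u * den ^ k) 0" using p(2) by simp
  obtain v where v: "v \<in> Polys (fst PV)" "eqv PV (den * v) 1" using den_unit by blast
  have "eqv PV (u * (den * v) ^ k) (u * 1 ^ k)"
    by (intro eqv_mult eqv_power v wf_PV eqv_refl u)
  moreover have "eqv PV (u * den ^ k * v ^ k) (0 * v ^ k)"
    by (intro eqv_mult den0 wf_PV eqv_refl Poly_power v)
  ultimately show ?thesis
    using rel_ideal_diff[OF wf_PV, of "u * (den * v) ^ k" "u * (den * v) ^ k - u"]
    by (simp add: eqv_def power_mult_distrib mult.assoc)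
qed

lemma generic_points_dense:
  assumes f: "f \<in> Polys (fst PX)" and z: "\<And>w. w ^ m = 1 \<Longrightarrow> ev (pnt w) f = 0"
    and p: "p \<in> prime_spec (coord_ring PX)"
  shows "cls PX f \<in> p"
proof -
  note P = prime_pres_of_prime[OF wf_PX p]
  let ?Q = "(fst PX, {f \<in> Polys (fst PX). cls PX f \<in> p})"
  have wfQ: "wf_pres ?Q" using P(1) unfolding prime_pres_def by blast
  have E: "ev (pnt 1) r = 0" if "r \<in> snd PX" for r using pnt_PX that by simp
  note G = prime_pres_of_point[OF wf_PX E]
  let ?G = "(fst PX, {f \<in> Polys (fst PX). ev (pnt 1) f = 0})"
  have "part k f \<in> rel_ideal ?Q" if k: "k < m" for k
  proof -
    let ?h = "part k f ^ m"
    have pk: "part k f \<in> Polys (fst PX)" by (rule part_Polys[OF f])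
    have "homog 0 ?h" using homog_power[OF homog_part[OF k], of m f] by (simp add: homog_def)
    then obtain u where u: "u \<in> Polys (fst PV)"
      and uQ: "\<And>Q. prime_pres Q \<Longrightarrow> fst Q = fst PX \<Longrightarrow> snd PX \<subseteq> snd Q \<Longrightarrow> eqv Q ?h u"
      using weight_0_polynomial[of ?h] pk by (metis Poly_power)
    \<comment> \<open>The same \<open>u\<close> is used twice: it vanishes at the generic point,
      hence on all of \<open>V\<close>, and modulo the given prime this forces \<open>?h\<close> to
      vanish.\<close>
    have "?h - u \<in> rel_ideal ?G" using uQ[OF G(1) _ G(3)] by (simp add: eqv_def)
    then have "ev (pnt 1) (?h - u) = 0" using G(2) by simp
    then have "ev (pnt 1) u = 0" using parts_vanish[OF z k] m1 by (simp add: power_0_left)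
    then have "u \<in> rel_ideal PV" by (rule V_injective[OF u])
    then have "u \<in> rel_ideal ?Q"
      using V_sub P(3) by (intro rel_ideal_mono[OF wf_PV wfQ]) auto
    then have "?h \<in> rel_ideal ?Q" using uQ[OF P(1) _ P(3)] eqv_rel_ideal[OF wfQ] by simp
    then show ?thesis using prime_pres_power[OF P(1), of "part k f" m] pk by simp
  qed
  note parts = this
  have "(\<Sum>k\<in>K. part k f) \<in> rel_ideal ?Q" if "finite K" "K \<subseteq> {..<m}" for K
    using that
    by (induction K rule: finite_induct) (simp_all add: rel_ideal_0[OF wfQ] rel_ideal_add[OF wfQ] parts)
  from this[of "{..<m}"] have "f \<in> rel_ideal ?Q" by (simp flip: sum_parts)
  then show ?thesis using P(2) by simp
qed

lemma pnt_g: "ev (pnt w) g \<noteq> 0"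
proof -
  have "g \<in> Polys (C_x ` {1..n})" unfolding g_def by (intro Poly_prod Poly_diff) simp_all
  then show ?thesis using g_nz by (simp add: pnt_xs)
qed

text \<open>At any point of an open set some \<open>f\<close> with nonvanishing locus inside that
  set is nonzero; such an \<open>f\<close> is nonzero at a generic point, where \<open>g\<close> is
  nonzero too because the \<open>x i\<close> are independent.\<close>

lemma closure_D:
  "zariski (coord_ring PX) closure_of {p \<in> prime_spec (coord_ring PX). cls PX g \<notin> p} = prime_spec (coord_ring PX)"
proof -
  interpret R: cring "coord_ring PX" by (rule coord_cring) simp
  have "\<exists>q. q \<in> prime_spec (coord_ring PX) \<and> cls PX g \<notin> q \<and> q \<in> T"
    if p: "p \<in> T" and T: "openin (zariski (coord_ring PX)) T" for p T
  proof -
    from T obtain E where E: "E \<subseteq> carrier (coord_ring PX)" "T = {p \<in> prime_spec (coord_ring PX). \<not> E \<subseteq> p}"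
      unfolding openin_zariski by blast
    then obtain c where c: "c \<in> E" "c \<notin> p" using p by blast
    obtain f where f: "f \<in> Polys (fst PX)" "c = cls PX f" using coord_carrierE E(1) c(1) by blast
    obtain w where w: "w ^ m = 1" "ev (pnt w) f \<noteq> 0"
      using generic_points_dense[OF f(1), of p] c(2) f(2) p E(2) by blast
    obtain q where q: "q \<in> prime_spec (coord_ring PX)"
      "\<And>f. f \<in> Polys (fst PX) \<Longrightarrow> cls PX f \<in> q \<longleftrightarrow> ev (pnt w) f = 0"
      using point_prime[OF wf_PX pnt_PX[OF w(1)]] by blast
    have "cls PX g \<notin> q" "c \<notin> q" using q(2) pnt_g w(2) f by simp_all
    then show ?thesis using q(1) c(1) E(2) by blast
  qed
  then show ?thesis
    unfolding closure_of_def R.zariski_topspace by blast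
qed

end

section \<open>The open immersion and its equivariance\<close>

text \<open>The inverse is known only through its existence. Its coordinates are computed from the
  fact that pulling back to \<open>S\<close> and then along \<open>G\<close> is the identity on
  sections over \<open>D\<close>.\<close>

lemma (in inverts_element) inverse_regular:
  assumes inv: "lrs_inverse (Spec S) (open_subspace (Spec R) D) (Spec_map R S h) G" and c: "c \<in> carrier R"
  shows "pb G (prime_spec S) (regular S (prime_spec S) (h c)) = regular R D c"
proof -
  have pre: "preim (Spec S) (spec_pt R h) D = prime_spec S"
    using spec_pt_D by (auto simp: preim_spec_pt)
  have "openin (rs_top (open_subspace (Spec R) D)) D"
    using D_open openin_open_subspace[of "Spec R" D D] by (simp add: Spec_simps(1))
  moreover have "regular R D c \<in> carrier (rs_sec (open_subspace (Spec R) D) D)"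
    using R.regular_carrier[OF D_open c] by (simp add: Spec_simps)
  ultimately have "pb G (preim (Spec S) (pt (Spec_map R S h)) D) (pb (Spec_map R S h) D (regular R D c)) = regular R D c"
    using inv unfolding lrs_inverse_def eq_morph_def comp_morph_def id_morph_def by simp
  then show ?thesis by (simp add: Spec_map_simps(1) Spec_map_regular[OF c] pre)
qed

lemma ev_weighted_id:
  assumes "f \<in> Polys S" "\<And>v. v \<in> S \<Longrightarrow> w v = 0"
  shows "ev (weighted w) f = f"
  using ev_cong[OF assms(1), of "weighted w" var] assms(2) by (simp add: weighted_def)

lemma subst_ok_weightedI:
  assumes wf: "wf_pres P" and rel: "\<And>r. r \<in> snd P \<Longrightarrow> ev (weighted w) r \<in> rel_ideal (mu_prod m 1 P)"
  shows "subst_ok (mu_prod m 1 P) P (weighted w)"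
proof -
  have "var v \<in> Polys (insert (C_z 1) (fst P))" if "v \<in> fst P" for v using that by simp
  then show ?thesis
    using rel unfolding subst_ok_def weighted_def by (simp add: wf wf_mu_prod)
qed

context family
begin

lemma g_prime_iff:
  assumes p: "p \<in> prime_spec (coord_ring PX)"
  shows "cls PX g \<notin> p \<longleftrightarrow> (\<forall>i\<in>{1..n}. cls PX (1 - var (C_x i)) \<notin> p)"
proof -
  interpret R: cring "coord_ring PX" by (rule coord_cring) simp
  have P: "1 - var (C_x i) \<in> Polys (fst PX)" if "i \<in> {1..n}" for i using that by simp
  have "cls PX (\<Prod>i\<in>I. 1 - var (C_x i)) \<notin> p \<longleftrightarrow> (\<forall>i\<in>I. cls PX (1 - var (C_x i)) \<notin> p)"
    if "finite I" "I \<subseteq> {1..n}" for I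
    using that
  proof (induction I rule: finite_induct)
    case empty
    then show ?case using R.primeD(3)[OF p] by (simp add: cls_1)
  next
    case (insert i I)
    have "(\<Prod>i\<in>I. 1 - var (C_x i)) \<in> Polys (fst PX)" using insert P by (intro Poly_prod) blast
    then have "cls PX (\<Prod>i\<in>insert i I. 1 - var (C_x i)) =
        cls PX (1 - var (C_x i)) \<otimes>\<^bsub>coord_ring PX\<^esub> cls PX (\<Prod>i\<in>I. 1 - var (C_x i))"
      "cls PX (\<Prod>i\<in>I. 1 - var (C_x i)) \<in> carrier (coord_ring PX)"
      "cls PX (1 - var (C_x i)) \<in> carrier (coord_ring PX)"
      using insert(1,2,4) P[of i] by (simp_all add: cls_ops(2) cls_ops(1)[OF _ _ Poly_0])
    then show ?case using R.primeD(5)[OF p] insert by simp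
  qed
  then show ?thesis unfolding g_def by simp
qed

section \<open>The two actions and the equivariance\<close>

definition wY :: "coord \<Rightarrow> nat"
  where "wY v = (if v = C_y then 1 else 0)"

lemma mu_rel:
  assumes "wf_pres P"
  shows "var (C_z 1) ^ m - 1 \<in> rel_ideal (mu_prod m 1 P)"
  by (rule rel_ideal_gen[OF wf_mu_prod[OF assms]]) simp

lemma weighted_Y: "subst_ok (mu_prod m 1 PY) PY (weighted wY)"
proof (rule subst_ok_weightedI)
  note wf = wf_mu_prod[OF wf_PY, of m 1]
  let ?U = "fst PV \<union> C_inv_1x ` {1..n}"
  have U: "ev (weighted wY) f = f" if "f \<in> Polys ?U" for f
    using that by (rule ev_weighted_id) (auto simp: wY_def)
  fix r assume r: "r \<in> snd PY"
  then have rY: "r \<in> rel_ideal (mu_prod m 1 PY)" by (intro rel_ideal_gen wf) simp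
  from r consider "r \<in> snd PV" | i where "i \<in> {1..n}" "r = (1 - var (C_x i)) * var (C_inv_1x i) - 1"
    | "r = var C_y ^ m - f_ab n a b" by (auto simp: snd_PY)
  then show "ev (weighted wY) r \<in> rel_ideal (mu_prod m 1 PY)"
  proof cases
    case 1
    then have "r \<in> Polys ?U" using wf_PV Poly_mono[of r "fst PV" ?U] by (auto simp: wf_pres_def)
    then show ?thesis using U rY by simp
  next
    case 2
    then have "r \<in> Polys ?U" by simp
    then show ?thesis using U rY by simp
  next
    case 3
    have "f_ab n a b \<in> Polys ?U" using Poly_mono[OF f_ab_Poly(1)] by blast
    then have "ev (weighted wY) r = var C_y ^ m * (var (C_z 1) ^ m - 1) + r"
      unfolding 3 by (simp add: U weighted_def wY_def algebra_simps power_mult_distrib)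
    moreover have "var C_y ^ m \<in> Polys (fst (mu_prod m 1 PY))" by simp
    ultimately show ?thesis using rY mu_rel[OF wf_PY] by (simp only: rel_ideal_add rel_ideal_mult wf)
  qed
qed simp

lemma ev_weighted_V: "f \<in> Polys (fst PV) \<Longrightarrow> ev (weighted wX) f = f"
  by (rule ev_weighted_id[OF _ wX_V])

text \<open>Both sides of the equation for \<open>h\<close> and \<open>d\<close> have weight
  \<open>m/h\<close>, so it is multiplied by \<open>z^(m/h)\<close>; the equation
  \<open>y_1 = 1\<close> compares weight \<open>m\<close> with weight 0 and uses
  \<open>z^m = 1\<close>.\<close>

lemma weighted_X: "subst_ok (mu_prod m 1 PX) PX (weighted wX)"
proof (rule subst_ok_weightedI)
  note wf = wf_mu_prod[OF wf_PX, of m 1]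
  fix r assume r: "r \<in> snd PX"
  then have rX: "r \<in> rel_ideal (mu_prod m 1 PX)" by (intro rel_ideal_gen wf) simp
  from r consider "r \<in> snd PV" | "r = var (C_yd 1) - 1"
    | h d where "r = var (C_yd d) ^ (d div h) -
          var (C_yd h) * (\<Prod>e\<in>{e. e dvd m \<and> h dvd e \<and> \<not> d dvd e}. F e ^ (e div h))"
      "h dvd d" "d dvd m"
    unfolding snd_PX by blast
  then show "ev (weighted wX) r \<in> rel_ideal (mu_prod m 1 PX)"
  proof cases
    case 1
    then have "r \<in> Polys (fst PV)" using wf_PV by (auto simp: wf_pres_def)
    then show ?thesis using ev_weighted_V rX by simp
  next
    case 2
    have "ev (weighted wX) r = var (C_yd 1) * (var (C_z 1) ^ m - 1) + r"
      unfolding 2 by (simp add: weighted_def algebra_simps)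
    moreover have "var (C_yd 1) \<in> Polys (fst (mu_prod m 1 PX))" by simp
    ultimately show ?thesis using rX mu_rel[OF wf_PX] by (simp only: rel_ideal_add rel_ideal_mult wf)
  next
    case 3
    let ?N = "\<Prod>e\<in>{e. e dvd m \<and> h dvd e \<and> \<not> d dvd e}. F e ^ (e div h)"
    have "?N \<in> Polys (fst PV)" by (intro Poly_prod) simp
    then have "ev (weighted wX) r = var (C_z 1) ^ (m div h) * r"
      unfolding 3(1) by (simp add: ev_weighted_V weighted_def power_mult_distrib div_mult_chain[OF 3(2,3)]
          right_diff_distrib mult.assoc flip: power_mult)
    moreover have "var (C_z 1) ^ (m div h) \<in> Polys (fst (mu_prod m 1 PX))" by simp
    ultimately show ?thesis using rX by (simp only: rel_ideal_mult wf)
  qed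
qed simp

lemma base_coords: "fst (base_pres m) \<subseteq> fst PV" "v \<in> fst (base_pres m) \<Longrightarrow> wX v = 0 \<and> wY v = 0"
  by (auto simp: V_pres_def base_pres_def wX_def wY_def)

lemma ev_weighted_GG: "ev (weighted wY) (GG d) = GG d"
proof (rule ev_weighted_id)
  show "GG d \<in> Polys (fst PY - {C_y})"
    unfolding Finv_def by (intro Poly_prod Poly_power Poly_mult Poly_uminus) auto
qed (simp add: wY_def)

text \<open>As \<open>y_d\<close> is \<open>y^(m/d)\<close> times a factor of weight 0, its weight
  is forced by weight 1 for y: both composites send it to
  \<open>z^(m/d) y^(m/d) GG d\<close>.\<close>

lemma \<iota>_equivariant:
  "mu_equivariant m PY PX (Aff_map (mu_prod m 1 PY) PY (weighted wY))
    (Aff_map (mu_prod m 1 PX) PX (weighted wX)) (Aff_map PY PX \<iota>s)"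
proof -
  let ?F = "\<iota>s(C_z 1 := var (C_z 1))"
  have "ev (weighted wY) (\<iota>s v) = ev ?F (weighted wX v)" if v: "v \<in> fst PX" for v
  proof -
    from v consider "v \<in> fst PV" | d where "v = C_yd d" by (auto simp: fst_PX)
    then show ?thesis
    proof cases
      case 1
      then have "v \<noteq> C_y" "v \<noteq> C_z 1" by auto
      then show ?thesis using 1 by (simp add: \<iota>s_V weighted_def wX_V wY_def)
    next
      case 2
      then show ?thesis using ev_weighted_GG
        by (simp add: weighted_def[of wX] power_mult_distrib)
          (simp add: weighted_def wY_def power_mult_distrib)
    qed
  qed
  then have "eq_morph (Aff (mu_prod m 1 PY)) (Aff PX)
     (comp_morph (Aff PY) (Aff_map PY PX \<iota>s) (Aff_map (mu_prod m 1 PY) PY (weighted wY)))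
     (comp_morph (Aff (mu_prod m 1 PX)) (Aff_map (mu_prod m 1 PX) PX (weighted wX))
       (Aff_map (mu_prod m 1 PY) (mu_prod m 1 PX) ?F))"
    by (intro Aff_map_comp_eq weighted_Y weighted_X \<iota>s_ok subst_ok_id_times) simp_all
  moreover have "id_times m 1 PY 1 PX (Aff_map PY PX \<iota>s) (Aff_map (mu_prod m 1 PY) (mu_prod m 1 PX) ?F)"
    by (rule id_times_Aff_map[OF \<iota>s_ok]) simp
  ultimately show ?thesis unfolding mu_equivariant_def by blast
qed

end

theorem proposition3p2p5:
  fixes n m :: nat and a b :: "nat \<Rightarrow> nat"
  assumes "n \<ge> 1" and "m \<ge> 1"
    and "\<And>i. i \<in> {1..n} \<Longrightarrow> a i \<le> b i"
  defines "PX \<equiv> X_pres n m a b" and "PY \<equiv> Y_pres n m a b"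
    and "W \<equiv> {p \<in> aff_points (X_pres n m a b).
                \<forall>i\<in>{1..n}. cls (X_pres n m a b) (1 - var (C_x i)) \<notin> p}"
  shows "\<exists>\<iota> \<kappa> \<alpha> \<beta>.
    open_immersion (Aff PY) (Aff PX) \<iota> \<and>
    (\<forall>d. d dvd m \<longrightarrow>
       cls PY (\<Prod>e\<in>{e. d dvd e \<and> e dvd m}. f_abe n m a b e ^ (e div d)) \<in> Units (coord_ring PY)) \<and>
    (\<forall>v \<in> fst (V_pres n m). pulls_back PY (aff_points PY) PX \<iota> v (cls PY (var v))) \<and>
    (\<forall>d. d dvd m \<longrightarrow>
       pulls_back PY (aff_points PY) PX \<iota> (C_yd d)
         (cls PY (var C_y ^ (m div d)) \<otimes>\<^bsub>coord_ring PY\<^esub>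
           inv\<^bsub>coord_ring PY\<^esub> cls PY (\<Prod>e\<in>{e. d dvd e \<and> e dvd m}. f_abe n m a b e ^ (e div d)))) \<and>
    openin (rs_top (Aff PX)) W \<and> rs_top (Aff PX) closure_of W = aff_points PX \<and>
    lrs_inverse (Aff PY) (open_subspace (Aff PX) W) \<iota> \<kappa> \<and>
    (\<forall>v \<in> fst (V_pres n m). pulls_back PX W PY \<kappa> v (cls PX (var v))) \<and>
    pulls_back PX W PY \<kappa> C_y (cls PX (var (C_yd m) * f_abe n m a b m)) \<and>
    mu_action m PY \<alpha> \<and>
    given_by (mu_prod m 1 PY) PY \<alpha>
      (\<lambda>v. if v = C_y then cls (mu_prod m 1 PY) (var (C_z 1) * var C_y)
           else cls (mu_prod m 1 PY) (var v)) \<and>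
    mu_action m PX \<beta> \<and> mu_equivariant m PY PX \<alpha> \<beta> \<iota>"
proof -
  interpret family n m a b by unfold_locales (use assms(1-3) in auto)
  note PX = PX_def[symmetric] and PY = PY_def[symmetric]
  interpret inverts_element "coord_ring PX" "coord_ring PY" \<theta> "cls PX g"
    unfolding PX_def PY_def by (rule Y_localization)
  have points: "aff_points PX = prime_spec (coord_ring PX)" "aff_points PY = prime_spec (coord_ring PY)"
    by (simp_all add: Aff_def R.Spec_points S.Spec_points)
  \<comment> \<open>A prime avoids all \<open>1 - x i\<close> exactly when it avoids their product
    \<open>g\<close>.\<close>
  have W: "W = D"
    unfolding W_def PX points using g_prime_iff by (auto simp: PX)
  define \<iota> where "\<iota> = Aff_map PY PX \<iota>s"
  note ok = \<iota>s_ok[folded PX_def PY_def]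
  have \<iota>: "\<iota> = Spec_map (coord_ring PX) (coord_ring PY) \<theta>"
    by (simp add: \<iota>_def Aff_map_def PX PY)
  obtain \<kappa> where \<kappa>: "lrs_inverse (Aff PY) (open_subspace (Aff PX) W) \<iota> \<kappa>"
    using Spec_map_open_immersion unfolding Aff_def W \<iota> by blast
  define \<alpha> where "\<alpha> = Aff_map (mu_prod m 1 PY) PY (weighted wY)"
  define \<beta> where "\<beta> = Aff_map (mu_prod m 1 PX) PX (weighted wX)"
  note okY = weighted_Y[folded PY_def] and okX = weighted_X[folded PX_def]
  have V: "v \<in> fst PX" "v \<in> fst PY" if "v \<in> fst (V_pres n m)" for v
    using that V_sub unfolding PX_def PY_def by blast+
  have W_open: "openin (rs_top (Aff PX)) W"
    unfolding W Aff_def Spec_simps by (rule D_open)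
  have immersion: "open_immersion (Aff PY) (Aff PX) \<iota>"
    unfolding open_immersion_def using Aff_map_morphism[OF ok] W_open \<kappa> \<iota>_def by blast
  have closure: "rs_top (Aff PX) closure_of W = aff_points PX"
    using closure_D unfolding points W by (simp add: Aff_def Spec_simps PX)
  have units: "\<forall>d. d dvd m \<longrightarrow>
       cls PY (\<Prod>e\<in>{e. d dvd e \<and> e dvd m}. f_abe n m a b e ^ (e div d)) \<in> Units (coord_ring PY)"
    using FF_Unit(1) unfolding PY_def by blast
  have \<iota>_V: "\<forall>v \<in> fst (V_pres n m). pulls_back PY (aff_points PY) PX \<iota> v (cls PY (var v))"
  proof
    fix v assume v: "v \<in> fst (V_pres n m)"
    show "pulls_back PY (aff_points PY) PX \<iota> v (cls PY (var v))"
      using Aff_map_pulls_back[OF ok V(1)[OF v]] unfolding \<iota>_def \<iota>s_V[OF v] .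
  qed
  have \<iota>_yd: "\<forall>d. d dvd m \<longrightarrow>
       pulls_back PY (aff_points PY) PX \<iota> (C_yd d)
         (cls PY (var C_y ^ (m div d)) \<otimes>\<^bsub>coord_ring PY\<^esub>
           inv\<^bsub>coord_ring PY\<^esub> cls PY (\<Prod>e\<in>{e. d dvd e \<and> e dvd m}. f_abe n m a b e ^ (e div d)))"
  proof (intro allI impI)
    fix d assume d: "d dvd m"
    have "cls PY (\<iota>s (C_yd d)) = cls PY (var C_y ^ (m div d)) \<otimes>\<^bsub>coord_ring PY\<^esub> cls PY (GG d)"
      unfolding PY_def \<iota>s_yd by (rule cls_ops(2)[OF wf_PY]) simp_all
    then show "pulls_back PY (aff_points PY) PX \<iota> (C_yd d)
         (cls PY (var C_y ^ (m div d)) \<otimes>\<^bsub>coord_ring PY\<^esub> inv\<^bsub>coord_ring PY\<^esub> cls PY (FF d))"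
      using Aff_map_pulls_back[OF ok, of "C_yd d"] d FF_Unit(2)[folded PY_def] by (simp add: \<iota>_def PX_def)
  qed
  \<comment> \<open>A coordinate of \<open>Y\<close> that is the image of a function
    \<open>f\<close> on \<open>X\<close> becomes \<open>f\<close> on \<open>W\<close>. This is
    applied to the coordinates of \<open>V\<close> and to y, the image of
    \<open>y_m f_m\<close>.\<close>
  have \<kappa>_reg: "pulls_back PX W PY \<kappa> v (cls PX f)"
    if "f \<in> Polys (fst PX)" "cls PY (ev \<iota>s f) = cls PY (var v)" for f v
  proof -
    have "cls PX f \<in> carrier (coord_ring PX)"
      unfolding PX_def by (rule cls_ops(1)[OF wf_PX _ Poly_0]) (use that(1) in \<open>simp add: PX_def\<close>)
    moreover have "\<theta> (cls PX f) = cls PY (var v)"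
      using poly_hom_cls[OF ok that(1)] that(2) by (simp add: PX PY)
    moreover have "lrs_inverse (Spec (coord_ring PY)) (open_subspace (Spec (coord_ring PX)) D)
        (Spec_map (coord_ring PX) (coord_ring PY) \<theta>) \<kappa>"
      using \<kappa> unfolding Aff_def W \<iota> .
    ultimately show ?thesis
      using inverse_regular[of \<kappa> "cls PX f"] unfolding pulls_back_def points W by simp
  qed
  have \<kappa>_V: "\<forall>v \<in> fst (V_pres n m). pulls_back PX W PY \<kappa> v (cls PX (var v))"
  proof
    fix v assume v: "v \<in> fst (V_pres n m)"
    show "pulls_back PX W PY \<kappa> v (cls PX (var v))"
      by (rule \<kappa>_reg) (simp_all only: Poly_var V(1)[OF v] ev_var \<iota>s_V[OF v])
  qed
  have \<kappa>_y: "pulls_back PX W PY \<kappa> C_y (cls PX (var (C_yd m) * f_abe n m a b m))"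
  proof (rule \<kappa>_reg)
    show "var (C_yd m) * F m \<in> Polys (fst PX)" unfolding PX_def by simp
    show "cls PY (ev \<iota>s (var (C_yd m) * F m)) = cls PY (var C_y)"
      unfolding PY_def by (rule eqv_cls[OF wf_PY \<iota>s_y])
  qed
  have Z: "C_z j \<notin> fst PX" "C_z j \<notin> fst PY" for j unfolding PX_def PY_def by simp_all
  have bX: "v \<in> fst PX \<and> wX v = 0" and bY: "v \<in> fst PY \<and> wY v = 0" if "v \<in> fst (base_pres m)" for v
    using that base_coords V by blast+
  have actY: "mu_action m PY \<alpha>"
    unfolding \<alpha>_def by (rule weighted_action[OF okY Z(2) Z(2) bY])
  have actX: "mu_action m PX \<beta>"
    unfolding \<beta>_def by (rule weighted_action[OF okX Z(1) Z(1) bX])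
  have \<alpha>: "given_by (mu_prod m 1 PY) PY \<alpha>
      (\<lambda>v. if v = C_y then cls (mu_prod m 1 PY) (var (C_z 1) * var C_y)
           else cls (mu_prod m 1 PY) (var v))"
    unfolding \<alpha>_def by (rule Aff_map_given_by[OF okY]) (simp add: weighted_def wY_def)
  have equi: "mu_equivariant m PY PX \<alpha> \<beta> \<iota>"
    using \<iota>_equivariant by (simp only: \<alpha>_def \<beta>_def \<iota>_def PX PY)
  show ?thesis
    by (rule exI[of _ \<iota>], rule exI[of _ \<kappa>], rule exI[of _ \<alpha>], rule exI[of _ \<beta>], intro conjI)
      (fact immersion units \<iota>_V \<iota>_yd W_open closure \<kappa> \<kappa>_V \<kappa>_y actY \<alpha> actX equi)+
qed

end
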